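(* Let $0<\alpha_2<\alpha_1<1$, $c_1>0$, $c_2\ge0$, $c_1+c_2=1$. The inter-phase times of the mixed time-changed Erlang queue are independent and identically distributed, and, with $\mathcal P^{\alpha_1,\alpha_2}$ denoting a generic inter-phase time, for $t>0$ $$\Pr(\mathcal P^{\alpha_1,\alpha_2}>t)=\sum_{r=0}^\infty\Big(-\frac{c_2}{c_1}\Big)^rt^{(\alpha_1-\alpha_2)r}E^{r+1}_{\alpha_1,(\alpha_1-\alpha_2)r+1}\Big(-\frac{k\mu}{c_1}t^{\alpha_1}\Big)-\sum_{r=0}^\infty\Big(-\frac{c_2}{c_1}\Big)^{r+1}t^{(\alpha_1-\alpha_2)(r+1)}E^{r+1}_{\alpha_1,(\alpha_1-\alpha_2)(r+1)+1}\Big(-\frac{k\mu}{c_1}t^{\alpha_1}\Big).$$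
   Context: Parameters: $\lambda>0$, $\mu>0$, $k\in\mathbb N=\{1,2,\dots\}$. Erlang queue: single-server queue with Poisson arrivals of rate $\lambda$, each service consisting of $k$ successive phases, each exponential with parameter $k\mu$, all independent. $\mathcal Q(t)=(\mathcal N(t),\mathcal S(t))$, where $\mathcal N(t)$ is the number of customers in the system and $\mathcal S(t)$ is the phase of the customer being served if $\mathcal N(t)>0$ (phases are counted down: service starts at phase $k$ and ends upon completion of phase $1$), with $\mathcal S(t)=0$ if $\mathcal N(t)=0$. Thus $\mathcal Q$ is the continuous-time Markov chain on $\mathcal H_0=\mathcal H\cup\{(0,0)\}$, $\mathcal H=\{(n,s)\in\mathbb N\times\mathbb N: s\le k\}$, with $\mathcal Q(0)=(0,0)$ and transition rates: $(0,0)\to(1,k)$ at rate $\lambda$; $(n,s)\to(n+1,s)$ at rate $\lambda$; $(n,s)\to(n,s-1)$ at rate $k\mu$ if $s\ge2$; $(n,1)\to(n-1,k)$ at rate $k\mu$ if $n\ge2$; $(1,1)\to(0,0)$ at rate $k\mu$. Inverse mixed stable subordinator: $\{D_{\alpha_1,\alpha_2}(t)\}_{t\ge0}$ is the nondecreasing Lévy process (started at $0$) with $\mathbb E(e^{-zD_{\alpha_1,\alpha_2}(t)})=e^{-t(c_1z^{\alpha_1}+c_2z^{\alpha_2})}$, $z>0$; $Y_{\alpha_1,\alpha_2}(t)=\inf\{s\ge0:D_{\alpha_1,\alpha_2}(s)>t\}$, $t>0$, $Y_{\alpha_1,\alpha_2}(0)=0$. Mixed time-changed Erlang queue: $\mathcal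 Q^{\alpha_1,\alpha_2}(t)=\mathcal Q(Y_{\alpha_1,\alpha_2}(t))$, with $\mathcal Q$ and $Y_{\alpha_1,\alpha_2}$ independent. An inter-phase time is the duration, in $\mathcal Q^{\alpha_1,\alpha_2}$, of a single service phase, from the instant the phase starts being served to the instant it is completed. Three-parameter Mittag-Leffler function: $E^\gamma_{\alpha,\beta}(t)=\sum_{r=0}^\infty\frac{\Gamma(\gamma+r)t^r}{r!\,\Gamma(\gamma)\Gamma(\alpha r+\beta)}$, $t\in\mathbb R$, $\alpha,\beta,\gamma>0$. Convention $0^0=1$. *)

theory Defs
  imports "HOL-Probability.Probability"
begin

section \<open>Continuous-time Markov chains\<close>

text \<open>
  Rates \<open>q x y\<close> are given for \<open>x \<noteq> y\<close>, with \<open>q x x = 0\<close>. The definition is the jump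
  chain/holding time one, for chains without absorbing states: \<open>Z\<close> is the jump chain, with
  transition probabilities \<open>q x y / exit_rate q x\<close>, and given \<open>Z\<close> the holding times \<open>S i\<close> are
  independent and exponential with rates \<open>exit_rate q (Z i)\<close>. That every time lies in
  some holding interval expresses non-explosion, which is automatic for bounded rates.
\<close>

definition exit_rate :: "('s \<Rightarrow> 's \<Rightarrow> real) \<Rightarrow> 's \<Rightarrow> real" where
  "exit_rate q x = (\<Sum>\<^sub>\<infinity>y. q x y)"

definition (in prob_space) ctmc ::
    "('s::countable \<Rightarrow> 's \<Rightarrow> real) \<Rightarrow> 's \<Rightarrow> (real \<Rightarrow> 'a \<Rightarrow> 's) \<Rightarrow> bool" where
  "ctmc q x0 X \<longleftrightarrow>
    (\<forall>t\<ge>0. random_variable (count_space UNIV) (X t)) \<and>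
    (\<exists>Z S.
      (\<forall>n::nat. random_variable (count_space UNIV) (Z n)) \<and>
      (\<forall>n::nat. random_variable borel (S n)) \<and>
      (\<forall>n z s. (\<forall>i<n. 0 \<le> s i) \<longrightarrow>
        prob {\<omega> \<in> space M. (\<forall>i\<le>n. Z i \<omega> = z i) \<and> (\<forall>i<n. s i < S i \<omega>)} =
          (if z 0 = x0 then
             (\<Prod>i<n. q (z i) (z (Suc i)) / exit_rate q (z i) * exp (- exit_rate q (z i) * s i))
           else 0)) \<and>
      (AE \<omega> in M. \<forall>t\<ge>0. \<exists>n.
        (\<Sum>i<n. S i \<omega>) \<le> t \<and> t < (\<Sum>i<Suc n. S i \<omega>) \<and> X t \<omega> = Z n \<omega>))"


section \<open>The Erlang queue\<close>

definition busy_states :: "nat \<Rightarrow> (nat \<times> nat) set" where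
  "busy_states k = {(n, s). 1 \<le> n \<and> 1 \<le> s \<and> s \<le> k}"

text \<open>The state that follows the completion of the current phase in the busy state \<open>(n, s)\<close>.\<close>

fun after_phase :: "nat \<Rightarrow> nat \<times> nat \<Rightarrow> nat \<times> nat" where
  "after_phase k (n, s) =
    (if 2 \<le> s then (n, s - 1) else if 2 \<le> n then (n - 1, k) else (0, 0))"

definition erlang_rate :: "real \<Rightarrow> real \<Rightarrow> nat \<Rightarrow> nat \<times> nat \<Rightarrow> nat \<times> nat \<Rightarrow> real" where
  "erlang_rate lam mu k x y =
    (if x = (0, 0) then (if y = (1, k) then lam else 0)
     else if x \<in> busy_states k then
       (if y = (fst x + 1, snd x) then lam
        else if y = after_phase k x then real k * mu
        else 0)
     else 0)"

definition (in prob_space) erlang_queue ::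
    "real \<Rightarrow> real \<Rightarrow> nat \<Rightarrow> (real \<Rightarrow> 'a \<Rightarrow> nat \<times> nat) \<Rightarrow> bool" where
  "erlang_queue lam mu k Q \<longleftrightarrow> ctmc (erlang_rate lam mu k) (0, 0) Q"


section \<open>Phases along a path of a queue\<close>

text \<open>
  A path is piecewise constant, so the left limit at \<open>t\<close> is the state
  occupied on some interval to the left of \<open>t\<close>. Arrivals \<open>(n, s) \<rightarrow> (n + 1, s)\<close> during a
  phase neither complete it nor start a new one.
\<close>

definition phase_completed_at :: "nat \<Rightarrow> (real \<Rightarrow> nat \<times> nat) \<Rightarrow> real \<Rightarrow> bool" where
  "phase_completed_at k x t \<longleftrightarrow>
    0 < t \<and> (\<exists>y\<in>busy_states k. (\<forall>\<^sub>F u in at_left t. x u = y) \<and> x t = after_phase k y)"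

definition phase_started_at :: "nat \<Rightarrow> (real \<Rightarrow> nat \<times> nat) \<Rightarrow> real \<Rightarrow> bool" where
  "phase_started_at k x t \<longleftrightarrow>
    0 < t \<and> (((\<forall>\<^sub>F u in at_left t. x u = (0, 0)) \<and> x t = (1, k)) \<or>
             (phase_completed_at k x t \<and> x t \<noteq> (0, 0)))"

text \<open>
  The phases are numbered from 0 in the order in which they are served. With a single server
  they do not overlap, so the first completion after the start of a phase is its own. For
  almost every path of the Erlang queue there are infinitely many phases and no \<open>Inf\<close> is
  taken over an empty set.
\<close>

primrec phase_start :: "nat \<Rightarrow> (real \<Rightarrow> nat \<times> nat) \<Rightarrow> nat \<Rightarrow> real" where
  "phase_start k x 0 = Inf {t. phase_started_at k x t}"
| "phase_start k x (Suc j) = Inf {t. phase_start k x j < t \<and> phase_started_at k x t}"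

definition phase_end :: "nat \<Rightarrow> (real \<Rightarrow> nat \<times> nat) \<Rightarrow> nat \<Rightarrow> real" where
  "phase_end k x j = Inf {t. phase_start k x j < t \<and> phase_completed_at k x t}"

definition inter_phase_time :: "nat \<Rightarrow> (real \<Rightarrow> nat \<times> nat) \<Rightarrow> nat \<Rightarrow> real" where
  "inter_phase_time k x j = phase_end k x j - phase_start k x j"


section \<open>The inverse mixed stable subordinator\<close>

definition (in prob_space) levy_process :: "(real \<Rightarrow> 'a \<Rightarrow> real) \<Rightarrow> bool" where
  "levy_process X \<longleftrightarrow>
    (\<forall>t\<ge>0. random_variable borel (X t)) \<and>
    (AE \<omega> in M. X 0 \<omega> = 0) \<and>
    (\<forall>(n::nat) t. 0 \<le> t 0 \<longrightarrow> (\<forall>i<n. t i \<le> t (Suc i)) \<longrightarrow>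
      indep_vars (\<lambda>_. borel) (\<lambda>i \<omega>. X (t (Suc i)) \<omega> - X (t i) \<omega>) {..<n}) \<and>
    (\<forall>s\<ge>0. \<forall>h\<ge>0. distr M borel (\<lambda>\<omega>. X (s + h) \<omega> - X s \<omega>) = distr M borel (X h)) \<and>
    (\<forall>t\<ge>0. \<forall>\<epsilon>>0. ((\<lambda>s. prob {\<omega> \<in> space M. \<epsilon> < \<bar>X s \<omega> - X t \<omega>\<bar>}) \<longlongrightarrow> 0) (at t within {0..})) \<and>
    (AE \<omega> in M. (\<forall>t\<ge>0. ((\<lambda>s. X s \<omega>) \<longlongrightarrow> X t \<omega>) (at_right t)) \<and>
                (\<forall>t>0. \<exists>l. ((\<lambda>s. X s \<omega>) \<longlongrightarrow> l) (at_left t)))"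

definition (in prob_space) mixed_stable_subordinator ::
    "real \<Rightarrow> real \<Rightarrow> real \<Rightarrow> real \<Rightarrow> (real \<Rightarrow> 'a \<Rightarrow> real) \<Rightarrow> bool" where
  "mixed_stable_subordinator c1 c2 \<alpha>1 \<alpha>2 D \<longleftrightarrow>
    levy_process D \<and>
    (AE \<omega> in M. mono_on {0..} (\<lambda>t. D t \<omega>)) \<and>
    (\<forall>t\<ge>0. \<forall>z>0. expectation (\<lambda>\<omega>. exp (- z * D t \<omega>)) =
       exp (- t * (c1 * z powr \<alpha>1 + c2 * z powr \<alpha>2)))"

definition inverse_process :: "(real \<Rightarrow> 'a \<Rightarrow> real) \<Rightarrow> real \<Rightarrow> 'a \<Rightarrow> real" where
  "inverse_process D t \<omega> = (if t = 0 then 0 else Inf {s. 0 \<le> s \<and> t < D s \<omega>})"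

definition time_change :: "(real \<Rightarrow> 'a \<Rightarrow> 's) \<Rightarrow> (real \<Rightarrow> 'a \<Rightarrow> real) \<Rightarrow> real \<Rightarrow> 'a \<Rightarrow> 's" where
  "time_change Q Y t \<omega> = Q (Y t \<omega>) \<omega>"

definition (in prob_space) indep_processes ::
    "(real \<Rightarrow> 'a \<Rightarrow> 's) \<Rightarrow> 's measure \<Rightarrow> (real \<Rightarrow> 'a \<Rightarrow> 'u) \<Rightarrow> 'u measure \<Rightarrow> bool" where
  "indep_processes X MX Y MY \<longleftrightarrow>
    (let MX' = PiM {0..} (\<lambda>_. MX); X' = (\<lambda>\<omega>. \<lambda>t\<in>{0..}. X t \<omega>);
         MY' = PiM {0..} (\<lambda>_. MY); Y' = (\<lambda>\<omega>. \<lambda>t\<in>{0..}. Y t \<omega>)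
     in random_variable MX' X' \<and> random_variable MY' Y' \<and>
        indep_set {X' -` A \<inter> space M | A. A \<in> sets MX'} {Y' -` B \<inter> space M | B. B \<in> sets MY'})"


section \<open>The three-parameter Mittag-Leffler function\<close>

definition mittag_leffler :: "real \<Rightarrow> real \<Rightarrow> real \<Rightarrow> real \<Rightarrow> real" where
  "mittag_leffler \<gamma> \<alpha> \<beta> t =
    (\<Sum>r. Gamma (\<gamma> + real r) * t ^ r / (fact r * Gamma \<gamma> * Gamma (\<alpha> * real r + \<beta>)))"

end

theory Submission
  imports Defs
begin

text \<open>
  The inverse \<open>Y\<close> passes the level \<open>s\<close> at time \<open>D (s-)\<close>, so the time-changed queue visits the states of the
  jump chain in the same order, and a phase that the queue serves during \<open>[s, s')\<close> takes the time
  \<open>D (s'-) - D (s-)\<close>. Fix the numbers of arrivals during the successive phases. This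
  determines the path of the jump chain, under which the durations of the phases are independent sums of
  exponential times of rate \<open>\<lambda> + k \<mu>\<close>; averaging over the geometrically distributed numbers
  of arrivals turns them into independent exponential times of rate \<open>k \<mu>\<close>. Since \<open>D\<close> is
  independent of the queue and has independent stationary increments, which almost surely do not jump at
  fixed times, the inter-phase times are independent with the law of \<open>D\<close> at an exponential time, whose Laplace
  transform is \<open>k \<mu> / (k \<mu> + c1 z^\<alpha>1 + c2 z^\<alpha>2)\<close>. For large \<open>z\<close> the transform of the tail expands
  into an absolutely convergent double series of powers of \<open>z\<close>. Inverted term by term, it is the series of
  Mittag-Leffler functions, and uniqueness of Laplace transforms finishes the proof.
\<close>

section \<open>Laplace transforms\<close>

text \<open>Independence is assumed for the paths of \<open>Q\<close> and of the inverse process, as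
  elements of product spaces over the uncountable set of nonnegative times. The jump chain, the
  holding times and the subordinator are not coordinates of these paths, so jump times, jump states
  and passage times are first written as functionals of the values at rational times. The
  inter-phase times are infima along a path that is regular only almost surely; their measurability
  is obtained for the completion, which is why the completion appears in the statement. An idle
  period has rate \<open>lam\<close> instead of \<open>lam + k * mu\<close>; it belongs to no phase,
  and independence of increments lets its share of the subordinator be discarded. On the analytic
  side the double series converges in the Laplace domain only where
  \<open>q * z powr - d + p * z powr - a < 1\<close>, hence for large \<open>z\<close>. That
  suffices: the transforms at \<open>z0 + n\<close>, for natural \<open>n\<close>, become moments of
  laws on [0, 1], and these determine the function.\<close>

lemma real_distribution_eqI_moments:
  fixes M1 M2 :: "real measure"
  assumes "real_distribution M1" "real_distribution M2"
    and b1: "AE x in M1. x \<in> {0..1}" and b2: "AE x in M2. x \<in> {0..1}"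
    and eq: "\<And>n::nat. (\<integral>x. x ^ n \<partial>M1) = (\<integral>x. x ^ n \<partial>M2)"
  shows "M1 = M2"
proof (rule Levy_uniqueness[OF assms(1,2)], rule ext)
  fix t :: real
  \<comment> \<open>On [0, 1] all moments are at most 1, so the exponential series can be integrated
    term by term and the characteristic function depends on the moments alone.\<close>
  have series: "char N t = (\<Sum>n. (\<i> * t) ^ n / fact n * (\<integral>x. x ^ n \<partial>N))"
    if "real_distribution N" and b: "AE x in N. x \<in> {0..1}" for N :: "real measure"
  proof -
    interpret real_distribution N by fact
    have le1: "norm (x ^ n) \<le> 1" if "x \<in> {0..1}" for x :: real and n
      using that by (auto simp: power_abs intro!: power_le_one)
    have int: "integrable N (\<lambda>x. x ^ n)" for n :: nat
    proof (rule integrable_const_bound[where B=1])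
      show "AE x in N. norm (x ^ n) \<le> 1"
        using b by eventually_elim (rule le1)
    qed measurable
    let ?f = "\<lambda>n x. (\<i> * t) ^ n / fact n * complex_of_real (x ^ n)"
    have f_int: "integrable N (?f n)" for n
      by (intro integrable_mult_right integrable_of_real int)
    have norm_f: "norm (?f n x) = \<bar>t\<bar> ^ n / fact n * \<bar>x ^ n\<bar>" for n x
      by (simp add: norm_mult norm_divide norm_power power_mult_distrib power_abs)
    have s: "summable (\<lambda>n. \<bar>t\<bar> ^ n / fact n)"
      using summable_exp[of "\<bar>t\<bar>"] by (simp add: divide_inverse mult.commute)
    have "char N t = (\<integral>x. (\<Sum>n. ?f n x) \<partial>N)"
      unfolding char_def
    proof (intro integral_cong_AE)
      show "AE x in N. iexp (t * x) = (\<Sum>n. ?f n x)"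
        by (intro AE_I2) (simp add: exp_def scaleR_conv_of_real divide_inverse power_mult_distrib mult_ac)
    qed measurable
    also have "\<dots> = (\<Sum>n. integral\<^sup>L N (?f n))"
    proof (intro integral_suminf f_int)
      show "AE x in N. summable (\<lambda>n. norm (?f n x))"
        using b
      proof eventually_elim
        case (elim x)
        show ?case unfolding norm_f
          by (rule summable_comparison_test'[OF s, of 0]) (use le1[OF elim] in \<open>auto simp: abs_mult power_abs intro!: divide_right_mono mult_left_le\<close>)
      qed
      have "(\<integral>x. norm (?f n x) \<partial>N) \<le> \<bar>t\<bar> ^ n / fact n" for n
      proof -
        have "(\<integral>x. norm (?f n x) \<partial>N) \<le> (\<integral>x. \<bar>t\<bar> ^ n / fact n \<partial>N)"
          unfolding norm_f
        proof (rule integral_mono_AE)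
          show "AE x in N. \<bar>t\<bar> ^ n / fact n * \<bar>x ^ n\<bar> \<le> \<bar>t\<bar> ^ n / fact n"
            using b by eventually_elim (rule mult_left_le, use le1 in auto)
        qed (auto intro!: integrable_mult_right integrable_abs int)
        then show ?thesis using prob_space by simp
      qed
      then show "summable (\<lambda>n. \<integral>x. norm (?f n x) \<partial>N)"
        by (intro summable_comparison_test'[OF s, of 0]) auto
    qed
    also have "\<dots> = (\<Sum>n. (\<i> * t) ^ n / fact n * (\<integral>x. x ^ n \<partial>N))"
      by (simp only: integral_mult_right_zero integral_complex_of_real)
    finally show ?thesis .
  qed
  show "char M1 t = char M2 t"
    by (simp only: series[OF assms(1) b1] series[OF assms(2) b2] eq)
qed

text \<open>
  The positive and the negative part of \<open>f\<close>, as densities, have the same total mass, and their images under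
  \<open>x \<mapsto> exp (- x)\<close> have the same moments.
\<close>

lemma laplace_transform_zero_imp_AE_zero:
  fixes f :: "real \<Rightarrow> real"
  assumes f: "integrable lborel f" and nonneg: "\<And>x. x < 0 \<Longrightarrow> f x = 0"
    and zero: "\<And>n::nat. (\<integral>x. exp (- real n * x) * f x \<partial>lborel) = 0"
  shows "AE x in lborel. f x = 0"
proof -
  note [measurable] = borel_measurable_integrable[OF f, simplified]
  define g where "g s x = max 0 (s * f x)" for s x :: real
  have [measurable]: "g s \<in> borel_measurable borel" for s
    unfolding g_def by measurable
  have g_nonneg: "0 \<le> g s x" for s x by (simp add: g_def)
  have g_int: "integrable lborel (g s)" for s
    unfolding g_def by (intro integrable_max) (auto intro!: integrable_mult_right f)
  have eg_int: "integrable lborel (\<lambda>x. exp (- real n * x) * g s x)" for n s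
  proof (rule Bochner_Integration.integrable_bound[OF g_int[of s]])
    have "norm (exp (- real n * x) * g s x) \<le> norm (g s x)" for x
    proof (cases "x < 0")
      case False
      then have "exp (- real n * x) \<le> 1" by simp
      then show ?thesis by (simp add: abs_mult mult_left_le_one_le)
    qed (simp add: g_def nonneg)
    then show "AE x in lborel. norm (exp (- real n * x) * g s x) \<le> norm (g s x)" by simp
  qed measurable
  have g_diff: "f x = g 1 x - g (-1) x" for x by (auto simp: g_def)
  have eq: "(\<integral>x. exp (- real n * x) * g 1 x \<partial>lborel) = (\<integral>x. exp (- real n * x) * g (-1) x \<partial>lborel)" for n
    using zero[of n] eg_int[of n 1] eg_int[of n "-1"] by (simp add: g_diff right_diff_distrib)
  define c where "c = (\<integral>x. g 1 x \<partial>lborel)"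
  have c: "(\<integral>x. g s x \<partial>lborel) = c" if "s = 1 \<or> s = -1" for s
    using that eq[of 0] by (auto simp: c_def)
  have "c \<ge> 0" unfolding c_def by (intro integral_nonneg_AE) (auto simp: g_nonneg)
  show ?thesis
  proof (cases "c = 0")
    case True
    have "AE x in lborel. g s x = 0" if "s = 1 \<or> s = -1" for s
      using integral_nonneg_eq_0_iff_AE[OF g_int[of s]] c[OF that] True by (auto simp: g_nonneg)
    from this[of 1] this[of "-1"] show ?thesis by (auto simp: g_diff)
  next
    case False
    with \<open>c \<ge> 0\<close> have "c > 0" by simp
    define D where "D s = density lborel (\<lambda>x. ennreal (g s x / c))" for s
    define N where "N s = distr (D s) borel (\<lambda>x. exp (- x))" for s
    have D_prob: "prob_space (D s)" if "s = 1 \<or> s = -1" for s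
    proof
      have "emeasure (D s) (space (D s)) = (\<integral>\<^sup>+x. ennreal (g s x / c) \<partial>lborel)"
        unfolding D_def by (subst emeasure_density) auto
      also have "\<dots> = ennreal (\<integral>x. g s x / c \<partial>lborel)"
        using g_int \<open>c > 0\<close> by (intro nn_integral_eq_integral) (auto simp: g_nonneg)
      also have "\<dots> = 1" using c[OF that] \<open>c > 0\<close> by simp
      finally show "emeasure (D s) (space (D s)) = 1" .
    qed
    have [measurable]: "(\<lambda>x. exp (- x)) \<in> measurable (D s) borel" for s
      by (simp add: D_def)
    have N_dist: "real_distribution (N s)" if "s = 1 \<or> s = -1" for s
      unfolding N_def using D_prob[OF that]
      by (intro prob_space.real_distribution_distr) auto
    have N_01: "AE x in N s. x \<in> {0..1}" for s
    proof -
      have "AE x in D s. 0 \<le> x"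
        unfolding D_def by (subst AE_density) (use nonneg in \<open>auto simp: g_def intro!: AE_I2 leI\<close>)
      then show ?thesis unfolding N_def
        by (subst AE_distr_iff) (auto elim!: eventually_mono)
    qed
    have N_mom: "(\<integral>x. x ^ n \<partial>N s) = (\<integral>x. exp (- real n * x) * g s x \<partial>lborel) / c" for n :: nat and s
    proof -
      have "(\<integral>x. x ^ n \<partial>N s) = (\<integral>x. exp (- x) ^ n \<partial>D s)"
        unfolding N_def by (subst integral_distr) auto
      also have "\<dots> = (\<integral>x. (g s x / c) *\<^sub>R exp (- x) ^ n \<partial>lborel)"
        unfolding D_def using \<open>c > 0\<close> by (subst integral_density) (auto simp: g_nonneg)
      also have "\<dots> = (\<integral>x. (exp (- real n * x) * g s x) / c \<partial>lborel)"
        by (intro Bochner_Integration.integral_cong) (auto simp: exp_of_nat_mult[symmetric])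
      finally show ?thesis by simp
    qed
    have "N 1 = N (-1)"
    proof (rule real_distribution_eqI_moments)
      show "(\<integral>x. x ^ n \<partial>N 1) = (\<integral>x. x ^ n \<partial>N (-1))" for n
        by (simp only: N_mom eq)
    qed (simp_all only: N_dist N_01 simp_thms)
    \<comment> \<open>\<open>- ln x\<close> undoes the substitution \<open>exp (- x)\<close>, so
      equal image laws give back equal densities.\<close>
    then have "distr (N 1) borel (\<lambda>x. - ln x) = distr (N (-1)) borel (\<lambda>x. - ln x)"
      by simp
    moreover have "distr (N s) borel (\<lambda>x. - ln x) = D s" for s
      unfolding N_def
      by (subst distr_distr) (auto simp: comp_def D_def intro!: distr_id2)
    ultimately have "D 1 = D (-1)" by simp
    then have "AE x in lborel. ennreal (g 1 x / c) = ennreal (g (-1) x / c)"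
      unfolding D_def
    proof (subst finite_density_unique[symmetric])
      have "(\<integral>\<^sup>+x. ennreal (g 1 x / c) \<partial>lborel) = ennreal (\<integral>x. g 1 x / c \<partial>lborel)"
        using g_int \<open>c > 0\<close> by (intro nn_integral_eq_integral) (auto simp: g_nonneg)
      then show "(\<integral>\<^sup>+x. ennreal (g 1 x / c) \<partial>lborel) \<noteq> \<infinity>" by simp
    qed auto
    then show ?thesis
    proof eventually_elim
      case (elim x)
      then have "g 1 x / c = g (-1) x / c"
        using \<open>c > 0\<close> g_nonneg by (subst (asm) ennreal_inj) auto
      then show ?case using \<open>c > 0\<close> by (simp add: g_diff)
    qed
  qed
qed

section \<open>Laplace transforms of powers and termwise inversion\<close>

lemma nn_integral_exp_powr:
  fixes a z :: real
  assumes "0 < z" "0 \<le> a"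
  shows "(\<integral>\<^sup>+t. ennreal (indicator {0<..} t * (exp (- z * t) * t powr a)) \<partial>lborel) =
    ennreal (Gamma (a + 1) * z powr - (a + 1))"
proof -
  have "ennreal (Gamma (a + 1)) = (\<integral>\<^sup>+t. ennreal (indicator {0..} t * t powr a / exp t) \<partial>lborel)"
    using Gamma_conv_nn_integral_real[of "a + 1"] assms by simp
  also have "\<dots> = (\<integral>\<^sup>+t. ennreal z * ennreal (indicator {0..} (z * t) * (z * t) powr a / exp (z * t)) \<partial>lborel)"
    using assms by (subst nn_integral_real_affine[where c=z and t=0]) (auto simp: nn_integral_cmult)
  also have "\<dots> = (\<integral>\<^sup>+t. ennreal (z powr (a + 1)) * ennreal (indicator {0<..} t * (exp (- z * t) * t powr a)) \<partial>lborel)"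
  proof (intro nn_integral_cong_AE)
    have "AE t in lborel. t \<noteq> (0::real)" by (rule AE_lborel_singleton)
    then show "AE t in lborel. ennreal z * ennreal (indicator {0..} (z * t) * (z * t) powr a / exp (z * t)) =
        ennreal (z powr (a + 1)) * ennreal (indicator {0<..} t * (exp (- z * t) * t powr a))"
    proof eventually_elim
      case (elim t)
      then show ?case using assms
        by (auto simp: indicator_def ennreal_mult'[symmetric] powr_mult powr_add exp_minus field_simps zero_le_mult_iff)
    qed
  qed
  also have "\<dots> = ennreal (z powr (a + 1)) * (\<integral>\<^sup>+t. ennreal (indicator {0<..} t * (exp (- z * t) * t powr a)) \<partial>lborel)"
    by (intro nn_integral_cmult) measurable
  finally have *: "ennreal (Gamma (a + 1)) = \<dots>" .
  have "ennreal (z powr - (a + 1)) * ennreal (z powr (a + 1)) = 1"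
    using assms by (simp add: ennreal_mult'[symmetric] powr_add[symmetric])
  then have "(\<integral>\<^sup>+t. ennreal (indicator {0<..} t * (exp (- z * t) * t powr a)) \<partial>lborel) =
      ennreal (z powr - (a + 1)) * ennreal (Gamma (a + 1))"
    unfolding * by (simp flip: mult.assoc)
  then show ?thesis
    using assms by (simp add: ennreal_mult'' mult.commute)
qed

text \<open>The binomial series with exponent \<open>- (r + 1)\<close>: upper negation gives a sign
  \<open>(- 1) ^ m\<close>, which cancels against the one from \<open>(- x) ^ m\<close>.\<close>

lemma binomial_series_neg:
  fixes x :: real
  assumes "\<bar>x\<bar> < 1"
  shows "(\<lambda>m. real (r + m choose m) * x ^ m) sums (1 / (1 - x) ^ (r + 1))"
proof -
  have "(\<lambda>m. ((- real (r + 1)) gchoose m) * (- x) ^ m) sums (1 + - x) powr (- real (r + 1))"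
    using gen_binomial_real[of "- x" "- real (r + 1)"] assms by simp
  moreover have "((- real (r + 1)) gchoose m) * (- x) ^ m = real (r + m choose m) * x ^ m" for m
  proof -
    have "((- real (r + 1)) gchoose m) = (- 1) ^ m * real (r + m choose m)"
      unfolding gbinomial_minus by (simp add: binomial_gbinomial)
    moreover have "(- x) ^ m = (- 1) ^ m * x ^ m" by (rule power_minus)
    moreover have "(- 1) ^ m * (- 1) ^ m = (1 :: real)" by (simp flip: power_add)
    ultimately show ?thesis by (simp add: mult.assoc mult.left_commute)
  qed
  moreover have "(1 + - x) powr (- real (r + 1)) = 1 / (1 - x) ^ (r + 1)"
    using assms by (simp only: powr_minus powr_realpow) (auto simp: powr_realpow field_simps simp del: power_Suc of_nat_Suc)
  ultimately show ?thesis by simp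
qed

text \<open>The way from almost every point to a given point: good points exist arbitrarily close to
  its right, and monotonicity or right-continuity does the rest.\<close>

lemma AE_lborel_ex_Ioo:
  fixes a b :: real
  assumes "AE x in lborel. P x" "a < b"
  shows "\<exists>x\<in>{a<..<b}. P x"
proof (rule ccontr)
  assume "\<not> ?thesis"
  with assms(1) have "AE x in lborel. x \<notin> {a<..<b}"
    by (auto elim!: eventually_mono)
  then have "emeasure lborel {a<..<b} = 0"
    by (subst (asm) AE_iff_measurable[where N="{a<..<b}"]) auto
  then show False using \<open>a < b\<close> by simp
qed

text \<open>Termwise inversion works with a single series, so the double series is enumerated by
  \<open>prod_decode\<close>. Fubini for absolutely summable families then returns to the iterated
  sums, whose inner sums become Mittag-Leffler functions.\<close>

lemma suminf_prod_decode:
  fixes f :: "nat \<times> nat \<Rightarrow> real"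
  assumes "summable (\<lambda>i. \<bar>f (prod_decode i)\<bar>)"
  shows "summable (\<lambda>m. f (r, m))" and "summable (\<lambda>r. \<Sum>m. f (r, m))"
    and "(\<Sum>r. \<Sum>m. f (r, m)) = (\<Sum>i. f (prod_decode i))"
proof -
  have "(\<lambda>i. norm (f (prod_decode i))) summable_on UNIV"
    using assms by (intro norm_summable_imp_summable_on) simp
  then have abs: "(\<lambda>x. norm (f x)) summable_on UNIV"
    using summable_on_reindex_bij_betw[OF bij_prod_decode, of "\<lambda>x. norm (f x)"] by simp
  then have s: "f summable_on UNIV \<times> UNIV"
    using Infinite_Sum.abs_summable_summable[OF abs] by simp
  have abs2: "(\<lambda>x. norm (f x)) summable_on UNIV \<times> UNIV" using abs by simp
  have r: "(\<lambda>m. norm (f (r, m))) summable_on UNIV" for r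
    using summable_on_SigmaD1[of "\<lambda>r m. norm (f (r, m))" UNIV "\<lambda>_. UNIV" r] abs2 by (simp add: case_prod_unfold)
  have r': "summable (\<lambda>m. f (r, m))" "infsum (\<lambda>m. f (r, m)) UNIV = (\<Sum>m. f (r, m))" for r
    using r[of r] Infinite_Sum.abs_summable_summable[OF r[of r]] summable_on_imp_summable[of "\<lambda>m. f (r, m)"] sums_unique[OF has_sum_imp_sums[OF has_sum_infsum]] by auto
  show "summable (\<lambda>m. f (r, m))" by (rule r')
  have "(\<lambda>r. infsum (\<lambda>m. f (r, m)) UNIV) summable_on UNIV"
    using s by (intro summable_on_Sigma_banach) auto
  then have o: "(\<lambda>r. \<Sum>m. f (r, m)) summable_on UNIV" unfolding r' .
  then show "summable (\<lambda>r. \<Sum>m. f (r, m))" by (rule summable_on_imp_summable)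
  have "(\<Sum>r. \<Sum>m. f (r, m)) = infsum (\<lambda>r. infsum (\<lambda>m. f (r, m)) UNIV) UNIV"
    unfolding r' by (rule sums_unique[OF has_sum_imp_sums[OF has_sum_infsum[OF o]], symmetric])
  also have "\<dots> = infsum f (UNIV \<times> UNIV)"
    using infsum_Sigma'_banach[of "\<lambda>r m. f (r, m)" UNIV "\<lambda>_. UNIV"] s by simp
  also have "\<dots> = infsum (\<lambda>i. f (prod_decode i)) UNIV"
    using infsum_reindex_bij_betw[OF bij_prod_decode, of f] by simp
  also have "\<dots> = (\<Sum>i. f (prod_decode i))"
    using s summable_on_reindex_bij_betw[OF bij_prod_decode, of f] by (intro sums_unique has_sum_imp_sums has_sum_infsum) simp
  finally show "(\<Sum>r. \<Sum>m. f (r, m)) = (\<Sum>i. f (prod_decode i))" .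
qed

text \<open>
  Absolute convergence of the Laplace transforms gives convergence of the series itself for almost
  every argument, and hence for every argument since the moduli of the terms increase.
\<close>

lemma laplace_powr_series:
  fixes c \<beta> :: "nat \<Rightarrow> real" and z0 :: real
  assumes "0 < z0" and \<beta>: "\<And>i. 0 \<le> \<beta> i"
    and sum: "summable (\<lambda>i. \<bar>c i\<bar> * z0 powr - (\<beta> i + 1))"
  defines "b \<equiv> \<lambda>i t. c i / Gamma (\<beta> i + 1) * t powr \<beta> i"
  shows "0 < t \<Longrightarrow> summable (\<lambda>i. \<bar>b i t\<bar>)"
    and "continuous_on {0<..} (\<lambda>t. \<Sum>i. b i t)"
    and "z0 \<le> z \<Longrightarrow> integrable lborel (\<lambda>t. indicator {0<..} t * (exp (- z * t) * (\<Sum>i. b i t)))"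
    and "z0 \<le> z \<Longrightarrow> (\<integral>t. indicator {0<..} t * (exp (- z * t) * (\<Sum>i. b i t)) \<partial>lborel) =
      (\<Sum>i. c i * z powr - (\<beta> i + 1))"
proof -
  have G: "0 < Gamma (\<beta> i + 1)" for i
    using \<beta>[of i] by (intro Gamma_real_pos) simp
  have [measurable]: "b i \<in> borel_measurable borel" for i
    unfolding b_def by measurable
  have abs_b: "\<bar>b i t\<bar> = \<bar>c i\<bar> / Gamma (\<beta> i + 1) * t powr \<beta> i" for i t
    using G[of i] by (simp add: b_def abs_mult)
  have nn: "(\<integral>\<^sup>+t. ennreal (indicator {0<..} t * (exp (- z * t) * \<bar>b i t\<bar>)) \<partial>lborel) =
      ennreal (\<bar>c i\<bar> * z powr - (\<beta> i + 1))" if "0 < z" for z i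
  proof -
    have "(\<integral>\<^sup>+t. ennreal (indicator {0<..} t * (exp (- z * t) * \<bar>b i t\<bar>)) \<partial>lborel) =
        (\<integral>\<^sup>+t. ennreal (\<bar>c i\<bar> / Gamma (\<beta> i + 1)) * ennreal (indicator {0<..} t * (exp (- z * t) * t powr \<beta> i)) \<partial>lborel)"
      using G[of i] by (intro nn_integral_cong) (auto simp: abs_b ennreal_mult'[symmetric] indicator_def field_simps)
    also have "\<dots> = ennreal (\<bar>c i\<bar> / Gamma (\<beta> i + 1)) * ennreal (Gamma (\<beta> i + 1) * z powr - (\<beta> i + 1))"
      using that \<beta> by (subst nn_integral_cmult) (auto simp only: nn_integral_exp_powr[OF that \<beta>], measurable)
    also have "\<dots> = ennreal (\<bar>c i\<bar> * z powr - (\<beta> i + 1))"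
      using G[of i] by (subst ennreal_mult'[symmetric]) auto
    finally show ?thesis .
  qed
  have sumz: "summable (\<lambda>i. \<bar>c i\<bar> * z powr - (\<beta> i + 1))" if "z0 \<le> z" for z
  proof (rule summable_comparison_test'[OF sum, of 0])
    fix i
    have "z powr - (\<beta> i + 1) \<le> z0 powr - (\<beta> i + 1)"
      using that \<open>0 < z0\<close> \<beta>[of i] by (intro powr_mono2') auto
    then show "norm (\<bar>c i\<bar> * z powr - (\<beta> i + 1)) \<le> \<bar>c i\<bar> * z0 powr - (\<beta> i + 1)"
      by (simp add: mult_left_mono)
  qed
  have "(\<integral>\<^sup>+t. (\<Sum>i. ennreal (indicator {0<..} t * (exp (- z0 * t) * \<bar>b i t\<bar>))) \<partial>lborel) =
      (\<Sum>i. ennreal (\<bar>c i\<bar> * z0 powr - (\<beta> i + 1)))"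
    using \<open>0 < z0\<close> by (subst nn_integral_suminf) (measurable, simp only: nn)
  also have "\<dots> \<noteq> \<infinity>"
    unfolding infinity_ennreal_def by (rule ennreal_suminf_neq_top[OF sum]) simp
  finally have "AE t in lborel. (\<Sum>i. ennreal (indicator {0<..} t * (exp (- z0 * t) * \<bar>b i t\<bar>))) \<noteq> \<infinity>"
    by (intro nn_integral_noteq_infinite) auto
  then have ex: "\<exists>t'\<in>{t<..<t+1}. (\<Sum>i. ennreal (indicator {0<..} t' * (exp (- z0 * t') * \<bar>b i t'\<bar>))) \<noteq> \<infinity>" for t
    by (rule AE_lborel_ex_Ioo) simp
  have mono: "\<bar>b i t\<bar> \<le> \<bar>b i t'\<bar>" if "0 < t" "t \<le> t'" for t t' i
    unfolding abs_b using G[of i] \<beta>[of i] that by (intro mult_left_mono powr_mono2) auto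
  have s: "summable (\<lambda>i. \<bar>b i t\<bar>)" if "0 < t" for t
  proof -
    obtain t' where t': "t < t'" "(\<Sum>i. ennreal (indicator {0<..} t' * (exp (- z0 * t') * \<bar>b i t'\<bar>))) \<noteq> \<infinity>"
      using ex[of t] by auto
    have "summable (\<lambda>i. indicator {0<..} t' * (exp (- z0 * t') * \<bar>b i t'\<bar>))"
      by (rule summable_suminf_not_top[OF _ t'(2)[unfolded infinity_ennreal_def]]) simp
    then have "summable (\<lambda>i. exp (- z0 * t') * \<bar>b i t'\<bar>)"
      using that t'(1) by (simp only: indicator_simps mult_1_left greaterThan_iff if_True indicator_def less_trans[OF that t'(1)] of_bool_eq)
    then have "summable (\<lambda>i. \<bar>b i t'\<bar>)"
      by (subst (asm) summable_cmult_iff) simp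
    then show ?thesis
      by (rule summable_comparison_test'[where N=0])
        (simp only: real_norm_def abs_idempotent mono[OF that less_imp_le[OF t'(1)]])
  qed
  then show "0 < t \<Longrightarrow> summable (\<lambda>i. \<bar>b i t\<bar>)" .
  show "continuous_on {0<..} (\<lambda>t. \<Sum>i. b i t)"
  proof (rule continuous_at_imp_continuous_on, rule ballI)
    fix t :: real assume "t \<in> {0<..}"
    then have "0 < t" by simp
    \<comment> \<open>The moduli of the terms increase, so on the interval up to
      \<open>t + 1\<close> their values at \<open>t + 1\<close> serve as majorants.\<close>
    have "uniform_limit {0<..<t+1} (\<lambda>n t. \<Sum>i<n. b i t) (\<lambda>t. \<Sum>i. b i t) sequentially"
      by (rule Weierstrass_m_test[OF _ s[of "t + 1"]]) (use \<open>0 < t\<close> in \<open>auto intro!: mono\<close>)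
    then have "continuous_on {0<..<t+1} (\<lambda>t. \<Sum>i. b i t)"
      by (rule uniform_limit_theorem[rotated])
        (auto simp: b_def G[THEN less_imp_neq, symmetric] intro!: always_eventually continuous_intros)
    then show "isCont (\<lambda>t. \<Sum>i. b i t) t"
      using \<open>0 < t\<close> by (simp add: continuous_on_eq_continuous_at)
  qed
  assume "z0 \<le> z"
  with \<open>0 < z0\<close> have "0 < z" by simp
  let ?g = "\<lambda>i t. indicator {0<..} t * (exp (- z * t) * b i t)"
  have norm_g: "norm (?g i t) = indicator {0<..} t * (exp (- z * t) * \<bar>b i t\<bar>)" for i t
    by (simp add: abs_mult)
  have g_int: "integrable lborel (?g i)" for i
    using nn[OF \<open>0 < z\<close>, of i] unfolding integrable_iff_bounded norm_g by auto
  have g_norm: "(\<integral>t. norm (?g i t) \<partial>lborel) = \<bar>c i\<bar> * z powr - (\<beta> i + 1)" for i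
    using nn[OF \<open>0 < z\<close>, of i] unfolding norm_g
    by (intro integral_eq_nn_integral[THEN trans]) auto
  \<comment> \<open>Each term has constant sign, so its integral is \<open>sgn (c i)\<close> times
    the integral of its modulus.\<close>
  have g_val: "integral\<^sup>L lborel (?g i) = c i * z powr - (\<beta> i + 1)" for i
  proof -
    have b: "sgn (c i) * \<bar>b i t\<bar> = b i t" for t
    proof -
      have "sgn (c i) * \<bar>b i t\<bar> = (sgn (c i) * \<bar>c i\<bar>) / Gamma (\<beta> i + 1) * t powr \<beta> i"
        unfolding abs_b by simp
      then show ?thesis by (simp only: sgn_mult_abs b_def)
    qed
    have "?g i t = sgn (c i) * norm (?g i t)" for t
      unfolding norm_g by (subst b[symmetric]) (simp only: mult.left_commute)
    then have "integral\<^sup>L lborel (?g i) = (\<integral>t. sgn (c i) * norm (?g i t) \<partial>lborel)"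
      by (rule Bochner_Integration.integral_cong[OF refl])
    also have "\<dots> = sgn (c i) * (\<bar>c i\<bar> * z powr - (\<beta> i + 1))"
      by (simp only: integral_mult_right_zero g_norm)
    also have "\<dots> = c i * z powr - (\<beta> i + 1)"
      by (simp only: sgn_mult_abs flip: mult.assoc)
    finally show ?thesis .
  qed
  have AE: "AE t in lborel. summable (\<lambda>i. norm (?g i t))"
  proof (rule AE_I2)
    fix t :: real
    show "summable (\<lambda>i. norm (?g i t))"
      unfolding norm_g by (cases "0 < t") (auto intro!: summable_mult s)
  qed
  have eq: "(\<lambda>t. \<Sum>i. ?g i t) = (\<lambda>t. indicator {0<..} t * (exp (- z * t) * (\<Sum>i. b i t)))"
  proof
    fix t :: real
    show "(\<Sum>i. ?g i t) = indicator {0<..} t * (exp (- z * t) * (\<Sum>i. b i t))"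
      using s[of t, THEN summable_rabs_cancel] by (cases "0 < t") (auto simp: suminf_mult)
  qed
  note * = g_int AE sumz[OF \<open>z0 \<le> z\<close>, folded g_norm]
  show "integrable lborel (\<lambda>t. indicator {0<..} t * (exp (- z * t) * (\<Sum>i. b i t)))"
    using integrable_suminf[OF *] unfolding eq .
  show "(\<integral>t. indicator {0<..} t * (exp (- z * t) * (\<Sum>i. b i t)) \<partial>lborel) =
      (\<Sum>i. c i * z powr - (\<beta> i + 1))"
    using integral_suminf[OF *] unfolding eq g_val .
qed

text \<open>The sum over \<open>m\<close> is \<open>A ^ r / (1 - B) ^ (r + 1)\<close>, and the sum
  over \<open>r\<close> is then geometric with ratio \<open>A / (1 - B)\<close>, of modulus below 1
  since \<open>\<bar>A\<bar> < 1 - \<bar>B\<bar>\<close>. Absolute convergence is the same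
  computation for the moduli of \<open>A\<close> and \<open>B\<close>.\<close>

lemma double_binomial_series:
  fixes A B :: real
  assumes AB: "\<bar>A\<bar> + \<bar>B\<bar> < 1"
  defines "f \<equiv> \<lambda>(r, m). A ^ r * (real (r + m choose m) * B ^ m)"
  shows "summable (\<lambda>i. \<bar>f (prod_decode i)\<bar>)"
    and "(\<Sum>i. f (prod_decode i)) = 1 / (1 - A - B)"
proof -
  have inner: "(\<lambda>m. A ^ r * (real (r + m choose m) * B ^ m)) sums (A ^ r * (1 / (1 - B) ^ (r + 1)))"
    and outer: "(\<lambda>r. A ^ r * (1 / (1 - B) ^ (r + 1))) sums (1 / (1 - A - B))"
    if "\<bar>A\<bar> + \<bar>B\<bar> < 1" for A B :: real and r
  proof -
    have b: "\<bar>B\<bar> < 1" using that by linarith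
    show "(\<lambda>m. A ^ r * (real (r + m choose m) * B ^ m)) sums (A ^ r * (1 / (1 - B) ^ (r + 1)))"
      by (rule sums_mult[OF binomial_series_neg[OF b]])
    have B: "0 < 1 - B" using b by simp
    have "\<bar>A\<bar> < 1 - B" using that by linarith
    then have q: "norm (A / (1 - B)) < 1" using B by simp
    have "(\<lambda>r. 1 / (1 - B) * (A / (1 - B)) ^ r) sums (1 / (1 - B) * (1 / (1 - A / (1 - B))))"
      by (rule sums_mult[OF geometric_sums[OF q]])
    moreover have "1 / (1 - B) * (1 / (1 - A / (1 - B))) = 1 / (1 - A - B)"
      using B q by (simp add: field_simps)
    moreover have "1 / (1 - B) * (A / (1 - B)) ^ r = A ^ r * (1 / (1 - B) ^ (r + 1))" for r
      by (simp add: power_divide)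
    ultimately show "(\<lambda>r. A ^ r * (1 / (1 - B) ^ (r + 1))) sums (1 / (1 - A - B))"
      by simp
  qed
  let ?A = "\<bar>A\<bar>" and ?B = "\<bar>B\<bar>"
  have AB': "\<bar>?A\<bar> + \<bar>?B\<bar> < 1" using AB by simp
  have B1: "0 \<le> 1 - ?B" using AB by linarith
  have abs_f: "\<bar>f (r, m)\<bar> = ?A ^ r * (real (r + m choose m) * ?B ^ m)" for r m
    by (simp add: f_def abs_mult power_abs)
  show s: "summable (\<lambda>i. \<bar>f (prod_decode i)\<bar>)"
  proof (rule summable_suminf_not_top)
    have "(\<Sum>i. ennreal \<bar>f (prod_decode i)\<bar>) = (\<Sum>r. \<Sum>m. ennreal \<bar>f (r, m)\<bar>)"
      by (rule suminf_ennreal_2dimen[where f="\<lambda>x. ennreal \<bar>f x\<bar>"]) simp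
    also have "\<dots> = (\<Sum>r. ennreal (?A ^ r * (1 / (1 - ?B) ^ (r + 1))))"
      unfolding abs_f using inner[OF AB']
      by (intro arg_cong[where f=suminf] ext suminf_ennreal_eq) auto
    also have "\<dots> = ennreal (1 / (1 - ?A - ?B))"
      using B1 by (intro suminf_ennreal_eq outer[OF AB']) auto
    finally show "(\<Sum>i. ennreal \<bar>f (prod_decode i)\<bar>) \<noteq> top" by simp
  qed simp
  have "(\<Sum>i. f (prod_decode i)) = (\<Sum>r. \<Sum>m. f (r, m))"
    by (rule suminf_prod_decode(3)[OF s, symmetric])
  also have "\<dots> = 1 / (1 - A - B)"
    unfolding f_def using sums_unique[OF inner[OF AB]] sums_unique[OF outer[OF AB]] by simp
  finally show "(\<Sum>i. f (prod_decode i)) = 1 / (1 - A - B)" .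
qed

text \<open>Let X have law \<open>K\<close> and let E be an independent exponential time of rate
  \<open>z\<close>. Fubini computes P(E < X) in two ways: integrating over X first gives
  \<open>z\<close> times the transform of the tail, integrating over E first gives the expectation
  of 1 - exp (- z X).\<close>

lemma laplace_transform_tail:
  fixes K :: "real measure" and z :: real
  assumes "real_distribution K" and nonneg: "AE x in K. 0 \<le> x" and "0 < z"
  defines "h \<equiv> \<lambda>t. indicator {0<..} t * (exp (- z * t) * measure K {t<..})"
  shows "integrable lborel h" and "integral\<^sup>L lborel h = (1 - (\<integral>x. exp (- z * x) \<partial>K)) / z"
proof -
  interpret real_distribution K by fact
  interpret pair_sigma_finite lborel K ..
  have exp_int: "integrable K (\<lambda>x. exp (- z * x))"
    by (rule integrable_const_bound[where B=1]) (use nonneg \<open>0 < z\<close> in \<open>auto elim!: eventually_mono\<close>)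
  have [measurable]: "(\<lambda>t. measure K {t<..}) \<in> borel_measurable borel"
  proof -
    have "mono (\<lambda>t. - measure K {t<..})"
      by (auto simp: mono_def intro!: finite_measure_mono)
    from borel_measurable_uminus[OF borel_measurable_mono[OF this]] show ?thesis by simp
  qed
  have [measurable]: "h \<in> borel_measurable borel" unfolding h_def by measurable
  have "(\<integral>\<^sup>+t. ennreal z * ennreal (h t) \<partial>lborel) =
      (\<integral>\<^sup>+t. (\<integral>\<^sup>+x. ennreal (exponential_density z t) * indicator {(t, x). 0 < t \<and> t < x} (t, x) \<partial>K) \<partial>lborel)"
  proof (intro nn_integral_cong)
    fix t :: real
    have "(\<integral>\<^sup>+x. ennreal (exponential_density z t) * indicator {(t, x). 0 < t \<and> t < x} (t, x) \<partial>K) =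
        (\<integral>\<^sup>+x. ennreal (indicator {0<..} t * exponential_density z t) * indicator {t<..} x \<partial>K)"
      by (intro nn_integral_cong) (auto simp: indicator_def)
    also have "\<dots> = ennreal (indicator {0<..} t * exponential_density z t) * emeasure K {t<..}"
      by (subst nn_integral_cmult) auto
    also have "\<dots> = ennreal z * ennreal (h t)"
      using \<open>0 < z\<close> by (auto simp: h_def emeasure_eq_measure exponential_density_def indicator_def
          ennreal_mult'[symmetric] mult_ac)
    finally show "ennreal z * ennreal (h t) =
      (\<integral>\<^sup>+x. ennreal (exponential_density z t) * indicator {(t, x). 0 < t \<and> t < x} (t, x) \<partial>K)" ..
  qed
  also have "\<dots> = (\<integral>\<^sup>+x. (\<integral>\<^sup>+t. ennreal (exponential_density z t) * indicator {(t, x). 0 < t \<and> t < x} (t, x) \<partial>lborel) \<partial>K)"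
    by (rule Fubini'[symmetric]) measurable
  also have "\<dots> = (\<integral>\<^sup>+x. ennreal (1 - exp (- z * x)) \<partial>K)"
  proof (rule nn_integral_cong_AE)
    show "AE x in K. (\<integral>\<^sup>+t. ennreal (exponential_density z t) * indicator {(t, x). 0 < t \<and> t < x} (t, x) \<partial>lborel) =
        ennreal (1 - exp (- z * x))"
      using nonneg
    proof eventually_elim
      case (elim x)
      have "(\<integral>\<^sup>+t. ennreal (exponential_density z t) * indicator {(t, x). 0 < t \<and> t < x} (t, x) \<partial>lborel) =
          (\<integral>\<^sup>+t. ennreal (exponential_density z t) * indicator {..x} t \<partial>lborel)"
      proof (rule nn_integral_cong_AE)
        have "AE t in lborel. t \<noteq> 0 \<and> t \<noteq> x"
          by (intro AE_conjI AE_lborel_singleton)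
        then show "AE t in lborel. ennreal (exponential_density z t) * indicator {(t, x). 0 < t \<and> t < x} (t, x) =
            ennreal (exponential_density z t) * indicator {..x} t"
          by eventually_elim (auto simp: indicator_def exponential_density_def)
      qed
      also have "\<dots> = ennreal (1 - exp (- z * x))"
        using nn_integral_erlang_density[OF \<open>0 < z\<close>, of 0 x] elim by (simp add: erlang_CDF_0)
      finally show ?case .
    qed
  qed
  also have "\<dots> = ennreal (\<integral>x. 1 - exp (- z * x) \<partial>K)"
    using nonneg \<open>0 < z\<close> by (intro nn_integral_eq_integral Bochner_Integration.integrable_diff exp_int)
      (auto elim!: eventually_mono)
  also have "(\<integral>x. 1 - exp (- z * x) \<partial>K) = 1 - (\<integral>x. exp (- z * x) \<partial>K)"
    by (subst Bochner_Integration.integral_diff) (use exp_int prob_space in auto)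
  also have "(\<integral>\<^sup>+t. ennreal z * ennreal (h t) \<partial>lborel) = ennreal z * (\<integral>\<^sup>+t. ennreal (h t) \<partial>lborel)"
    by (intro nn_integral_cmult) measurable
  finally have *: "ennreal z * (\<integral>\<^sup>+t. ennreal (h t) \<partial>lborel) = ennreal (1 - (\<integral>x. exp (- z * x) \<partial>K))" .
  have "ennreal (1 / z) * ennreal z = 1"
    using \<open>0 < z\<close> by (subst ennreal_mult'[symmetric]) auto
  then have "(\<integral>\<^sup>+t. ennreal (h t) \<partial>lborel) = ennreal (1 / z) * (ennreal z * (\<integral>\<^sup>+t. ennreal (h t) \<partial>lborel))"
    by (simp flip: mult.assoc)
  also have "\<dots> = ennreal ((1 - (\<integral>x. exp (- z * x) \<partial>K)) / z)"
    unfolding * using \<open>0 < z\<close> by (subst ennreal_mult'[symmetric]) auto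
  finally have nn: "(\<integral>\<^sup>+t. ennreal (h t) \<partial>lborel) = \<dots>" .
  have h_nonneg: "0 \<le> h t" for t by (simp add: h_def)
  show "integrable lborel h"
    using nn by (intro integrableI_nonneg) (auto simp: h_nonneg)
  have "(\<integral>x. exp (- z * x) \<partial>K) \<le> (\<integral>x. 1 \<partial>K)"
    using nonneg \<open>0 < z\<close> by (intro integral_mono_AE exp_int) (auto elim!: eventually_mono)
  then have "(\<integral>x. exp (- z * x) \<partial>K) \<le> 1" using prob_space by simp
  then show "integral\<^sup>L lborel h = (1 - (\<integral>x. exp (- z * x) \<partial>K)) / z"
    using \<open>0 < z\<close> by (subst integral_eq_nn_integral) (auto simp: h_nonneg nn)
qed

section \<open>Series of Mittag-Leffler functions\<close>

text \<open>The factor may vanish, as powers of \<open>c2 / c1\<close> do for \<open>c2 = 0\<close>.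
  The hypothesis then says nothing about \<open>f\<close>, but both sides are 0.\<close>

lemma suminf_cmult_summable:
  fixes f :: "nat \<Rightarrow> real"
  assumes "summable (\<lambda>n. c * f n)"
  shows "(\<Sum>n. c * f n) = c * (\<Sum>n. f n)"
proof (cases "c = 0")
  case False
  with assms have "summable f" by (simp add: summable_cmult_iff)
  then show ?thesis by (rule suminf_mult)
qed simp

text \<open>
  The double series has coefficients \<open>A ^ r * (r + m choose m) * B ^ m\<close> in the Laplace domain;
  \<open>e\<close> accommodates the shift of the exponents in the second series of the theorem.
\<close>

lemma mittag_leffler_series:
  fixes p q a d e z0 :: real
  assumes "0 < p" "0 \<le> q" "0 < a" "0 < d" "0 \<le> e" "0 < z0"
    and z0: "q * z0 powr - d + p * z0 powr - a < 1"
  defines "R \<equiv> \<lambda>t r. (- q) ^ r * t powr (d * real r + e) *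
    mittag_leffler (real r + 1) a (d * real r + e + 1) (- p * t powr a)"
  shows "0 < t \<Longrightarrow> summable (R t)"
    and "continuous_on {0<..} (\<lambda>t. \<Sum>r. R t r)"
    and "z0 \<le> z \<Longrightarrow> integrable lborel (\<lambda>t. indicator {0<..} t * (exp (- z * t) * (\<Sum>r. R t r)))"
    and "z0 \<le> z \<Longrightarrow> (\<integral>t. indicator {0<..} t * (exp (- z * t) * (\<Sum>r. R t r)) \<partial>lborel) =
      z powr - (e + 1) / (1 + q * z powr - d + p * z powr - a)"
proof -
  define c where "c = (\<lambda>(r, m). (- q) ^ r * (real (r + m choose m) * (- p) ^ m))"
  define \<beta> where "\<beta> = (\<lambda>(r, m). d * real r + e + a * real m)"
  define b where "b i t = c i / Gamma (\<beta> i + 1) * t powr \<beta> i" for i t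
  have \<beta>: "0 \<le> \<beta> i" for i using assms by (auto simp: \<beta>_def split: prod.split)
  \<comment> \<open>In the Laplace domain the terms are those of the double binomial series at
    \<open>A = - q * z powr - d\<close> and \<open>B = - p * z powr - a\<close>, up to the common
    factor \<open>z powr - (e + 1)\<close>.\<close>
  have c_powr: "c i * z powr - (\<beta> i + 1) =
      z powr - (e + 1) * (case i of (r, m) \<Rightarrow> (- q * z powr - d) ^ r * (real (r + m choose m) * (- p * z powr - a) ^ m))"
    if "0 < z" for i z
  proof -
    obtain r m where i: "i = (r, m)" by (cases i)
    have "- (\<beta> i + 1) = - (e + 1) + (real r * - d + real m * - a)"
      by (simp add: i \<beta>_def algebra_simps)
    then have "z powr - (\<beta> i + 1) = z powr - (e + 1) * ((z powr - d) ^ r * (z powr - a) ^ m)"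
      using that by (simp only: powr_add powr_power)
    moreover have "(- q * z powr - d) ^ r = (- q) ^ r * (z powr - d) ^ r"
        "(- p * z powr - a) ^ m = (- p) ^ m * (z powr - a) ^ m"
      by (rule power_mult_distrib)+
    ultimately show ?thesis unfolding i c_def prod.case by simp
  qed
  have AB: "\<bar>- q * z powr - d\<bar> + \<bar>- p * z powr - a\<bar> < 1" if "z0 \<le> z" for z
  proof -
    have "z powr - d \<le> z0 powr - d" "z powr - a \<le> z0 powr - a"
      using that assms by (auto intro!: powr_mono2')
    then have "q * z powr - d \<le> q * z0 powr - d" "p * z powr - a \<le> p * z0 powr - a"
      using assms by (auto intro!: mult_left_mono)
    moreover have "\<bar>- q * z powr - d\<bar> = q * z powr - d" "\<bar>- p * z powr - a\<bar> = p * z powr - a"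
      using assms by (simp_all add: abs_mult)
    ultimately show ?thesis using z0 by linarith
  qed
  have abs_c: "\<bar>c (prod_decode i)\<bar> * z0 powr - (\<beta> (prod_decode i) + 1) =
      z0 powr - (e + 1) * \<bar>case prod_decode i of (r, m) \<Rightarrow> (- q * z0 powr - d) ^ r * (real (r + m choose m) * (- p * z0 powr - a) ^ m)\<bar>" for i
  proof -
    have "\<bar>c (prod_decode i)\<bar> * z0 powr - (\<beta> (prod_decode i) + 1) = \<bar>c (prod_decode i) * z0 powr - (\<beta> (prod_decode i) + 1)\<bar>"
      by (simp only: abs_mult abs_of_nonneg[OF powr_ge_zero])
    then show ?thesis
      by (simp only: c_powr[OF \<open>0 < z0\<close>] abs_mult abs_of_nonneg[OF powr_ge_zero])
  qed
  have sum: "summable (\<lambda>i. \<bar>c (prod_decode i)\<bar> * z0 powr - (\<beta> (prod_decode i) + 1))"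
    unfolding abs_c by (intro summable_mult double_binomial_series(1) AB) simp
  note L = laplace_powr_series[where c="\<lambda>i. c (prod_decode i)" and \<beta>="\<lambda>i. \<beta> (prod_decode i)", OF \<open>0 < z0\<close> \<beta> sum, folded b_def]
  \<comment> \<open>The binomial coefficient is
    \<open>Gamma (r + 1 + m) / (fact m * Gamma (r + 1))\<close>, which is where the parameter
    \<gamma> = r + 1 of the Mittag-Leffler function comes from.\<close>
  have b_R: "b (r, m) t = ((- q) ^ r * t powr (d * real r + e)) *
      (Gamma (real r + 1 + real m) * (- p * t powr a) ^ m /
       (fact m * Gamma (real r + 1) * Gamma (a * real m + (d * real r + e + 1))))" if "0 < t" for r m t
  proof -
    have "Gamma (real r + 1 + real m) = fact (r + m)" "Gamma (real r + 1) = fact r"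
      using Gamma_fact[of "r + m", where 'a=real] Gamma_fact[of r, where 'a=real] by (simp_all add: add_ac)
    moreover have "real (r + m choose m) = fact (r + m) / (fact m * fact r)"
      by (simp add: binomial_fact)
    moreover have "t powr \<beta> (r, m) = t powr (d * real r + e) * (t powr a) ^ m"
      using that by (simp add: \<beta>_def powr_add powr_power mult.commute)
    moreover have "Gamma (\<beta> (r, m) + 1) = Gamma (a * real m + (d * real r + e + 1))"
      by (simp add: \<beta>_def add_ac)
    ultimately show ?thesis
      unfolding b_def c_def prod.case power_mult_distrib by simp
  qed
  have s: "summable (\<lambda>i. \<bar>b (prod_decode i) t\<bar>)" if "0 < t" for t
    using L(1)[OF that] .
  have R: "(\<Sum>m. b (r, m) t) = R t r" if "0 < t" for r t
    using suminf_prod_decode(1)[of "\<lambda>i. b i t", OF s[OF that], of r]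
    unfolding b_R[OF that] R_def mittag_leffler_def by (rule suminf_cmult_summable)
  show "0 < t \<Longrightarrow> summable (R t)"
    using suminf_prod_decode(2)[of "\<lambda>i. b i t", OF s] R by simp
  have sumR: "(\<Sum>r. R t r) = (\<Sum>i. b (prod_decode i) t)" if "0 < t" for t
    using suminf_prod_decode(3)[of "\<lambda>i. b i t", OF s[OF that]] R[OF that] by simp
  show "continuous_on {0<..} (\<lambda>t. \<Sum>r. R t r)"
    using L(2) by (rule continuous_on_cong[OF refl, THEN iffD1, rotated]) (simp add: sumR)
  have eq: "indicator {0<..} t * (exp (- z * t) * (\<Sum>r. R t r)) =
      indicator {0<..} t * (exp (- z * t) * (\<Sum>i. b (prod_decode i) t))" for t z
    by (cases "0 < t") (simp_all add: sumR)
  assume "z0 \<le> z"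
  with \<open>0 < z0\<close> have "0 < z" by simp
  show "integrable lborel (\<lambda>t. indicator {0<..} t * (exp (- z * t) * (\<Sum>r. R t r)))"
    unfolding eq by (rule L(3)[OF \<open>z0 \<le> z\<close>])
  have "(\<integral>t. indicator {0<..} t * (exp (- z * t) * (\<Sum>r. R t r)) \<partial>lborel) =
      (\<Sum>i. c (prod_decode i) * z powr - (\<beta> (prod_decode i) + 1))"
    unfolding eq by (rule L(4)[OF \<open>z0 \<le> z\<close>])
  also have "\<dots> = z powr - (e + 1) * (1 / (1 - (- q * z powr - d) - (- p * z powr - a)))"
    unfolding c_powr[OF \<open>0 < z\<close>]
    by (subst suminf_mult[OF summable_rabs_cancel[OF double_binomial_series(1)[OF AB[OF \<open>z0 \<le> z\<close>]]]])
      (simp only: double_binomial_series(2)[OF AB[OF \<open>z0 \<le> z\<close>]])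
  finally show "(\<integral>t. indicator {0<..} t * (exp (- z * t) * (\<Sum>r. R t r)) \<partial>lborel) =
      z powr - (e + 1) / (1 + q * z powr - d + p * z powr - a)" by simp
qed

theorem tail_eq_mittag_leffler_series:
  fixes K :: "real measure" and \<kappa> c1 c2 \<alpha>1 \<alpha>2 :: real
  defines "F \<equiv> \<lambda>t r. (- c2 / c1) ^ r * t powr ((\<alpha>1 - \<alpha>2) * real r)
      * mittag_leffler (real r + 1) \<alpha>1 ((\<alpha>1 - \<alpha>2) * real r + 1) (- (\<kappa> / c1) * t powr \<alpha>1)"
    and "G \<equiv> \<lambda>t r. (- c2 / c1) ^ (r + 1) * t powr ((\<alpha>1 - \<alpha>2) * (real r + 1))
      * mittag_leffler (real r + 1) \<alpha>1 ((\<alpha>1 - \<alpha>2) * (real r + 1) + 1) (- (\<kappa> / c1) * t powr \<alpha>1)"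
  assumes K: "real_distribution K" "AE x in K. 0 \<le> x"
    and par: "0 < \<kappa>" "0 < \<alpha>1" "\<alpha>2 < \<alpha>1" "0 < c1" "0 \<le> c2"
    and lap: "\<And>z. 0 < z \<Longrightarrow> (\<integral>x. exp (- z * x) \<partial>K) = \<kappa> / (\<kappa> + (c1 * z powr \<alpha>1 + c2 * z powr \<alpha>2))"
    and "0 < t"
  shows "summable (F t)" and "summable (G t)"
    and "measure K {t<..} = (\<Sum>r. F t r) - (\<Sum>r. G t r)"
proof -
  interpret real_distribution K by fact
  define p q d where "p = \<kappa> / c1" and "q = c2 / c1" and "d = \<alpha>1 - \<alpha>2"
  define R where "R e t r = (- q) ^ r * t powr (d * real r + e) *
    mittag_leffler (real r + 1) \<alpha>1 (d * real r + e + 1) (- p * t powr \<alpha>1)" for e t r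
  have pq: "0 < p" "0 \<le> q" "0 < d" using par by (auto simp: p_def q_def d_def)
  \<comment> \<open>Both exponents are negative, so the convergence condition of the double series
    holds from some \<open>z0\<close> on.\<close>
  have "((\<lambda>z. q * z powr - d + p * z powr - \<alpha>1) \<longlongrightarrow> q * 0 + p * 0) at_top"
    using pq par by (intro tendsto_intros tendsto_neg_powr filterlim_ident) auto
  then have "\<forall>\<^sub>F z in at_top. q * z powr - d + p * z powr - \<alpha>1 < 1 \<and> 0 < z"
    by (intro eventually_conj order_tendstoD(2)[of _ "q * 0 + p * 0"] eventually_gt_at_top) auto
  from eventually_happens'[OF trivial_limit_at_top_linorder this]
  obtain z0 where z0: "q * z0 powr - d + p * z0 powr - \<alpha>1 < 1" "0 < z0"
    by blast
  note ml = mittag_leffler_series[OF pq(1,2) par(2) pq(3) _ z0(2,1), folded R_def]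
  have F: "F = R 0"
    by (simp add: F_def R_def p_def q_def d_def fun_eq_iff)
  \<comment> \<open>The second series of the theorem is the first one with exponents shifted by
    \<open>d\<close>, with one factor \<open>- q\<close> taken out.\<close>
  have G: "G t r = - q * R d t r" for t r
    by (simp add: G_def R_def p_def q_def d_def fun_eq_iff distrib_left add_ac)
  have d0: "0 \<le> d" using pq by simp
  have sG: "(\<Sum>r. G t r) = - q * (\<Sum>r. R d t r)" if "0 < t" for t
    unfolding G by (rule suminf_mult[OF ml(1)[OF d0 that]])
  show "summable (F t)" unfolding F by (rule ml(1)[OF order_refl \<open>0 < t\<close>])
  show "summable (G t)" unfolding G[abs_def] by (rule summable_mult[OF ml(1)[OF d0 \<open>0 < t\<close>]])
  define S where "S t = (\<Sum>r. R 0 t r) + q * (\<Sum>r. R d t r)" for t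
  \<comment> \<open>The weight \<open>exp (- z0 * t)\<close> makes the difference integrable and
    moves its transform at \<open>n\<close> to the point \<open>z0 + n\<close>, where the series
    formulas hold.\<close>
  define f where "f t = indicator {0<..} t * (exp (- z0 * t) * (measure K {t<..} - S t))" for t
  have ef: "exp (- real n * t) * f t =
      indicator {0<..} t * (exp (- (z0 + real n) * t) * measure K {t<..}) -
      (indicator {0<..} t * (exp (- (z0 + real n) * t) * (\<Sum>r. R 0 t r)) +
       q * (indicator {0<..} t * (exp (- (z0 + real n) * t) * (\<Sum>r. R d t r))))" for n t
  proof -
    have "exp (- (z0 + real n) * t) = exp (- real n * t) * exp (- z0 * t)"
      by (simp add: algebra_simps flip: exp_add)
    then show ?thesis by (simp add: f_def S_def algebra_simps)
  qed
  note tail = laplace_transform_tail[OF K]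
  have zn: "0 < z0 + real n" "z0 \<le> z0 + real n" for n using z0 by auto
  note ints = tail(1)[OF zn(1)] ml(3)[OF order_refl zn(2)] ml(3)[OF d0 zn(2)]
  have "AE t in lborel. f t = 0"
  proof (rule laplace_transform_zero_imp_AE_zero)
    have "integrable lborel (\<lambda>t. exp (- real 0 * t) * f t)"
      unfolding ef by (intro Bochner_Integration.integrable_diff Bochner_Integration.integrable_add integrable_mult_right ints)
    then show "integrable lborel f" by simp
    show "f t = 0" if "t < 0" for t using that by (simp add: f_def)
    fix n :: nat
    let ?z = "z0 + real n"
    have "(\<integral>t. exp (- real n * t) * f t \<partial>lborel) =
        (1 - (\<integral>x. exp (- ?z * x) \<partial>K)) / ?z -
        (?z powr - (0 + 1) / (1 + q * ?z powr - d + p * ?z powr - \<alpha>1) +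
         q * (?z powr - (d + 1) / (1 + q * ?z powr - d + p * ?z powr - \<alpha>1)))"
      unfolding ef
      by (subst Bochner_Integration.integral_diff Bochner_Integration.integral_add,
          (intro Bochner_Integration.integrable_add integrable_mult_right ints)+)+
        (simp only: integral_mult_right_zero tail(2)[OF zn(1)] ml(4)[OF order_refl zn(2)] ml(4)[OF d0 zn(2)])
    also have "\<dots> = 0"
    proof -
      have z: "0 < ?z" by (rule zn)
      \<comment> \<open>In terms of \<open>u\<close> and \<open>v\<close> both transforms equal
        \<open>(c1 * u + c2 * v) / (W * z)\<close> at \<open>z = z0 + n\<close>.\<close>
      define u v where "u = ?z powr \<alpha>1" and "v = ?z powr \<alpha>2"
      have uv: "0 < u" "0 < v" using z by (auto simp: u_def v_def)
      define W where "W = \<kappa> + (c1 * u + c2 * v)"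
      have W: "0 < W" using par uv by (auto simp: W_def intro!: add_pos_nonneg)
      have powrs: "?z powr - d = v / u" "?z powr - \<alpha>1 = 1 / u" "?z powr - (d + 1) = v / u / ?z" "?z powr - (0 + 1) = 1 / ?z"
        using z by (simp_all add: u_def v_def d_def powr_diff powr_minus powr_add field_simps)
      have E: "1 + q * (v / u) + p * (1 / u) = W / (c1 * u)"
        using par uv by (simp add: p_def q_def W_def field_simps)
      have "1 / Z / (W / (c1 * u)) + q * (v / u / Z / (W / (c1 * u))) = (c1 * u + c2 * v) / W / Z" if "0 < Z" for Z
        using par uv W that by (simp add: q_def field_simps)
      from this[OF z] have "1 / ?z / (W / (c1 * u)) + q * (v / u / ?z / (W / (c1 * u))) = (c1 * u + c2 * v) / W / ?z" .
      moreover have "(c1 * u + c2 * v) / W = 1 - \<kappa> / W"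
        using W by (simp add: field_simps) (simp add: W_def)
      ultimately show ?thesis
        unfolding lap[OF z] powrs E u_def[symmetric] v_def[symmetric] W_def[symmetric] by simp
    qed
    finally show "(\<integral>t. exp (- real n * t) * f t \<partial>lborel) = 0" .
  qed
  then have AE: "AE t in lborel. 0 < t \<longrightarrow> measure K {t<..} = S t"
    by eventually_elim (auto simp: f_def)
  \<comment> \<open>Equality holds almost everywhere so far. The series is continuous and the tail
    is right-continuous, so a sequence of good points decreasing to \<open>t\<close> gives equality
    at \<open>t\<close>.\<close>
  have S_lim: "(S \<longlongrightarrow> S t) (at_right t)"
  proof -
    have "continuous_on {0<..} S"
      unfolding S_def by (intro continuous_intros ml(2) d0 order_refl)
    then have "isCont S t" using \<open>0 < t\<close> by (simp add: continuous_on_eq_continuous_at)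
    then show ?thesis by (simp add: isCont_def filterlim_at_split)
  qed
  have "((\<lambda>t. 1 - cdf K t) \<longlongrightarrow> 1 - cdf K t) (at_right t)"
    using cdf_is_right_cont[of t] by (intro tendsto_intros) (simp add: continuous_within)
  moreover have tail_cdf: "measure K {t<..} = 1 - cdf K t" for t
    using prob_compl[of "{..t}"] by (simp add: cdf_def Compl_eq_Diff_UNIV[symmetric] flip: not_le)
  ultimately have H_lim: "((\<lambda>t. measure K {t<..}) \<longlongrightarrow> measure K {t<..}) (at_right t)" by simp
  have ex: "\<exists>x\<in>{t<..<t + 1 / Suc n}. 0 < x \<longrightarrow> measure K {x<..} = S x" for n
    by (rule AE_lborel_ex_Ioo[OF AE]) simp
  then obtain x where x: "x n \<in> {t<..<t + 1 / Suc n}" "measure K {x n<..} = S (x n)" for n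
    using \<open>0 < t\<close> by (metis greaterThanLessThan_iff less_trans)
  have "x \<longlonglongrightarrow> t"
  proof (rule tendsto_sandwich[of "\<lambda>_. t" _ _ "\<lambda>n. t + 1 / Suc n"])
    show "(\<lambda>n. t + 1 / Suc n) \<longlonglongrightarrow> t"
      using tendsto_add[OF tendsto_const LIMSEQ_Suc[OF lim_1_over_n], of t] by simp
  qed (use x(1) in \<open>auto intro!: always_eventually less_imp_le\<close>)
  then have "filterlim x (at_right t) sequentially"
    using x(1) by (auto simp: filterlim_at intro!: always_eventually)
  then have "(\<lambda>n. S (x n)) \<longlonglongrightarrow> S t" "(\<lambda>n. S (x n)) \<longlonglongrightarrow> measure K {t<..}"
    using filterlim_compose[OF S_lim, of x sequentially] filterlim_compose[OF H_lim, of x sequentially]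
    by (simp_all add: x(2))
  then have "measure K {t<..} = S t" by (rule LIMSEQ_unique[rotated])
  then show "measure K {t<..} = (\<Sum>r. F t r) - (\<Sum>r. G t r)"
    using sG[OF \<open>0 < t\<close>] by (simp add: S_def F)
qed

section \<open>Independence and exponential times\<close>

text \<open>The open right half-lines generate the Borel sets and are closed under intersection, but
  the generator used for independence also contains the whole line. The almost sure lower bound
  turns that event into the tail event at -1; the bound lies strictly below 0 to suit variables that
  are almost surely nonnegative.\<close>

lemma (in prob_space) indep_vars_of_tails:
  fixes X :: "'i \<Rightarrow> 'a \<Rightarrow> real"
  assumes "finite I" and rv: "\<And>i. i \<in> I \<Longrightarrow> random_variable borel (X i)"
    and lower: "\<And>i. i \<in> I \<Longrightarrow> AE \<omega> in M. -1 < X i \<omega>"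
    and tails: "\<And>t. prob {\<omega> \<in> space M. \<forall>i\<in>I. t i < X i \<omega>} = (\<Prod>i\<in>I. prob {\<omega> \<in> space M. t i < X i \<omega>})"
  shows "indep_vars (\<lambda>_. borel) X I"
proof (cases "I = {}")
  case True
  then show ?thesis by (simp add: indep_vars_def indep_sets_def)
next
  case False
  let ?E = "insert UNIV (range greaterThan) :: real set set"
  have "sets (borel :: real measure) = sigma_sets UNIV (range greaterThan)"
    by (subst borel_Ioi) (simp add: sets_measure_of)
  also have "\<dots> = sigma_sets UNIV ?E"
    by (intro sigma_sets_eqI) (auto intro: sigma_sets_top)
  finally have borel: "sets (borel :: real measure) = sigma_sets (space borel) ?E" by simp
  have "indep_vars (\<lambda>_. borel) X I \<longleftrightarrow>
    (\<forall>A\<in>(\<Pi> i\<in>I. ?E). prob (\<Inter>j\<in>I. X j -` A j \<inter> space M) = (\<Prod>j\<in>I. prob (X j -` A j \<inter> space M)))"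
  proof (rule indep_vars_finite[OF False \<open>finite I\<close> borel rv])
    have "{a<..} \<inter> {b<..} = {max a b<..}" for a b :: real by auto
    then show "Int_stable ?E" by (auto simp: Int_stable_def)
  qed auto
  moreover have "prob (\<Inter>j\<in>I. X j -` A j \<inter> space M) = (\<Prod>j\<in>I. prob (X j -` A j \<inter> space M))"
    if A: "A \<in> (\<Pi> i\<in>I. ?E)" for A
  proof -
    have "\<forall>i\<in>I. \<exists>t. AE \<omega> in M. X i \<omega> \<in> A i \<longleftrightarrow> t < X i \<omega>"
    proof
      fix i assume i: "i \<in> I"
      show "\<exists>t. AE \<omega> in M. X i \<omega> \<in> A i \<longleftrightarrow> t < X i \<omega>"
      proof (cases "A i = UNIV")
        case True
        have "AE \<omega> in M. X i \<omega> \<in> A i \<longleftrightarrow> -1 < X i \<omega>"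
          using lower[OF i] by eventually_elim (auto simp: True)
        then show ?thesis ..
      next
        case False
        then obtain t where "A i = {t<..}" using A i by (auto simp: Pi_iff)
        then show ?thesis by (intro exI[of _ t]) simp
      qed
    qed
    then obtain t where t: "\<And>i. i \<in> I \<Longrightarrow> AE \<omega> in M. X i \<omega> \<in> A i \<longleftrightarrow> t i < X i \<omega>" by metis
    have Ab: "A i \<in> sets borel" if "i \<in> I" for i
      using A that by (auto simp: Pi_iff)
    have AE: "AE \<omega> in M. \<forall>i\<in>I. X i \<omega> \<in> A i \<longleftrightarrow> t i < X i \<omega>"
      using t \<open>finite I\<close> by (simp add: AE_finite_all)
    have "prob (\<Inter>j\<in>I. X j -` A j \<inter> space M) = prob {\<omega> \<in> space M. \<forall>i\<in>I. t i < X i \<omega>}"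
    proof (rule finite_measure_eq_AE)
      show "AE \<omega> in M. (\<omega> \<in> (\<Inter>j\<in>I. X j -` A j \<inter> space M)) = (\<omega> \<in> {\<omega> \<in> space M. \<forall>i\<in>I. t i < X i \<omega>})"
        using AE AE_space by eventually_elim (use False in auto)
      show "(\<Inter>j\<in>I. X j -` A j \<inter> space M) \<in> events"
        using False \<open>finite I\<close> rv Ab by (intro sets.finite_INT measurable_sets) auto
      have "{\<omega> \<in> space M. \<forall>i\<in>I. t i < X i \<omega>} = (\<Inter>i\<in>I. X i -` {t i<..} \<inter> space M)"
        using False by auto
      also have "\<dots> \<in> events"
        using False \<open>finite I\<close> rv by (intro sets.finite_INT measurable_sets) auto
      finally show "{\<omega> \<in> space M. \<forall>i\<in>I. t i < X i \<omega>} \<in> events" .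
    qed
    also have "\<dots> = (\<Prod>i\<in>I. prob {\<omega> \<in> space M. t i < X i \<omega>})" by (rule tails)
    also have "\<dots> = (\<Prod>i\<in>I. prob (X i -` A i \<inter> space M))"
    proof (rule prod.cong[OF refl])
      fix i assume i: "i \<in> I"
      note [measurable] = rv[OF i] Ab[OF i]
      show "prob {\<omega> \<in> space M. t i < X i \<omega>} = prob (X i -` A i \<inter> space M)"
      proof (rule finite_measure_eq_AE)
        show "AE \<omega> in M. (\<omega> \<in> {\<omega> \<in> space M. t i < X i \<omega>}) = (\<omega> \<in> X i -` A i \<inter> space M)"
          using t[OF i] AE_space by eventually_elim auto
      qed measurable
    qed
    finally show ?thesis .
  qed
  ultimately show ?thesis by blast
qed

text \<open>Given the event \<open>E\<close> and positive holding times, the factorised tails make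
  the \<open>S m\<close> independent exponential variables. Sums over disjoint blocks of rate
  \<open>l\<close> are then independent Erlang variables. Indices outside the blocks may have other
  rates; this is the place of the idle periods.\<close>

lemma (in prob_space) nn_integral_exponential_blocks:
  fixes S :: "nat \<Rightarrow> 'a \<Rightarrow> real" and h :: "'i \<Rightarrow> real \<Rightarrow> ennreal"
  assumes E [measurable]: "E \<in> events" and S [measurable]: "\<And>m. random_variable borel (S m)"
    and r: "\<And>m. m < N \<Longrightarrow> 0 < r m" and "0 < l" and "0 < w"
    and tail: "\<And>s. (\<And>m. m < N \<Longrightarrow> 0 \<le> s m) \<Longrightarrow>
      prob {\<omega> \<in> space M. \<omega> \<in> E \<and> (\<forall>m<N. s m < S m \<omega>)} = w * (\<Prod>m<N. exp (- r m * s m))"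
    and "finite I" and B: "\<And>i. i \<in> I \<Longrightarrow> B i \<subseteq> {..<N}" "disjoint_family_on B I"
      "\<And>i. i \<in> I \<Longrightarrow> card (B i) = Suc (a i)" "\<And>i m. i \<in> I \<Longrightarrow> m \<in> B i \<Longrightarrow> r m = l"
    and h [measurable]: "\<And>i. h i \<in> borel_measurable borel"
  shows "(\<integral>\<^sup>+\<omega>. (\<Prod>i\<in>I. h i (\<Sum>m\<in>B i. S m \<omega>)) * indicator {\<omega> \<in> space M. \<omega> \<in> E \<and> (\<forall>m<N. 0 < S m \<omega>)} \<omega> \<partial>M) =
    ennreal w * (\<Prod>i\<in>I. \<integral>\<^sup>+x. ennreal (erlang_density (a i) l x) * h i x \<partial>lborel)"
proof -
  \<comment> \<open>Positivity belongs to the event because \<open>tail\<close> covers nonnegative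
    thresholds; the thresholds 0 give it probability \<open>w\<close>, and a negative threshold can
    be replaced by 0.\<close>
  define E' where "E' = {\<omega> \<in> space M. \<omega> \<in> E \<and> (\<forall>m<N. 0 < S m \<omega>)}"
  have [measurable]: "E' \<in> events" unfolding E'_def by measurable
  have E': "prob E' = w" using tail[of "\<lambda>_. 0"] by (simp add: E'_def)
  define U where "U = uniform_measure M E'"
  interpret U: prob_space U
    unfolding U_def using E' \<open>0 < w\<close> by (intro prob_space_uniform_measure) (auto simp: emeasure_eq_measure)
  have sets_U [measurable_cong]: "sets U = sets M" and space_U: "space U = space M"
    by (simp_all add: U_def)
  have joint: "U.prob {\<omega> \<in> space U. \<forall>m\<in>{..<N}. t m < S m \<omega>} = (\<Prod>m<N. exp (- r m * max 0 (t m)))" for t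
  proof -
    have "U.prob {\<omega> \<in> space U. \<forall>m\<in>{..<N}. t m < S m \<omega>} =
        prob (E' \<inter> {\<omega> \<in> space M. \<forall>m\<in>{..<N}. t m < S m \<omega>}) / w"
      unfolding space_U E'[symmetric] unfolding U_def
      by (rule measure_uniform_measure) (use E' \<open>0 < w\<close> in \<open>auto simp: emeasure_eq_measure\<close>)
    also have "E' \<inter> {\<omega> \<in> space M. \<forall>m\<in>{..<N}. t m < S m \<omega>} =
        {\<omega> \<in> space M. \<omega> \<in> E \<and> (\<forall>m<N. max 0 (t m) < S m \<omega>)}"
      by (auto simp: E'_def)
    also have "prob \<dots> = w * (\<Prod>m<N. exp (- r m * max 0 (t m)))"
      by (rule tail) simp
    finally show ?thesis using \<open>0 < w\<close> by simp
  qed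
  have pos: "AE \<omega> in U. \<forall>m<N. 0 < S m \<omega>"
  proof -
    have "AE \<omega> in U. \<omega> \<in> E'"
      unfolding U_def by (rule AE_uniform_measureI) auto
    then show ?thesis by (auto simp: E'_def elim!: eventually_mono)
  qed
  have marginal: "U.prob {\<omega> \<in> space U. t < S j \<omega>} = exp (- r j * max 0 t)" if j: "j < N" for j t
  proof -
    have "U.prob {\<omega> \<in> space U. t < S j \<omega>} =
        U.prob {\<omega> \<in> space U. \<forall>m\<in>{..<N}. (if m = j then t else 0) < S m \<omega>}"
    proof (rule U.finite_measure_eq_AE)
      show "AE \<omega> in U. (\<omega> \<in> {\<omega> \<in> space U. t < S j \<omega>}) =
          (\<omega> \<in> {\<omega> \<in> space U. \<forall>m\<in>{..<N}. (if m = j then t else 0) < S m \<omega>})"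
        using pos by eventually_elim (use j in auto)
    qed measurable
    also have "\<dots> = (\<Prod>m<N. if m = j then exp (- r j * max 0 t) else 1)"
      unfolding joint by (intro prod.cong) auto
    also have "\<dots> = exp (- r j * max 0 t)" using j by simp
    finally show ?thesis .
  qed
  have indep: "U.indep_vars (\<lambda>_. borel) S {..<N}"
  proof (rule U.indep_vars_of_tails)
    fix i assume "i \<in> {..<N}"
    then show "AE \<omega> in U. -1 < S i \<omega>"
      using pos by (auto elim!: eventually_mono intro: less_trans[of "-1" 0])
  next
    show "U.prob {\<omega> \<in> space U. \<forall>i\<in>{..<N}. t i < S i \<omega>} =
        (\<Prod>i<N. U.prob {\<omega> \<in> space U. t i < S i \<omega>})" for t
      unfolding joint by (intro prod.cong) (auto simp: marginal)
  qed simp_all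
  have exponential: "distributed U lborel (S j) (exponential_density (r j))" if j: "j < N" for j
  proof -
    have "U.prob {\<omega> \<in> space U. S j \<omega> \<le> x} = 1 - exp (- x * r j)" if "0 \<le> x" for x
    proof -
      have "U.prob {\<omega> \<in> space U. S j \<omega> \<le> x} = 1 - U.prob {\<omega> \<in> space U. \<not> S j \<omega> \<le> x}"
        by (subst U.prob_neg) auto
      then show ?thesis using marginal[OF j, of x] that by (simp add: not_le max_def mult.commute)
    qed
    then show ?thesis using r[OF j] by (simp add: U.exponential_distributed_iff)
  qed
  have erl: "distributed U lborel (\<lambda>\<omega>. \<Sum>m\<in>B i. S m \<omega>) (erlang_density (a i) l)" if i: "i \<in> I" for i
  proof -
    have "finite (B i)" "B i \<noteq> {}"
      using B(3)[OF i] by (auto intro: card_ge_0_finite)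
    moreover have "distributed U lborel (S m) (exponential_density l)" if "m \<in> B i" for m
      using exponential[of m] B(1,4)[OF i] that by auto
    ultimately have "distributed U lborel (\<lambda>\<omega>. \<Sum>m\<in>B i. S m \<omega>) (erlang_density (card (B i) - 1) l)"
      using \<open>0 < l\<close> U.indep_vars_subset[OF indep B(1)[OF i]]
      by (intro U.exponential_distributed_sum)
    then show ?thesis by (simp add: B(3)[OF i])
  qed
  have "U.indep_vars (\<lambda>i. PiM (B i) (\<lambda>_. borel)) (\<lambda>i \<omega>. restrict (\<lambda>m. S m \<omega>) (B i)) I"
    using indep B(1,2) by (rule U.indep_vars_restrict)
  then have "U.indep_vars (\<lambda>_. borel) (\<lambda>i \<omega>. h i (\<Sum>m\<in>B i. restrict (\<lambda>m. S m \<omega>) (B i) m)) I"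
    by (rule U.indep_vars_compose2) measurable
  then have indep_h: "U.indep_vars (\<lambda>_. borel) (\<lambda>i \<omega>. h i (\<Sum>m\<in>B i. S m \<omega>)) I"
    by (simp cong: sum.cong)
  have "(\<integral>\<^sup>+\<omega>. (\<Prod>i\<in>I. h i (\<Sum>m\<in>B i. S m \<omega>)) \<partial>U) = (\<Prod>i\<in>I. \<integral>\<^sup>+\<omega>. h i (\<Sum>m\<in>B i. S m \<omega>) \<partial>U)"
    by (rule U.indep_vars_nn_integral[OF \<open>finite I\<close> indep_h]) simp
  also have "\<dots> = (\<Prod>i\<in>I. \<integral>\<^sup>+x. ennreal (erlang_density (a i) l x) * h i x \<partial>lborel)"
    by (intro prod.cong refl distributed_nn_integral[OF erl, symmetric]) auto
  finally have *: "(\<integral>\<^sup>+\<omega>. (\<Prod>i\<in>I. h i (\<Sum>m\<in>B i. S m \<omega>)) \<partial>U) = \<dots>" .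
  have "(\<integral>\<^sup>+\<omega>. (\<Prod>i\<in>I. h i (\<Sum>m\<in>B i. S m \<omega>)) \<partial>U) =
      (\<integral>\<^sup>+\<omega>. (\<Prod>i\<in>I. h i (\<Sum>m\<in>B i. S m \<omega>)) * indicator E' \<omega> \<partial>M) / ennreal w"
    unfolding U_def by (subst nn_integral_uniform_measure) (auto simp: emeasure_eq_measure E')
  then have "ennreal w * (\<integral>\<^sup>+\<omega>. (\<Prod>i\<in>I. h i (\<Sum>m\<in>B i. S m \<omega>)) \<partial>U) =
      (\<integral>\<^sup>+\<omega>. (\<Prod>i\<in>I. h i (\<Sum>m\<in>B i. S m \<omega>)) * indicator E' \<omega> \<partial>M)"
    using \<open>0 < w\<close> by (simp add: ennreal_times_divide mult_divide_eq_ennreal mult.commute[of "ennreal w"] ennreal_divide_times)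
  then show ?thesis unfolding * E'_def ..
qed

section \<open>Phases along step paths\<close>

text \<open>Negative times are left unconstrained; phases start and end at positive times.\<close>

definition step_path :: "(real \<Rightarrow> 's) \<Rightarrow> (nat \<Rightarrow> 's) \<Rightarrow> (nat \<Rightarrow> real) \<Rightarrow> bool" where
  "step_path x Z U \<longleftrightarrow> U 0 = 0 \<and> strict_mono U \<and> (\<forall>t. \<exists>n. t < U n) \<and>
    (\<forall>n t. U n \<le> t \<longrightarrow> t < U (Suc n) \<longrightarrow> x t = Z n)"

lemma increasing_index_left:
  fixes U :: "nat \<Rightarrow> real"
  assumes "U 0 < t" "\<exists>n. t < U n"
  obtains i where "U i < t" "t \<le> U (Suc i)"
proof -
  obtain n where "t \<le> U n" using assms(2) less_imp_le by blast
  then have "\<exists>i. U i < t \<and> t \<le> U (Suc i)"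
  proof (induction n)
    case (Suc n)
    then show ?case by (cases "t \<le> U n") (auto simp: not_le)
  qed (use assms(1) in simp)
  then show ?thesis using that by blast
qed

lemma increasing_index_right:
  fixes U :: "nat \<Rightarrow> real"
  assumes "U 0 \<le> t" "\<exists>n. t < U n"
  obtains i where "U i \<le> t" "t < U (Suc i)"
proof -
  obtain n where "t < U n" using assms(2) by blast
  then have "\<exists>i. U i \<le> t \<and> t < U (Suc i)"
  proof (induction n)
    case (Suc n)
    then show ?case by (cases "t < U n") (auto simp: not_less)
  qed (use assms(1) in simp)
  then show ?thesis using that by blast
qed

lemma step_path_left_limit:
  assumes x: "step_path x Z U" and t: "U i < t" "t \<le> U (Suc i)"
  shows "(\<forall>\<^sub>F u in at_left t. x u = y) \<longleftrightarrow> y = Z i"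
proof -
  have ev: "\<forall>\<^sub>F u in at_left t. x u = Z i"
    unfolding eventually_at_left[OF t(1)]
    using x t by (intro exI[of _ "U i"]) (auto simp: step_path_def)
  show ?thesis
  proof
    assume "\<forall>\<^sub>F u in at_left t. x u = y"
    with ev have "\<forall>\<^sub>F u in at_left t. y = Z i" by eventually_elim auto
    then show "y = Z i" by simp
  qed (use ev in simp)
qed

text \<open>The discrete counterpart of \<open>phase_completed_at\<close>. Index \<open>m\<close>
  stands for the jump out of the state with number \<open>m\<close>, which happens at time
  \<open>U (Suc m)\<close>.\<close>

definition completes :: "nat \<Rightarrow> (nat \<Rightarrow> nat \<times> nat) \<Rightarrow> nat \<Rightarrow> bool" where
  "completes k Z m \<longleftrightarrow> Z m \<in> busy_states k \<and> Z (Suc m) = after_phase k (Z m)"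

definition starts :: "nat \<Rightarrow> (nat \<Rightarrow> nat \<times> nat) \<Rightarrow> nat \<Rightarrow> bool" where
  "starts k Z m \<longleftrightarrow> (Z m = (0, 0) \<and> Z (Suc m) = (1, k)) \<or> (completes k Z m \<and> Z (Suc m) \<noteq> (0, 0))"

lemma after_phase_neq: "y \<in> busy_states k \<Longrightarrow> after_phase k y \<noteq> y"
  by (cases y) (auto simp: busy_states_def)

text \<open>Inside a holding interval the left limit equals the current state, whereas a completion
  changes the state. So completions happen at jump times.\<close>

lemma step_path_completed:
  assumes x: "step_path x Z U"
  shows "phase_completed_at k x t \<longleftrightarrow> (\<exists>i. t = U (Suc i) \<and> completes k Z i)"
proof -
  have U: "U 0 = 0" "\<And>i. U i < U (Suc i)" "\<And>t. \<exists>n. t < U n" "\<And>i. 0 < U (Suc i)"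
    and xZ: "\<And>n. x (U n) = Z n" "\<And>n t. U n \<le> t \<Longrightarrow> t < U (Suc n) \<Longrightarrow> x t = Z n"
    using x unfolding step_path_def by (auto simp: strict_mono_Suc_iff) (metis strict_monoD strict_mono_Suc_iff zero_less_Suc)
  show ?thesis
  proof
    assume p: "phase_completed_at k x t"
    then have "U 0 < t" by (simp add: phase_completed_at_def U)
    then obtain i where i: "U i < t" "t \<le> U (Suc i)"
      using U(3) by (rule increasing_index_left)
    from p have Z: "Z i \<in> busy_states k" "x t = after_phase k (Z i)"
      by (auto simp: phase_completed_at_def step_path_left_limit[OF x i])
    have "t = U (Suc i)"
    proof (rule ccontr)
      assume "t \<noteq> U (Suc i)"
      then have "x t = Z i" using i by (intro xZ(2)) auto
      with Z after_phase_neq show False by metis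
    qed
    with Z xZ(1)[of "Suc i"] show "\<exists>i. t = U (Suc i) \<and> completes k Z i"
      by (auto simp: completes_def)
  next
    assume "\<exists>i. t = U (Suc i) \<and> completes k Z i"
    then obtain i where i: "t = U (Suc i)" "completes k Z i" by blast
    then have "U i < t" "t \<le> U (Suc i)" using U by auto
    note l = step_path_left_limit[OF x this]
    show "phase_completed_at k x t"
      unfolding phase_completed_at_def l using i U(4)[of i] xZ(1)[of "Suc i"] by (auto simp: completes_def)
  qed
qed

lemma step_path_started:
  assumes x: "step_path x Z U"
  shows "phase_started_at k x t \<longleftrightarrow> (\<exists>i. t = U (Suc i) \<and> starts k Z i)"
proof -
  have U: "U 0 = 0" "\<And>i. U i < U (Suc i)" "\<And>t. \<exists>n. t < U n" "\<And>i. 0 < U (Suc i)"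
    and xZ: "\<And>n. x (U n) = Z n" "\<And>n t. U n \<le> t \<Longrightarrow> t < U (Suc n) \<Longrightarrow> x t = Z n"
    using x unfolding step_path_def by (auto simp: strict_mono_Suc_iff) (metis strict_monoD strict_mono_Suc_iff zero_less_Suc)
  have idle: "(0 < t \<and> (\<forall>\<^sub>F u in at_left t. x u = (0, 0)) \<and> x t = (1, k)) \<longleftrightarrow>
      (\<exists>i. t = U (Suc i) \<and> Z i = (0, 0) \<and> Z (Suc i) = (1, k))"
  proof
    assume p: "0 < t \<and> (\<forall>\<^sub>F u in at_left t. x u = (0, 0)) \<and> x t = (1, k)"
    then have "U 0 < t" by (simp add: U)
    then obtain i where i: "U i < t" "t \<le> U (Suc i)"
      using U(3) by (rule increasing_index_left)
    from p have Z: "Z i = (0, 0)" "x t = (1, k)"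
      by (auto simp: step_path_left_limit[OF x i])
    have "t = U (Suc i)"
    proof (rule ccontr)
      assume "t \<noteq> U (Suc i)"
      then have "x t = Z i" using i by (intro xZ(2)) auto
      with Z show False by simp
    qed
    with Z xZ(1)[of "Suc i"] show "\<exists>i. t = U (Suc i) \<and> Z i = (0, 0) \<and> Z (Suc i) = (1, k)" by auto
  next
    assume "\<exists>i. t = U (Suc i) \<and> Z i = (0, 0) \<and> Z (Suc i) = (1, k)"
    then obtain i where i: "t = U (Suc i)" "Z i = (0, 0)" "Z (Suc i) = (1, k)" by blast
    then have "U i < t" "t \<le> U (Suc i)" using U by auto
    note l = step_path_left_limit[OF x this]
    show "0 < t \<and> (\<forall>\<^sub>F u in at_left t. x u = (0, 0)) \<and> x t = (1, k)"
      unfolding l using i U(4)[of i] xZ(1)[of "Suc i"] by auto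
  qed
  have "phase_started_at k x t \<longleftrightarrow> (0 < t \<and> (\<forall>\<^sub>F u in at_left t. x u = (0, 0)) \<and> x t = (1, k)) \<or>
      (phase_completed_at k x t \<and> x t \<noteq> (0, 0))"
    by (auto simp: phase_started_at_def phase_completed_at_def)
  then show ?thesis
    unfolding idle step_path_completed[OF x] starts_def using xZ(1) by auto
qed

text \<open>Since \<open>U\<close> is strictly increasing, \<open>U m < U (Suc i)\<close> means
  \<open>m \<le> i\<close>. The infimum is therefore a minimum, attained at the first admissible
  index from \<open>m\<close> on.\<close>

lemma Inf_step_times:
  fixes U :: "nat \<Rightarrow> real"
  assumes U: "strict_mono U" and "m \<le> l" "P l" "\<And>j. m \<le> j \<Longrightarrow> j < l \<Longrightarrow> \<not> P j"
  shows "Inf {t. U m < t \<and> (\<exists>i. t = U (Suc i) \<and> P i)} = U (Suc l)"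
proof (rule cInf_eq_minimum)
  show "U (Suc l) \<in> {t. U m < t \<and> (\<exists>i. t = U (Suc i) \<and> P i)}"
    using assms by (auto simp: strict_mono_less)
next
  fix t assume "t \<in> {t. U m < t \<and> (\<exists>i. t = U (Suc i) \<and> P i)}"
  then obtain i where i: "t = U (Suc i)" "P i" "m < Suc i" using U by (auto simp: strict_mono_less)
  then have "l \<le> i" using assms(4)[of i] by (meson not_le less_Suc_eq_le)
  with i U show "U (Suc l) \<le> t" by (simp add: strict_mono_less_eq)
qed

text \<open>
  The path of the jump chain on which phase \<open>i\<close> sees exactly \<open>a i\<close> arrivals; a configuration
  \<open>(i, r, x)\<close> consists of the current phase, the number of arrivals still to come in it, and the state.
\<close>

primrec phase_cfg :: "nat \<Rightarrow> (nat \<Rightarrow> nat) \<Rightarrow> nat \<Rightarrow> nat \<times> nat \<times> nat \<times> nat" where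
  "phase_cfg k a 0 = (0, a 0, (0, 0))"
| "phase_cfg k a (Suc m) = (case phase_cfg k a m of (i, r, x) \<Rightarrow>
    if x = (0, 0) then (i, r, (1, k))
    else if 0 < r then (i, r - 1, (fst x + 1, snd x))
    else (Suc i, a (Suc i), after_phase k x))"

definition chain_path :: "nat \<Rightarrow> (nat \<Rightarrow> nat) \<Rightarrow> nat \<Rightarrow> nat \<times> nat" where
  "chain_path k a m = snd (snd (phase_cfg k a m))"

text \<open>This counts jumps: a phase takes \<open>a i\<close> arrivals and one completion,
  preceded by one arrival if the queue is empty. The result is the index of the state reached when
  the first \<open>i\<close> phases are over.\<close>

primrec phases_end :: "nat \<Rightarrow> (nat \<Rightarrow> nat) \<Rightarrow> nat \<Rightarrow> nat" where
  "phases_end k a 0 = 0"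
| "phases_end k a (Suc i) =
    phases_end k a i + (if chain_path k a (phases_end k a i) = (0, 0) then 1 else 0) + a i + 1"

definition phase_begin :: "nat \<Rightarrow> (nat \<Rightarrow> nat) \<Rightarrow> nat \<Rightarrow> nat" where
  "phase_begin k a i = phases_end k a i + (if chain_path k a (phases_end k a i) = (0, 0) then 1 else 0)"

lemma phases_end_Suc: "phases_end k a (Suc i) = Suc (phase_begin k a i + a i)"
  by (simp add: phase_begin_def)

declare phases_end.simps(2) [simp del]

section \<open>The jump chain phase by phase\<close>

lemma after_phase_states:
  "y \<in> busy_states k \<Longrightarrow> after_phase k y \<in> insert (0, 0) (busy_states k)"
  by (cases y) (auto simp: busy_states_def)

lemma busy_nonzero: "y \<in> busy_states k \<Longrightarrow> y \<noteq> (0, 0)"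
  by (auto simp: busy_states_def)

text \<open>The configuration keeps step with the index count: at \<open>phases_end\<close> it has
  just entered phase \<open>i\<close> with all its arrivals still to come. The fact
  \<open>block\<close> is the induction step of this invariant and at the same time yields the
  course of the phase in the last claim.\<close>

lemma phase_cfg_end:
  assumes "1 \<le> k"
  shows "fst (phase_cfg k a (phases_end k a i)) = i"
    and "fst (snd (phase_cfg k a (phases_end k a i))) = a i"
    and "chain_path k a (phases_end k a i) \<in> insert (0, 0) (busy_states k)"
    and "\<exists>y\<in>busy_states k. (\<forall>l\<le>a i. phase_cfg k a (phase_begin k a i + l) = (i, a i - l, fst y + l, snd y)) \<and>
      chain_path k a (phases_end k a (Suc i)) = after_phase k (fst y + a i, snd y)"
proof -
  have block: "\<exists>y\<in>busy_states k. (\<forall>l\<le>a i. phase_cfg k a (phase_begin k a i + l) = (i, a i - l, fst y + l, snd y)) \<and>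
      phase_cfg k a (phases_end k a (Suc i)) = (Suc i, a (Suc i), after_phase k (fst y + a i, snd y))"
    if IH: "fst (phase_cfg k a (phases_end k a i)) = i" "fst (snd (phase_cfg k a (phases_end k a i))) = a i"
      "chain_path k a (phases_end k a i) \<in> insert (0, 0) (busy_states k)" for i
  proof -
    have cfg: "phase_cfg k a (phases_end k a i) = (i, a i, chain_path k a (phases_end k a i))"
      using IH(1,2) unfolding chain_path_def by (simp add: prod_eq_iff)
    obtain y where y: "y \<in> busy_states k" "phase_cfg k a (phase_begin k a i) = (i, a i, y)"
    proof (cases "chain_path k a (phases_end k a i) = (0, 0)")
      case True
      then have "phase_cfg k a (phase_begin k a i) = (i, a i, (1, k))"
        using cfg by (simp add: phase_begin_def)
      moreover have "(1, k) \<in> busy_states k" using assms by (simp add: busy_states_def)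
      ultimately show ?thesis by (rule that[rotated])
    next
      case False
      then have "phase_cfg k a (phase_begin k a i) = (i, a i, chain_path k a (phases_end k a i))"
        using cfg by (simp add: phase_begin_def)
      moreover have "chain_path k a (phases_end k a i) \<in> busy_states k" using False IH(3) by simp
      ultimately show ?thesis by (rule that[rotated])
    qed
    have y0: "(fst y + l, snd y) \<noteq> (0, 0)" for l using y(1) by (auto simp: busy_states_def)
    have l: "phase_cfg k a (phase_begin k a i + l) = (i, a i - l, fst y + l, snd y)" if "l \<le> a i" for l
      using that
    proof (induction l)
      case (Suc l)
      then have IH: "phase_cfg k a (phase_begin k a i + l) = (i, a i - l, fst y + l, snd y)" by simp
      show ?case
        unfolding add_Suc_right phase_cfg.simps IH prod.case if_not_P[OF y0] using Suc.prems by simp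
    qed (simp add: y)
    have e: "phase_cfg k a (phases_end k a (Suc i)) = (Suc i, a (Suc i), after_phase k (fst y + a i, snd y))"
      unfolding phases_end_Suc phase_cfg.simps l[OF order_refl] prod.case if_not_P[OF y0] by simp
    show ?thesis
    proof (intro bexI[OF _ y(1)] conjI allI impI)
      fix l' assume "l' \<le> a i"
      then show "phase_cfg k a (phase_begin k a i + l') = (i, a i - l', fst y + l', snd y)" by (rule l)
    qed (rule e)
  qed
  have inv: "fst (phase_cfg k a (phases_end k a i)) = i \<and> fst (snd (phase_cfg k a (phases_end k a i))) = a i \<and>
      chain_path k a (phases_end k a i) \<in> insert (0, 0) (busy_states k)" for i
  proof (induction i)
    case 0
    then show ?case by (simp add: chain_path_def)
  next
    case (Suc i)
    then obtain y where "y \<in> busy_states k"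
      "phase_cfg k a (phases_end k a (Suc i)) = (Suc i, a (Suc i), after_phase k (fst y + a i, snd y))"
      using block[of i] by blast
    moreover from this have "(fst y + a i, snd y) \<in> busy_states k" by (auto simp: busy_states_def)
    ultimately show ?case using after_phase_states[of "(fst y + a i, snd y)" k]
      by (simp add: chain_path_def del: after_phase.simps)
  qed
  then show "fst (phase_cfg k a (phases_end k a i)) = i"
    "fst (snd (phase_cfg k a (phases_end k a i))) = a i"
    "chain_path k a (phases_end k a i) \<in> insert (0, 0) (busy_states k)" by blast+
  show "\<exists>y\<in>busy_states k. (\<forall>l\<le>a i. phase_cfg k a (phase_begin k a i + l) = (i, a i - l, fst y + l, snd y)) \<and>
      chain_path k a (phases_end k a (Suc i)) = after_phase k (fst y + a i, snd y)"
  proof -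
    obtain y where y: "y \<in> busy_states k"
      "\<forall>l\<le>a i. phase_cfg k a (phase_begin k a i + l) = (i, a i - l, fst y + l, snd y)"
      "phase_cfg k a (phases_end k a (Suc i)) = (Suc i, a (Suc i), after_phase k (fst y + a i, snd y))"
      using block[of i] inv[of i] by blast
    then have "chain_path k a (phases_end k a (Suc i)) = after_phase k (fst y + a i, snd y)"
      by (simp add: chain_path_def del: after_phase.simps)
    with y show ?thesis by blast
  qed
qed

lemma chain_path_block:
  assumes "1 \<le> k"
  obtains y where "y \<in> busy_states k"
    "\<And>l. l \<le> a i \<Longrightarrow> chain_path k a (phase_begin k a i + l) = (fst y + l, snd y)"
    "chain_path k a (phases_end k a (Suc i)) = after_phase k (fst y + a i, snd y)"
    "\<And>l. l \<le> a i \<Longrightarrow> (fst y + l, snd y) \<in> busy_states k"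
proof -
  obtain y where y: "y \<in> busy_states k"
    "\<And>l. l \<le> a i \<Longrightarrow> phase_cfg k a (phase_begin k a i + l) = (i, a i - l, fst y + l, snd y)"
    "chain_path k a (phases_end k a (Suc i)) = after_phase k (fst y + a i, snd y)"
    using phase_cfg_end(4)[OF assms, of a i] by blast
  show ?thesis
    by (rule that[OF y(1)]) (use y in \<open>auto simp: chain_path_def busy_states_def\<close>)
qed

lemma chain_path_begin_idle:
  assumes "1 \<le> k" "chain_path k a (phases_end k a i) = (0, 0)"
  shows "chain_path k a (Suc (phases_end k a i)) = (1, k)"
  using assms(2) by (auto simp: chain_path_def split: prod.split)

lemma arrival_neq_after_phase: "y \<in> busy_states k \<Longrightarrow> (Suc (fst y), snd y) \<noteq> after_phase k y"
  by (cases y) (auto simp: busy_states_def)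

lemma chain_path_not_completes:
  assumes k: "1 \<le> k" and m: "phase_begin k a i \<le> m" "m < phase_begin k a i + a i"
  shows "chain_path k a m \<in> busy_states k"
    and "chain_path k a (Suc m) = (Suc (fst (chain_path k a m)), snd (chain_path k a m))"
    and "\<not> completes k (chain_path k a) m" and "\<not> starts k (chain_path k a) m"
proof -
  obtain y where y: "y \<in> busy_states k"
    "\<And>l. l \<le> a i \<Longrightarrow> chain_path k a (phase_begin k a i + l) = (fst y + l, snd y)"
    "\<And>l. l \<le> a i \<Longrightarrow> (fst y + l, snd y) \<in> busy_states k"
    using chain_path_block[OF k] by metis
  obtain l where l: "m = phase_begin k a i + l" "l < a i" using m by (auto simp: le_iff_add)
  show busy: "chain_path k a m \<in> busy_states k" using y(2,3)[of l] l by simp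
  show Suc: "chain_path k a (Suc m) = (Suc (fst (chain_path k a m)), snd (chain_path k a m))"
    using y(2)[of l] y(2)[of "Suc l"] l by simp
  show c: "\<not> completes k (chain_path k a) m"
    unfolding completes_def Suc using arrival_neq_after_phase[OF busy] by simp
  show "\<not> starts k (chain_path k a) m"
    unfolding starts_def using c busy busy_nonzero by blast
qed

lemma chain_path_completes:
  assumes k: "1 \<le> k"
  shows "completes k (chain_path k a) (phase_begin k a i + a i)"
  using chain_path_block[OF k, of a i] unfolding completes_def phases_end_Suc by (metis order_refl)

text \<open>A completion that leaves customers behind is itself the start of the next phase; after
  one that empties the queue, the start is the following arrival. The final clause excludes earlier
  starts, so that an infimum over later starts finds this one.\<close>

lemma chain_path_starts:
  assumes k: "1 \<le> k"
  shows "\<exists>m. phase_begin k a i = Suc m \<and> starts k (chain_path k a) m \<and>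
    (case i of 0 \<Rightarrow> m = 0 | Suc j \<Rightarrow> phase_begin k a j \<le> m \<and>
      (\<forall>m'. phase_begin k a j \<le> m' \<longrightarrow> m' < m \<longrightarrow> \<not> starts k (chain_path k a) m'))"
proof (cases i)
  case 0
  have "chain_path k a 0 = (0, 0)" by (simp add: chain_path_def)
  moreover from this have "chain_path k a (Suc 0) = (1, k)"
    using chain_path_begin_idle[OF k, of a 0] by simp
  ultimately show ?thesis using 0 by (simp add: phase_begin_def starts_def)
next
  case (Suc j)
  let ?m = "phase_begin k a j + a j"
  note e = phases_end_Suc[of k a j]
  have c: "completes k (chain_path k a) ?m" by (rule chain_path_completes[OF k])
  have no: "\<not> starts k (chain_path k a) m'" if "phase_begin k a j \<le> m'" "m' < ?m" for m'
    using chain_path_not_completes(4)[OF k that] .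
  show ?thesis
  proof (cases "chain_path k a (Suc ?m) = (0, 0)")
    case True
    then have "phase_begin k a i = Suc (Suc ?m)" by (simp add: phase_begin_def Suc e)
    moreover have "starts k (chain_path k a) (Suc ?m)"
      using chain_path_begin_idle[OF k, of a i] True by (simp add: starts_def Suc e)
    moreover have "\<not> starts k (chain_path k a) ?m"
      using True c busy_nonzero by (auto simp: starts_def completes_def)
    ultimately show ?thesis using no by (auto simp: Suc less_Suc_eq)
  next
    case False
    then have "phase_begin k a i = Suc ?m" by (simp add: phase_begin_def Suc e)
    moreover have "starts k (chain_path k a) ?m" using False c by (simp add: starts_def)
    ultimately show ?thesis using no by (auto simp: Suc)
  qed
qed

lemma phases_end_le_mono: "i \<le> j \<Longrightarrow> phases_end k a i \<le> phases_end k a j"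
  by (induction j) (auto simp: le_Suc_eq phases_end.simps(2))

lemma phase_begin_less_end: "i < n \<Longrightarrow> phase_begin k a i + a i < phases_end k a n"
  using phases_end_le_mono[of "Suc i" n k a] by (simp add: phases_end_Suc)

text \<open>The infima that define the first \<open>n\<close> starts and ends are attained at jumps
  with index below \<open>phases_end k a n\<close>, so agreement with the chain path up to that
  index suffices.\<close>

lemma step_path_phases:
  assumes k: "1 \<le> k" and x: "step_path x Z U" and Z: "\<And>m. m \<le> phases_end k a n \<Longrightarrow> Z m = chain_path k a m"
  shows "i < n \<Longrightarrow> phase_start k x i = U (phase_begin k a i)"
    and "i < n \<Longrightarrow> phase_end k x i = U (phases_end k a (Suc i))"
proof -
  have U: "strict_mono U" "U 0 = 0" using x by (auto simp: step_path_def)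
  have starts: "starts k Z m \<longleftrightarrow> starts k (chain_path k a) m" and completes: "completes k Z m \<longleftrightarrow> completes k (chain_path k a) m"
    if "m < phases_end k a n" for m
    using that Z by (auto simp: starts_def completes_def)
  have "i < n \<longrightarrow> phase_start k x i = U (phase_begin k a i)" for i
  proof (induction i)
    case 0
    show ?case
    proof
      assume "0 < n"
      obtain m where m: "phase_begin k a 0 = Suc m" "starts k (chain_path k a) m" "m = 0"
        using chain_path_starts[OF k, of a 0] by auto
      have less: "phase_begin k a 0 < phases_end k a n"
        using phase_begin_less_end[OF \<open>0 < n\<close>, of k a] by simp
      \<comment> \<open>Starts are positive times and \<open>U 0 = 0\<close>, so the first infimum
        takes the same form as the later ones.\<close>
      have "phase_start k x 0 = Inf {t. U 0 < t \<and> phase_started_at k x t}"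
        unfolding phase_start.simps U(2) by (intro arg_cong[where f=Inf]) (auto simp: phase_started_at_def)
      also have "\<dots> = U (Suc m)"
        unfolding step_path_started[OF x] using m less by (intro Inf_step_times U) (auto simp: starts)
      finally show "phase_start k x 0 = U (phase_begin k a 0)" by (simp add: m)
    qed
  next
    case (Suc j)
    show ?case
    proof
      assume j: "Suc j < n"
      with Suc have IH: "phase_start k x j = U (phase_begin k a j)" by simp
      obtain m where m: "phase_begin k a (Suc j) = Suc m" "starts k (chain_path k a) m" "phase_begin k a j \<le> m"
        "\<And>m'. phase_begin k a j \<le> m' \<Longrightarrow> m' < m \<Longrightarrow> \<not> starts k (chain_path k a) m'"
        using chain_path_starts[OF k, of a "Suc j"] by auto
      have less: "phase_begin k a (Suc j) < phases_end k a n"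
        using phase_begin_less_end[OF j, of k a] by simp
      have "phase_start k x (Suc j) = U (Suc m)"
        unfolding phase_start.simps IH step_path_started[OF x]
        using m less by (intro Inf_step_times U) (auto simp: starts)
      then show "phase_start k x (Suc j) = U (phase_begin k a (Suc j))" by (simp add: m)
    qed
  qed
  then show s: "i < n \<Longrightarrow> phase_start k x i = U (phase_begin k a i)" by blast
  assume i: "i < n"
  note less = phase_begin_less_end[OF i, of k a]
  show "phase_end k x i = U (phases_end k a (Suc i))"
    unfolding phase_end_def s[OF i] step_path_completed[OF x] phases_end_Suc
    using chain_path_completes[OF k, of a i] chain_path_not_completes(3)[OF k, of a i] less
    by (intro Inf_step_times U) (auto simp: completes)
qed

text \<open>Reading the index set as time shows that the chain determines the numbers of arrivals.\<close>

lemma chain_path_inject: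
  assumes k: "1 \<le> k" and a: "\<And>m. m \<le> phases_end k a n \<Longrightarrow> Z m = chain_path k a m"
    and b: "\<And>m. m \<le> phases_end k b n \<Longrightarrow> Z m = chain_path k b m" and "i < n"
  shows "a i = b i"
proof -
  have x: "step_path (\<lambda>t. Z (nat \<lfloor>t\<rfloor>)) Z real"
    unfolding step_path_def
  proof (intro conjI allI impI)
    show "\<exists>n. t < real n" for t by (rule reals_Archimedean2)
    fix n t assume "real n \<le> t" "t < real (Suc n)"
    then have "\<lfloor>t\<rfloor> = int n" by (simp add: floor_eq_iff)
    then show "Z (nat \<lfloor>t\<rfloor>) = Z n" by simp
  qed (auto simp: strict_mono_def)
  note A = step_path_phases[OF k x a \<open>i < n\<close>] and B = step_path_phases[OF k x b \<open>i < n\<close>]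
  have "phase_begin k a i = phase_begin k b i" "phases_end k a (Suc i) = phases_end k b (Suc i)"
    using A B by simp_all
  then show ?thesis by (simp add: phases_end_Suc)
qed

section \<open>Time change by the inverse of an increasing path\<close>

definition increasing_path :: "(real \<Rightarrow> real) \<Rightarrow> bool" where
  "increasing_path d \<longleftrightarrow> d 0 = 0 \<and> strict_mono_on {0..} d \<and> (\<forall>c. \<exists>s\<ge>0. c < d s)"

text \<open>For an increasing path and \<open>s > 0\<close> this is the left limit at
  \<open>s\<close>; the inserted 0 fixes the value at \<open>s = 0\<close>.\<close>

definition left_value :: "(real \<Rightarrow> real) \<Rightarrow> real \<Rightarrow> real" where
  "left_value d s = Sup (insert 0 (d ` {0..<s}))"

lemma increasing_path_less:
  assumes "increasing_path d" "0 \<le> s" "s < t"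
  shows "d s < d t"
  using assms by (auto simp: increasing_path_def strict_mono_on_def)

lemma increasing_path_nonneg:
  assumes "increasing_path d" "0 \<le> s"
  shows "0 \<le> d s"
  using assms increasing_path_less[OF assms(1), of 0 s] by (cases "s = 0") (auto simp: increasing_path_def)

lemma left_value_0 [simp]: "left_value d 0 = 0"
  by (simp add: left_value_def)

lemma left_value_bdd:
  assumes "increasing_path d" "0 \<le> s"
  shows "bdd_above (insert 0 (d ` {0..<s}))"
  using assms increasing_path_nonneg[OF assms] increasing_path_less[OF assms(1)]
  by (intro bdd_aboveI[of _ "d s"]) (auto intro: less_imp_le)

lemma left_value_le:
  assumes "increasing_path d" "0 \<le> s"
  shows "left_value d s \<le> d s"
  unfolding left_value_def
  using assms increasing_path_nonneg[OF assms] increasing_path_less[OF assms(1)]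
  by (intro cSup_least) (auto intro: less_imp_le)

lemma le_left_value:
  assumes "increasing_path d" "0 \<le> r" "r < s"
  shows "d r \<le> left_value d s"
  unfolding left_value_def using assms left_value_bdd[OF assms(1), of s] by (intro cSup_upper) auto

lemma left_value_less:
  assumes d: "increasing_path d" and "0 \<le> s" "s < t"
  shows "left_value d s < left_value d t"
proof -
  have "left_value d s \<le> d s" by (rule left_value_le[OF assms(1,2)])
  also have "d s < d ((s + t) / 2)" using assms by (intro increasing_path_less[OF d]) auto
  also have "\<dots> \<le> left_value d t" using assms by (intro le_left_value[OF d]) auto
  finally show ?thesis .
qed

lemma left_value_nonneg:
  assumes d: "increasing_path d" and "0 \<le> s"
  shows "0 \<le> left_value d s"
  unfolding left_value_def using left_value_bdd[OF assms] by (intro cSup_upper) auto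

text \<open>The infimum lies below \<open>s\<close> exactly if the path exceeds \<open>u\<close>
  somewhere before \<open>s\<close>, that is, if \<open>u\<close> lies below the supremum over those
  times. At \<open>u = 0\<close> the inverse is 0 by definition, which agrees with this because the
  path is strictly increasing.\<close>

lemma inverse_process_less_iff:
  assumes d: "increasing_path (\<lambda>s. D s \<omega>)" and "0 \<le> u" "0 \<le> s"
  shows "inverse_process D u \<omega> < s \<longleftrightarrow> u < left_value (\<lambda>s. D s \<omega>) s"
proof (cases "u = 0")
  case True
  show ?thesis
  proof (cases "s = 0")
    case False
    then have "0 < s" using \<open>0 \<le> s\<close> by simp
    then show ?thesis using left_value_less[OF d order_refl] True by (simp add: inverse_process_def)
  qed (simp add: inverse_process_def True)
next
  case False
  let ?A = "{r. 0 \<le> r \<and> u < D r \<omega>}"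
  have ne: "?A \<noteq> {}" using d by (auto simp: increasing_path_def)
  have bdd: "bdd_below ?A" by (intro bdd_belowI[of _ 0]) auto
  have "Inf ?A < s \<longleftrightarrow> (\<exists>r\<in>?A. r < s)" by (rule cInf_less_iff[OF ne bdd])
  also have "\<dots> \<longleftrightarrow> (\<exists>v\<in>insert 0 ((\<lambda>s. D s \<omega>) ` {0..<s}). u < v)"
    using \<open>0 \<le> u\<close> by auto
  also have "\<dots> \<longleftrightarrow> u < left_value (\<lambda>s. D s \<omega>) s"
    unfolding left_value_def using left_value_bdd[OF d \<open>0 \<le> s\<close>] by (intro less_cSup_iff[symmetric]) auto
  finally show ?thesis using False by (simp add: inverse_process_def)
qed

text \<open>Negating the equivalence for the inverse, it has reached the level \<open>T n\<close> at
  time \<open>t\<close> exactly if \<open>left_value\<close> at \<open>T n\<close> is at most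
  \<open>t\<close>. Holding intervals of \<open>q\<close> thus become holding intervals between
  consecutive left values, nonempty because these increase strictly.\<close>

lemma step_path_time_change:
  assumes d: "increasing_path (\<lambda>s. D s \<omega>)"
    and q: "strict_mono T" "T 0 = 0" "\<And>t. \<exists>n. t < T n"
      "\<And>n t. T n \<le> t \<Longrightarrow> t < T (Suc n) \<Longrightarrow> q t = Z n"
  shows "step_path (\<lambda>t. q (inverse_process D t \<omega>)) Z (\<lambda>n. left_value (\<lambda>s. D s \<omega>) (T n))"
proof -
  have T: "0 \<le> T n" for n using q(1,2) by (metis strict_mono_less_eq zero_le)
  have L: "strict_mono (\<lambda>n. left_value (\<lambda>s. D s \<omega>) (T n))"
    using left_value_less[OF d T] q(1) by (auto simp: strict_mono_def)
  have L0: "0 \<le> left_value (\<lambda>s. D s \<omega>) (T n)" for n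
    by (rule left_value_nonneg[OF d T])
  show ?thesis
    unfolding step_path_def
  proof (intro conjI allI impI L)
    show "\<exists>n. t < left_value (\<lambda>s. D s \<omega>) (T n)" for t
    proof -
      obtain s where s: "0 \<le> s" "t < D s \<omega>" using d by (auto simp: increasing_path_def)
      obtain n where "s < T n" using q(3) by blast
      with s show ?thesis using le_left_value[OF d s(1), of "T n"] by (intro exI[of _ n]) auto
    qed
    fix n t assume t: "left_value (\<lambda>s. D s \<omega>) (T n) \<le> t" "t < left_value (\<lambda>s. D s \<omega>) (T (Suc n))"
    then have "0 \<le> t" using L0[of n] by simp
    then show "q (inverse_process D t \<omega>) = Z n"
      using t inverse_process_less_iff[where D=D and \<omega>=\<omega>, OF d \<open>0 \<le> t\<close> T] by (intro q(4)) (auto simp flip: not_less)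
  qed (simp add: q(2))
qed

text \<open>
  The level passage times of the inverse and the jump chain are expressed by the values of the
  paths at rational times, which makes them measurable functions of the paths.
\<close>

definition first_rat :: "(rat \<Rightarrow> bool) \<Rightarrow> real" where
  "first_rat P = real_of_ereal (INF v. if 0 \<le> v \<and> P v then ereal (of_rat v) else \<infinity>)"

lemma first_rat_eq:
  assumes "0 \<le> c" and P: "\<And>v. 0 \<le> v \<Longrightarrow> P v \<longleftrightarrow> c \<le> of_rat v"
  shows "first_rat P = c"
proof -
  have "(INF v. if 0 \<le> v \<and> P v then ereal (of_rat v) else \<infinity>) = ereal c" (is "?I = _")
  proof (rule antisym)
    show "ereal c \<le> ?I" by (intro INF_greatest) (auto simp: P)
    show "?I \<le> ereal c"
    proof (rule dense_ge)
      fix y assume "ereal c < y"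
      show "?I \<le> y"
      proof (cases y)
        case (real x)
        with \<open>ereal c < y\<close> have "c < x" by simp
        then obtain v where v: "c < of_rat v" "of_rat v < x" using of_rat_dense by blast
        with \<open>0 \<le> c\<close> have "0 \<le> v" by (metis less_imp_le order.trans zero_le_of_rat_iff)
        with v P show ?thesis unfolding real by (intro INF_lower2[of v]) auto
      qed (use \<open>ereal c < y\<close> in auto)
    qed
  qed
  then show ?thesis by (simp add: first_rat_def)
qed

lemma measurable_first_rat [measurable (raw)]:
  assumes [measurable]: "\<And>v. Measurable.pred M (\<lambda>x. P x v)"
  shows "(\<lambda>x. first_rat (P x)) \<in> borel_measurable M"
  unfolding first_rat_def by measurable

definition level_time :: "(real \<Rightarrow> real) \<Rightarrow> real \<Rightarrow> real" where
  "level_time y s = first_rat (\<lambda>v. 0 \<le> v \<and> s \<le> y (of_rat v))"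

lemma level_time_inverse_process:
  assumes d: "increasing_path (\<lambda>s. D s \<omega>)" and "0 \<le> s"
    and y: "\<And>u. 0 \<le> u \<Longrightarrow> y u = inverse_process D u \<omega>"
  shows "level_time y s = left_value (\<lambda>s. D s \<omega>) s"
  unfolding level_time_def
proof (rule first_rat_eq[OF left_value_nonneg[OF d \<open>0 \<le> s\<close>]])
  fix v :: rat assume "0 \<le> v"
  then have v: "0 \<le> (of_rat v :: real)" by simp
  show "(0 \<le> v \<and> s \<le> y (of_rat v)) = (left_value (\<lambda>s. D s \<omega>) s \<le> of_rat v)"
    using inverse_process_less_iff[where D=D and \<omega>=\<omega>, OF d v \<open>0 \<le> s\<close>] \<open>0 \<le> v\<close> by (auto simp: y[OF v] simp flip: not_less)
qed

lemma measurable_eval_PiM_rat: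
  assumes "0 \<le> v"
  shows "(\<lambda>y. y (of_rat v :: real)) \<in> measurable (PiM {0..} (\<lambda>_. N)) N"
  using assms by (intro measurable_component_singleton) simp

lemma measurable_level_time [measurable (raw)]:
  assumes s [measurable]: "f \<in> borel_measurable M" and y [measurable]: "g \<in> measurable M (PiM {0..} (\<lambda>_. borel))"
  shows "(\<lambda>x. level_time (g x) (f x)) \<in> borel_measurable M"
  unfolding level_time_def
proof (rule measurable_first_rat)
  fix v :: rat
  show "Measurable.pred M (\<lambda>x. 0 \<le> v \<and> f x \<le> g x (of_rat v))"
  proof (cases "0 \<le> v")
    case True
    have [measurable]: "(\<lambda>x. g x (of_rat v)) \<in> borel_measurable M"
      using measurable_compose[OF y measurable_eval_PiM_rat[OF True]] .
    show ?thesis using True by measurable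
  qed simp
qed

text \<open>On a step path whose consecutive states differ, this says that at least \<open>n\<close>
  jumps have happened by time \<open>v\<close>. The witnesses are rational, so countably many
  coordinates of the path decide it.\<close>

primrec changes_before :: "(real \<Rightarrow> 's) \<Rightarrow> nat \<Rightarrow> rat \<Rightarrow> bool" where
  "changes_before q 0 v \<longleftrightarrow> True"
| "changes_before q (Suc n) v \<longleftrightarrow>
    (\<exists>r. 0 \<le> r \<and> r < v \<and> q (of_rat r) \<noteq> q (of_rat v) \<and> changes_before q n r)"

definition jump_time :: "(real \<Rightarrow> 's) \<Rightarrow> nat \<Rightarrow> real" where
  "jump_time q n = first_rat (\<lambda>v. 0 \<le> v \<and> changes_before q n v)"

definition jump_state :: "(real \<Rightarrow> 's) \<Rightarrow> nat \<Rightarrow> 's \<Rightarrow> bool" where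
  "jump_state q n z \<longleftrightarrow> (\<exists>v. 0 \<le> v \<and> changes_before q n v \<and> \<not> changes_before q (Suc n) v \<and> q (of_rat v) = z)"

context
  fixes q :: "real \<Rightarrow> 's" and Z :: "nat \<Rightarrow> 's" and T :: "nat \<Rightarrow> real"
  assumes T: "strict_mono T" "T 0 = 0" "\<And>t. \<exists>n. t < T n"
    and q: "\<And>n t. T n \<le> t \<Longrightarrow> t < T (Suc n) \<Longrightarrow> q t = Z n"
    and Z: "\<And>n. Z n \<noteq> Z (Suc n)"
begin

lemma changes_before_iff: "0 \<le> v \<Longrightarrow> changes_before q n v \<longleftrightarrow> T n \<le> of_rat v"
proof (induction n arbitrary: v)
  case 0
  then show ?case by (simp add: T(2))
next
  case (Suc n)
  have idx: "\<exists>m. T m \<le> of_rat r \<and> of_rat r < T (Suc m)" if "0 \<le> r" for r :: rat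
    using increasing_index_right[of T "of_rat r"] T(2,3) that by (metis zero_le_of_rat_iff)
  obtain m where m: "T m \<le> of_rat v" "of_rat v < T (Suc m)" using idx[OF Suc.prems] by blast
  show ?case
  proof
    assume "changes_before q (Suc n) v"
    then obtain r where r: "0 \<le> r" "r < v" "q (of_rat r) \<noteq> q (of_rat v)" "T n \<le> of_rat r"
      using Suc.IH by auto
    obtain l where l: "T l \<le> of_rat r" "of_rat r < T (Suc l)" using idx[OF r(1)] by blast
    have "n < Suc l" using r(4) l(2) T(1) by (meson le_less_trans strict_mono_less)
    moreover have "l < Suc m"
      using l(1) m(2) r(2) T(1) by (meson le_less_trans less_trans of_rat_less strict_mono_less)
    moreover have "l \<noteq> m" using q[OF l] q[OF m] r(3) by auto
    ultimately have "Suc n \<le> m" by simp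
    then have "T (Suc n) \<le> T m" using T(1) by (simp add: strict_mono_less_eq)
    with m(1) show "T (Suc n) \<le> of_rat v" by simp
  next
    assume "T (Suc n) \<le> of_rat v"
    then have "Suc n < Suc m" using m(2) T(1) by (meson le_less_trans strict_mono_less)
    then obtain j where j: "m = Suc j" "n \<le> j" by (cases m) auto
    \<comment> \<open>The witness is taken from the holding interval just before that of
      \<open>v\<close>: states further apart may coincide, consecutive ones differ.\<close>
    obtain r where r: "T j < of_rat r" "of_rat r < T m"
      using of_rat_dense[of "T j" "T m"] T(1) j(1) by (auto simp: strict_mono_less)
    have "T 0 \<le> T j" "T n \<le> T j" using T(1) j(2) by (auto simp: strict_mono_less_eq)
    then have r0: "0 \<le> r" "T n \<le> of_rat r" using r(1) T(2)
      by (metis less_imp_le order.trans zero_le_of_rat_iff, linarith)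
    have "r < v" using r(2) m(1) by (metis less_le_trans of_rat_less)
    moreover have "q (of_rat r) \<noteq> q (of_rat v)"
      using q[of j "of_rat r"] q[OF m] r j(1) Z[of j] by simp
    ultimately show "changes_before q (Suc n) v" using r0 Suc.IH[OF r0(1)] by auto
  qed
qed

lemma jump_time_eq: "jump_time q n = T n"
proof -
  have "T 0 \<le> T n" using T(1) by (simp add: strict_mono_less_eq)
  then show ?thesis
    unfolding jump_time_def using T(2) by (intro first_rat_eq) (auto simp: changes_before_iff)
qed

lemma jump_state_iff: "jump_state q n z \<longleftrightarrow> Z n = z"
proof -
  have "T 0 \<le> T n" "T n < T (Suc n)" using T(1) by (simp_all add: strict_mono_less_eq strict_mono_less)
  then obtain v where v: "T n < of_rat v" "of_rat v < T (Suc n)" using of_rat_dense by blast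
  then have "0 \<le> v" using \<open>T 0 \<le> T n\<close> T(2) by (metis less_imp_le order.trans zero_le_of_rat_iff)
  have eq: "q (of_rat v) = Z n" if "T n \<le> of_rat v" "of_rat v < T (Suc n)" for v :: rat
    using q that .
  show ?thesis
    unfolding jump_state_def
    using v eq \<open>0 \<le> v\<close> changes_before_iff by (metis less_imp_le not_le)
qed

end

section \<open>Measurability of jump times and jump states\<close>

lemma changes_before_cong:
  assumes "\<And>t. 0 \<le> t \<Longrightarrow> q t = q' t"
  shows "0 \<le> v \<Longrightarrow> changes_before q n v \<longleftrightarrow> changes_before q' n v"
  by (induction n arbitrary: v) (auto simp: assms)

lemma jump_time_cong:
  assumes "\<And>t. 0 \<le> t \<Longrightarrow> q t = q' t"
  shows "jump_time q n = jump_time q' n"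
  unfolding jump_time_def using changes_before_cong[OF assms] by (intro arg_cong[where f=first_rat]) auto

lemma jump_state_cong:
  assumes "\<And>t. 0 \<le> t \<Longrightarrow> q t = q' t"
  shows "jump_state q n z = jump_state q' n z"
  unfolding jump_state_def using changes_before_cong[OF assms] assms
  by (intro arg_cong[where f=Ex] ext) (auto simp del: changes_before.simps)

lemma measurable_changes_before:
  fixes v :: rat
  assumes "0 \<le> v"
  shows "Measurable.pred (PiM {0..} (\<lambda>_. count_space UNIV)) (\<lambda>q :: real \<Rightarrow> 's::countable. changes_before q n v)"
  using assms
proof (induction n arbitrary: v)
  case (Suc n)
  have "Measurable.pred (PiM {0..} (\<lambda>_. count_space UNIV))
      (\<lambda>q :: real \<Rightarrow> 's. 0 \<le> r \<and> r < v \<and> q (of_rat r) \<noteq> q (of_rat v) \<and> changes_before q n r)" for r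
  proof (cases "0 \<le> r")
    case True
    have eval: "Measurable.pred (PiM {0..} (\<lambda>_. count_space UNIV)) (\<lambda>q :: real \<Rightarrow> 's. q (of_rat u) = z)"
      if "0 \<le> u" for u z
      by (rule measurable_compose[OF measurable_eval_PiM_rat[OF that], where g="\<lambda>x. x = z"]) simp
    note [measurable] = Suc.IH[OF True] eval[OF True] eval[OF Suc.prems]
    \<comment> \<open>The state space is countable, so inequality of two coordinates becomes a
      countable union of measurable conditions on each of them.\<close>
    have "(q (of_rat r) \<noteq> q (of_rat v)) = (\<exists>z. q (of_rat r) = z \<and> \<not> q (of_rat v) = z)" for q :: "real \<Rightarrow> 's"
      by auto
    then show ?thesis by (simp only:) measurable
  qed simp
  then show ?case unfolding changes_before.simps by measurable
qed simp

lemma measurable_jump_time: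
  "(\<lambda>q :: real \<Rightarrow> 's::countable. jump_time q n) \<in> borel_measurable (PiM {0..} (\<lambda>_. count_space UNIV))"
  unfolding jump_time_def
proof (rule measurable_first_rat)
  show "Measurable.pred (PiM {0..} (\<lambda>_. count_space UNIV)) (\<lambda>q :: real \<Rightarrow> 's. 0 \<le> v \<and> changes_before q n v)" for v
    using measurable_changes_before[of v n] by (cases "0 \<le> v") auto
qed

lemma measurable_jump_state:
  "Measurable.pred (PiM {0..} (\<lambda>_. count_space UNIV)) (\<lambda>q :: real \<Rightarrow> 's::countable. jump_state q n z)"
proof -
  have "Measurable.pred (PiM {0..} (\<lambda>_. count_space UNIV))
      (\<lambda>q :: real \<Rightarrow> 's. 0 \<le> v \<and> changes_before q n v \<and> \<not> changes_before q (Suc n) v \<and> q (of_rat v) = z)" for v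
  proof (cases "0 \<le> v")
    case True
    note [measurable] = measurable_changes_before[OF True]
    have [measurable]: "Measurable.pred (PiM {0..} (\<lambda>_. count_space UNIV)) (\<lambda>q :: real \<Rightarrow> 's. q (of_rat v) = z)"
      by (rule measurable_compose[OF measurable_eval_PiM_rat[OF True], where g="\<lambda>x. x = z"]) simp
    show ?thesis by measurable
  qed simp
  then show ?thesis unfolding jump_state_def by measurable
qed

section \<open>The mixed stable subordinator\<close>

locale mixed_subordinator = prob_space M for M :: "'a measure" +
  fixes D :: "real \<Rightarrow> 'a \<Rightarrow> real" and c1 c2 \<alpha>1 \<alpha>2 :: real
  assumes subordinator: "mixed_stable_subordinator c1 c2 \<alpha>1 \<alpha>2 D"
    and c1: "0 < c1" and c2: "0 \<le> c2" and \<alpha>1: "0 < \<alpha>1"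
    and measurable_inverse: "random_variable (PiM {0..} (\<lambda>_. borel)) (\<lambda>\<omega>. \<lambda>t\<in>{0..}. inverse_process D t \<omega>)"
begin

definition psi :: "real \<Rightarrow> real" where
  "psi z = c1 * z powr \<alpha>1 + c2 * z powr \<alpha>2"

text \<open>
  Only the inverse is assumed to be independent of the queue, so \<open>D\<close> has to be recovered from it, which
  yields left limits.
\<close>

definition passage :: "real \<Rightarrow> 'a \<Rightarrow> real" where
  "passage s \<omega> = level_time (\<lambda>t\<in>{0..}. inverse_process D t \<omega>) s"

lemma measurable_passage [measurable]: "passage s \<in> borel_measurable M"
  unfolding passage_def by (rule measurable_level_time[OF _ measurable_inverse]) simp

lemma
  fixes u :: "nat \<Rightarrow> real"
  shows measurable_D: "0 \<le> t \<Longrightarrow> random_variable borel (D t)"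
  and D_0: "AE \<omega> in M. D 0 \<omega> = 0"
  and D_indep: "0 \<le> u 0 \<Longrightarrow> (\<And>i. i < n \<Longrightarrow> u i \<le> u (Suc i)) \<Longrightarrow>
      indep_vars (\<lambda>_. borel) (\<lambda>i \<omega>. D (u (Suc i)) \<omega> - D (u i) \<omega>) {..<n}"
  and D_stationary: "0 \<le> s \<Longrightarrow> 0 \<le> h \<Longrightarrow> distr M borel (\<lambda>\<omega>. D (s + h) \<omega> - D s \<omega>) = distr M borel (D h)"
  and D_mono: "AE \<omega> in M. mono_on {0..} (\<lambda>t. D t \<omega>)"
  and D_laplace: "0 \<le> t \<Longrightarrow> 0 < z \<Longrightarrow> expectation (\<lambda>\<omega>. exp (- z * D t \<omega>)) = exp (- t * psi z)"
  using subordinator unfolding mixed_stable_subordinator_def levy_process_def psi_def by auto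

section \<open>Path properties from the Laplace exponent\<close>

lemma psi_pos: "0 < z \<Longrightarrow> 0 < psi z"
  using c1 c2 by (auto simp: psi_def intro!: add_pos_nonneg)

lemma D_nonneg: "0 \<le> t \<Longrightarrow> AE \<omega> in M. 0 \<le> D t \<omega>"
  using D_0 D_mono
proof eventually_elim
  case (elim \<omega>)
  then show ?case using mono_onD[OF elim(3), of 0 t] elim(1,2) by simp
qed

lemma exp_D_integrable: "0 \<le> t \<Longrightarrow> 0 < z \<Longrightarrow> integrable M (\<lambda>\<omega>. exp (- z * D t \<omega>))"
  using D_nonneg[of t] measurable_D[of t]
  by (intro integrable_const_bound[where B=1]) (auto elim!: eventually_mono)

text \<open>The indicator of \<open>D h = 0\<close> is at most \<open>exp (- z * D h)\<close> for
  every \<open>z\<close>, so the probability is at most \<open>exp (- h * psi z)\<close>. As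
  \<open>c1 > 0\<close>, \<open>psi\<close> is unbounded and the bound tends to 0.\<close>

lemma prob_D_eq_0:
  assumes "0 < h"
  shows "prob {\<omega> \<in> space M. D h \<omega> = 0} = 0"
proof -
  have [measurable]: "random_variable borel (D h)" using assms by (intro measurable_D) simp
  have le: "prob {\<omega> \<in> space M. D h \<omega> = 0} \<le> exp (- h * psi z)" if "0 < z" for z
  proof -
    have "prob {\<omega> \<in> space M. D h \<omega> = 0} = expectation (indicator {\<omega> \<in> space M. D h \<omega> = 0})"
      by (subst Bochner_Integration.integral_indicator) (auto simp: Int_absorb1 intro!: arg_cong[where f=prob])
    also have "\<dots> \<le> expectation (\<lambda>\<omega>. exp (- z * D h \<omega>))"
      using assms that by (intro integral_mono exp_D_integrable integrable_real_indicator) (auto simp: indicator_def less_top[symmetric])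
    also have "\<dots> = exp (- h * psi z)" using assms that by (intro D_laplace) auto
    finally show ?thesis .
  qed
  have "filterlim psi at_top at_top"
  proof (rule filterlim_at_top_mono)
    show "filterlim (\<lambda>z. c1 * z powr \<alpha>1) at_top at_top"
      using c1 \<alpha>1 by (intro filterlim_tendsto_pos_mult_at_top[OF tendsto_const] real_powr_at_top)
    show "\<forall>\<^sub>F z in at_top. c1 * z powr \<alpha>1 \<le> psi z" using c2 by (simp add: psi_def)
  qed
  then have "filterlim (\<lambda>z. h * psi z) at_top at_top"
    using assms by (intro filterlim_tendsto_pos_mult_at_top[OF tendsto_const])
  then have "((\<lambda>z. exp (- (h * psi z))) \<longlongrightarrow> 0) at_top"
    by (intro filterlim_compose[OF exp_at_bot]) (simp add: filterlim_uminus_at_top)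
  then have "((\<lambda>z. exp (- h * psi z)) \<longlongrightarrow> 0) at_top" by simp
  moreover have "\<forall>\<^sub>F z in at_top. prob {\<omega> \<in> space M. D h \<omega> = 0} \<le> exp (- h * psi z)"
    using eventually_gt_at_top[of 0] by eventually_elim (rule le)
  ultimately have "prob {\<omega> \<in> space M. D h \<omega> = 0} \<le> 0"
    by (intro tendsto_lowerbound) auto
  then show ?thesis by (simp add: measure_le_0_iff)
qed

lemma D_less:
  assumes "0 \<le> s" "s < t"
  shows "AE \<omega> in M. D s \<omega> < D t \<omega>"
proof -
  have [measurable]: "random_variable borel (D s)" "random_variable borel (D t)" "random_variable borel (D (t - s))"
    using assms by (auto intro!: measurable_D)
  have "prob {\<omega> \<in> space M. D t \<omega> - D s \<omega> = 0} = measure (distr M borel (\<lambda>\<omega>. D t \<omega> - D s \<omega>)) {0}"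
    by (subst measure_distr) (auto intro!: arg_cong[where f=prob])
  also have "\<dots> = measure (distr M borel (D (t - s))) {0}"
    using D_stationary[of s "t - s"] assms by simp
  also have "\<dots> = prob {\<omega> \<in> space M. D (t - s) \<omega> = 0}"
    by (subst measure_distr) (auto intro!: arg_cong[where f=prob])
  also have "\<dots> = 0" using assms by (intro prob_D_eq_0) simp
  finally have "prob {\<omega> \<in> space M. D t \<omega> - D s \<omega> = 0} = 0" .
  then have "AE \<omega> in M. D t \<omega> - D s \<omega> \<noteq> 0"
    by (subst AE_iff_measurable[OF _ refl]) (auto simp: emeasure_eq_measure)
  then show ?thesis
    using D_mono by eventually_elim (use assms in \<open>auto simp: mono_on_def less_le\<close>)
qed

lemma D_unbounded: "AE \<omega> in M. \<forall>c. \<exists>s\<ge>0. c < D s \<omega>"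
proof -
  have *: "AE \<omega> in M. \<exists>n. real c < D (real n) \<omega>" for c :: nat
  proof -
    have [measurable]: "random_variable borel (D (real n))" for n by (intro measurable_D) simp
    \<comment> \<open>Markov's inequality for \<open>exp (- D n)\<close>; since
      \<open>psi 1 > 0\<close>, the bound decays geometrically in \<open>n\<close>.\<close>
    have le: "prob {\<omega> \<in> space M. \<forall>n. D (real n) \<omega> \<le> real c} \<le> exp (real c) * exp (- real n * psi 1)" for n
    proof -
      have "prob {\<omega> \<in> space M. \<forall>n. D (real n) \<omega> \<le> real c} \<le> prob {\<omega> \<in> space M. D (real n) \<omega> \<le> real c}"
        by (intro finite_measure_mono) auto
      also have "\<dots> = expectation (indicator {\<omega> \<in> space M. D (real n) \<omega> \<le> real c})"
        by (subst Bochner_Integration.integral_indicator) (auto simp: Int_absorb1 intro!: arg_cong[where f=prob])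
      also have "\<dots> \<le> expectation (\<lambda>\<omega>. exp (real c) * exp (- 1 * D (real n) \<omega>))"
        by (intro integral_mono integrable_mult_right exp_D_integrable integrable_real_indicator)
            (auto simp: indicator_def mult_exp_exp less_top[symmetric])
      also have "\<dots> = exp (real c) * exp (- real n * psi 1)"
        using D_laplace[of "real n" 1] by (simp only: integral_mult_right_zero zero_less_one of_nat_0_le_iff)
      finally show ?thesis .
    qed
    have "(\<lambda>n. exp (- psi 1) ^ n) \<longlonglongrightarrow> 0" using psi_pos[of 1] by (intro LIMSEQ_realpow_zero) auto
    then have "(\<lambda>n. exp (real c) * exp (- real n * psi 1)) \<longlonglongrightarrow> exp (real c) * 0"
      by (intro tendsto_mult_left) (simp add: exp_of_nat_mult[symmetric])
    then have "prob {\<omega> \<in> space M. \<forall>n. D (real n) \<omega> \<le> real c} \<le> exp (real c) * 0"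
      by (rule LIMSEQ_le_const) (use le in blast)
    then have "prob {\<omega> \<in> space M. \<forall>n. D (real n) \<omega> \<le> real c} = 0"
      by (simp add: measure_le_0_iff)
    then show ?thesis
      by (subst AE_iff_measurable[OF _ refl]) (auto simp: emeasure_eq_measure not_less)
  qed
  have "AE \<omega> in M. \<forall>c::nat. \<exists>n. real c < D (real n) \<omega>"
    using * by (simp add: AE_all_countable)
  then show ?thesis
  proof eventually_elim
    case (elim \<omega>)
    show ?case
    proof
      fix c :: real
      obtain m :: nat where "c < real m" using reals_Archimedean2 by blast
      moreover obtain n where "real m < D (real n) \<omega>" using elim by blast
      ultimately show "\<exists>s\<ge>0. c < D s \<omega>" by (intro exI[of _ "real n"]) auto
    qed
  qed
qed

text \<open>Strictness is available almost surely for countably many pairs of times at once. Two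
  rational times placed between \<open>s\<close> and \<open>t\<close>, together with monotonicity,
  carry it to all pairs.\<close>

lemma AE_increasing_path: "AE \<omega> in M. increasing_path (\<lambda>s. D s \<omega>)"
proof -
  have "AE \<omega> in M. \<forall>r s::rat. 0 \<le> r \<and> r < s \<longrightarrow> D (of_rat r) \<omega> < D (of_rat s) \<omega>"
    unfolding AE_all_countable
  proof (intro allI)
    fix r s :: rat
    show "AE \<omega> in M. 0 \<le> r \<and> r < s \<longrightarrow> D (of_rat r) \<omega> < D (of_rat s) \<omega>"
      using D_less[of "of_rat r" "of_rat s"] by (cases "0 \<le> r \<and> r < s") (auto simp: of_rat_less)
  qed
  then show ?thesis
    using D_0 D_mono D_unbounded
  proof eventually_elim
    case (elim \<omega>)
    have "D s \<omega> < D t \<omega>" if st: "0 \<le> s" "s < t" for s t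
    proof -
      obtain r where r: "s < of_rat r" "of_rat r < t" using of_rat_dense[OF st(2)] by blast
      obtain r' where r': "(of_rat r :: real) < of_rat r'" "of_rat r' < t" using of_rat_dense[OF r(2)] by blast
      have "(0::real) \<le> of_rat r" by (rule less_imp_le[OF le_less_trans[OF st(1) r(1)]])
      then have "0 \<le> r" "r < r'" using r'(1) by (auto simp: of_rat_less)
      have "D s \<omega> \<le> D (of_rat r) \<omega>" "D (of_rat r') \<omega> \<le> D t \<omega>"
        using st r r' \<open>0 \<le> r\<close> \<open>r < r'\<close> by (auto intro!: mono_onD[OF elim(3)])
      moreover have "D (of_rat r) \<omega> < D (of_rat r') \<omega>"
        using elim(1) \<open>0 \<le> r\<close> \<open>r < r'\<close> by blast
      ultimately show ?thesis by linarith
    qed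
    then show ?case
      using elim(2,4) by (auto simp: increasing_path_def strict_mono_on_def)
  qed
qed

lemma AE_passage_left_value:
  "AE \<omega> in M. increasing_path (\<lambda>s. D s \<omega>) \<and> (\<forall>s\<ge>0. passage s \<omega> = left_value (\<lambda>s. D s \<omega>) s)"
  using AE_increasing_path
proof eventually_elim
  case (elim \<omega>)
  then show ?case
    unfolding passage_def by (auto intro!: level_time_inverse_process[where D=D])
qed

text \<open>The left value is at most \<open>D s\<close> and at least \<open>D r\<close> for
  \<open>r < s\<close>. Letting \<open>r\<close> increase to \<open>s\<close> in the Laplace
  transform at 1 shows that \<open>exp (- passage s)\<close>, the larger variable, has expectation
  at most that of \<open>exp (- D s)\<close>; hence the two agree almost surely.\<close>

lemma AE_passage_eq_D:
  assumes "0 \<le> s"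
  shows "AE \<omega> in M. passage s \<omega> = D s \<omega>"
proof (cases "s = 0")
  case True
  show ?thesis
    using AE_passage_left_value D_0 by eventually_elim (auto simp: True)
next
  case False
  with assms have s: "0 < s" by simp
  note [measurable] = measurable_D[OF assms]
  have le: "AE \<omega> in M. passage s \<omega> \<le> D s \<omega>"
    using AE_passage_left_value by eventually_elim (use left_value_le assms in auto)
  have nonneg: "AE \<omega> in M. 0 \<le> passage s \<omega>"
    using AE_passage_left_value by eventually_elim (use left_value_nonneg assms in auto)
  have int: "integrable M (\<lambda>\<omega>. exp (- passage s \<omega>))"
    using nonneg by (intro integrable_const_bound[where B=1]) auto
  have int': "integrable M (\<lambda>\<omega>. exp (- D s \<omega>))"
    using exp_D_integrable[OF assms, of 1] by simp
  have ge: "expectation (\<lambda>\<omega>. exp (- passage s \<omega>)) \<le> exp (- r * psi 1)" if r: "0 \<le> r" "r < s" for r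
  proof -
    have "AE \<omega> in M. exp (- passage s \<omega>) \<le> exp (- 1 * D r \<omega>)"
      using AE_passage_left_value by eventually_elim (use le_left_value[OF _ r] assms in auto)
    then have "expectation (\<lambda>\<omega>. exp (- passage s \<omega>)) \<le> expectation (\<lambda>\<omega>. exp (- 1 * D r \<omega>))"
      using r by (intro integral_mono_AE int exp_D_integrable) auto
    also have "\<dots> = exp (- r * psi 1)" using r by (intro D_laplace) auto
    finally show ?thesis .
  qed
  have "((\<lambda>r. exp (- r * psi 1)) \<longlongrightarrow> exp (- s * psi 1)) (at_left s)"
    by (intro tendsto_intros)
  moreover have "\<forall>\<^sub>F r in at_left s. expectation (\<lambda>\<omega>. exp (- passage s \<omega>)) \<le> exp (- r * psi 1)"
    using eventually_at_left_real[OF s] by eventually_elim (use ge in auto)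
  ultimately have "expectation (\<lambda>\<omega>. exp (- passage s \<omega>)) \<le> exp (- s * psi 1)"
    by (intro tendsto_lowerbound) auto
  also have "exp (- s * psi 1) = expectation (\<lambda>\<omega>. exp (- D s \<omega>))"
    using D_laplace[OF assms, of 1] by simp
  finally have "expectation (\<lambda>\<omega>. exp (- passage s \<omega>) - exp (- D s \<omega>)) \<le> 0"
    using int int' by simp
  moreover have nn: "AE \<omega> in M. 0 \<le> exp (- passage s \<omega>) - exp (- D s \<omega>)"
    using le by eventually_elim simp
  ultimately have "expectation (\<lambda>\<omega>. exp (- passage s \<omega>) - exp (- D s \<omega>)) = 0"
    by (intro antisym integral_nonneg_AE)
  then have "AE \<omega> in M. exp (- passage s \<omega>) - exp (- D s \<omega>) = 0"
    using nn int int' by (subst (asm) integral_nonneg_eq_0_iff_AE) auto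
  then show ?thesis by eventually_elim simp
qed

lemma prob_passage_gt:
  assumes "0 \<le> s"
  shows "prob {\<omega> \<in> space M. t < passage s \<omega>} = prob {\<omega> \<in> space M. t < D s \<omega>}"
  using AE_passage_eq_D[OF assms] measurable_D[OF assms]
  by (intro finite_measure_eq_AE) (auto elim!: eventually_mono)

text \<open>Interlacing the times as lo 0, hi 0, lo 1, hi 1, ... gives one nondecreasing sequence
  \<open>u\<close>. Its even increments belong to the phases; the odd ones, over the gaps, are
  dropped from the independent family.\<close>

lemma prob_passage_increments:
  fixes lo hi t :: "nat \<Rightarrow> real"
  assumes "0 \<le> lo 0" and lo_hi: "\<And>i. lo i \<le> hi i" and hi_lo: "\<And>i. hi i \<le> lo (Suc i)"
  shows "prob {\<omega> \<in> space M. \<forall>i<n. t i < passage (hi i) \<omega> - passage (lo i) \<omega>} =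
    (\<Prod>i<n. prob {\<omega> \<in> space M. t i < passage (hi i - lo i) \<omega>})"
proof (cases "n = 0")
  case True
  then show ?thesis by (simp add: prob_space)
next
  case False
  define u where "u j = (if even j then lo (j div 2) else hi (j div 2))" for j
  have u_even: "u (2 * i) = lo i" and u_odd: "u (Suc (2 * i)) = hi i" for i
    by (auto simp: u_def)
  have u_mono: "u j \<le> u (Suc j)" for j
    using lo_hi hi_lo by (cases "even j") (auto simp: u_def elim!: evenE oddE)
  have lo0: "0 \<le> lo i" for i
  proof (induction i)
    case (Suc i)
    then show ?case using lo_hi[of i] hi_lo[of i] by simp
  qed (rule assms(1))
  have hi0: "0 \<le> hi i" for i using lo0[of i] lo_hi[of i] by simp
  have [measurable]: "random_variable borel (D (lo i))" "random_variable borel (D (hi i))"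
      "random_variable borel (D (hi i - lo i))" for i
    using lo0 hi0 lo_hi by (auto intro!: measurable_D)
  have u0: "0 \<le> u 0" using lo0 by (simp add: u_def)
  define X where "X j \<omega> = D (u (Suc j)) \<omega> - D (u j) \<omega>" for j \<omega>
  have X_even: "X (2 * i) = (\<lambda>\<omega>. D (hi i) \<omega> - D (lo i) \<omega>)" for i
    unfolding X_def u_even u_odd ..
  let ?J = "(*) 2 ` {..<n}"
  have "prob (\<Inter>j\<in>?J. X j -` {t (j div 2)<..} \<inter> space M) = (\<Prod>j\<in>?J. prob (X j -` {t (j div 2)<..} \<inter> space M))"
    using False D_indep[OF u0 u_mono, where n="2 * n"] unfolding X_def[symmetric]
    by (intro indep_varsD[where I="{..<2 * n}"]) auto
  also have "(\<Inter>j\<in>?J. X j -` {t (j div 2)<..} \<inter> space M) =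
      {\<omega> \<in> space M. \<forall>i<n. t i < D (hi i) \<omega> - D (lo i) \<omega>}"
    using False by (auto simp: X_even)
  also have "(\<Prod>j\<in>?J. prob (X j -` {t (j div 2)<..} \<inter> space M)) =
      (\<Prod>i<n. prob {\<omega> \<in> space M. t i < D (hi i) \<omega> - D (lo i) \<omega>})"
    by (subst prod.reindex) (auto simp: inj_on_def X_even intro!: prod.cong arg_cong[where f=prob])
  also have "\<dots> = (\<Prod>i<n. prob {\<omega> \<in> space M. t i < passage (hi i - lo i) \<omega>})"
  proof (intro prod.cong refl)
    fix i
    have "prob {\<omega> \<in> space M. t i < D (hi i) \<omega> - D (lo i) \<omega>} =
        measure (distr M borel (\<lambda>\<omega>. D (lo i + (hi i - lo i)) \<omega> - D (lo i) \<omega>)) {t i<..}"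
      by (subst measure_distr) (auto intro!: arg_cong[where f=prob])
    also have "\<dots> = measure (distr M borel (D (hi i - lo i))) {t i<..}"
      using lo0 lo_hi by (subst D_stationary) auto
    also have "\<dots> = prob {\<omega> \<in> space M. t i < D (hi i - lo i) \<omega>}"
      by (subst measure_distr) (auto intro!: arg_cong[where f=prob])
    finally show "prob {\<omega> \<in> space M. t i < D (hi i) \<omega> - D (lo i) \<omega>} =
        prob {\<omega> \<in> space M. t i < passage (hi i - lo i) \<omega>}"
      using lo_hi[of i] by (simp add: prob_passage_gt)
  qed
  finally have D_eq: "prob {\<omega> \<in> space M. \<forall>i<n. t i < D (hi i) \<omega> - D (lo i) \<omega>} =
      (\<Prod>i<n. prob {\<omega> \<in> space M. t i < passage (hi i - lo i) \<omega>})" .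
  have "AE \<omega> in M. \<forall>i. passage (hi i) \<omega> = D (hi i) \<omega> \<and> passage (lo i) \<omega> = D (lo i) \<omega>"
    unfolding AE_all_countable using AE_passage_eq_D lo0 hi0 by (auto intro: AE_conjI)
  then have "prob {\<omega> \<in> space M. \<forall>i<n. t i < passage (hi i) \<omega> - passage (lo i) \<omega>} =
      prob {\<omega> \<in> space M. \<forall>i<n. t i < D (hi i) \<omega> - D (lo i) \<omega>}"
    by (intro finite_measure_eq_AE) (auto elim!: eventually_mono)
  with D_eq show ?thesis by simp
qed

lemma passage_laplace:
  assumes "0 \<le> s" "0 < z"
  shows "expectation (\<lambda>\<omega>. exp (- z * passage s \<omega>)) = exp (- s * psi z)"
proof -
  have "expectation (\<lambda>\<omega>. exp (- z * passage s \<omega>)) = expectation (\<lambda>\<omega>. exp (- z * D s \<omega>))"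
    using AE_passage_eq_D[OF assms(1)] measurable_D[OF assms(1)]
    by (intro integral_cong_AE) (auto elim!: eventually_mono)
  then show ?thesis using D_laplace[OF assms] by simp
qed

end

section \<open>The jump chain of the Erlang queue\<close>

text \<open>Read as an integral over a finite product of counting measures, a sum over all tuples of
  arrival counts factorises into one sum per phase.\<close>

lemma nn_integral_count_space_PiE:
  fixes f :: "'i \<Rightarrow> nat \<Rightarrow> ennreal"
  assumes "finite I"
  shows "(\<integral>\<^sup>+a. (\<Prod>i\<in>I. f i (a i)) \<partial>count_space (PiE I (\<lambda>_. UNIV))) = (\<Prod>i\<in>I. \<Sum>m. f i m)"
proof -
  interpret product_sigma_finite "\<lambda>_::'i. count_space (UNIV :: nat set)"
    by (simp add: product_sigma_finite_def sigma_finite_measure_count_space)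
  have "(\<integral>\<^sup>+a. (\<Prod>i\<in>I. f i (a i)) \<partial>count_space (PiE I (\<lambda>_. UNIV))) =
      (\<integral>\<^sup>+a. (\<Prod>i\<in>I. f i (a i)) \<partial>PiM I (\<lambda>_. count_space UNIV))"
    using assms by (subst count_space_PiM_finite) auto
  also have "\<dots> = (\<Prod>i\<in>I. \<integral>\<^sup>+m. f i m \<partial>count_space UNIV)"
    using assms by (intro product_nn_integral_prod) auto
  finally show ?thesis by (simp add: nn_integral_count_space_nat)
qed

lemma exit_rate_erlang:
  assumes k: "1 \<le> k"
  shows "exit_rate (erlang_rate lam mu k) (0, 0) = lam"
    and "y \<in> busy_states k \<Longrightarrow> exit_rate (erlang_rate lam mu k) y = lam + real k * mu"
proof -
  have "exit_rate (erlang_rate lam mu k) (0, 0) = (\<Sum>\<^sub>\<infinity>y\<in>{(1::nat, k)}. lam)"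
    unfolding exit_rate_def by (rule infsum_cong_neutral) (auto simp: erlang_rate_def)
  then show "exit_rate (erlang_rate lam mu k) (0, 0) = lam" by simp
  assume y: "y \<in> busy_states k"
  let ?u = "(fst y + 1, snd y)" and ?v = "after_phase k y"
  \<comment> \<open>The two targets must be distinct for their rates to add up.\<close>
  have uv: "?u \<noteq> ?v" using arrival_neq_after_phase[OF y] by simp
  have "exit_rate (erlang_rate lam mu k) y = (\<Sum>\<^sub>\<infinity>z\<in>{?u, ?v}. if z = ?u then lam else real k * mu)"
    unfolding exit_rate_def using busy_nonzero[OF y] y
    by (intro infsum_cong_neutral) (auto simp: erlang_rate_def)
  also have "\<dots> = (\<Sum>z\<in>{?u, ?v}. if z = ?u then lam else real k * mu)"
    by (rule infsum_finite) simp
  also have "\<dots> = lam + real k * mu"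
    by (subst sum.insert) (use uv in auto)
  finally show "exit_rate (erlang_rate lam mu k) y = lam + real k * mu" .
qed

lemma prod_lessThan_add:
  fixes f :: "nat \<Rightarrow> 'a::comm_monoid_mult"
  shows "(\<Prod>m<N + l. f m) = (\<Prod>m<N. f m) * (\<Prod>j<l. f (N + j))"
  by (induction l) (auto simp: mult.assoc)

text \<open>The jump out of the idle state is certain and contributes 1. In every busy state an
  arrival has probability \<open>lam / l\<close> and a completion \<open>k * mu / l\<close>, so only
  the counts matter.\<close>

lemma prod_transition_probabilities:
  fixes lam mu :: real
  assumes k: "1 \<le> k" and pos: "0 < lam" "0 < mu"
  defines "q \<equiv> erlang_rate lam mu k" and "l \<equiv> lam + real k * mu"
  shows "(\<Prod>m<phases_end k a n. q (chain_path k a m) (chain_path k a (Suc m)) / exit_rate q (chain_path k a m)) =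
    (\<Prod>i<n. (lam / l) ^ a i * (real k * mu / l))"
proof (induction n)
  case (Suc n)
  let ?z = "chain_path k a"
  let ?f = "\<lambda>m. q (?z m) (?z (Suc m)) / exit_rate q (?z m)"
  have idle: "(\<Prod>m<phase_begin k a n. ?f m) = (\<Prod>m<phases_end k a n. ?f m)"
  proof (cases "?z (phases_end k a n) = (0, 0)")
    case True
    then have "?f (phases_end k a n) = 1"
      using chain_path_begin_idle[OF k True] exit_rate_erlang(1)[OF k] pos
      by (simp add: q_def erlang_rate_def)
    then show ?thesis using True by (simp add: phase_begin_def)
  qed (simp add: phase_begin_def)
  have arr: "?f (phase_begin k a n + j) = lam / l" if "j < a n" for j
  proof -
    let ?m = "phase_begin k a n + j"
    have m: "phase_begin k a n \<le> ?m" "?m < phase_begin k a n + a n" using that by auto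
    note A = chain_path_not_completes(1,2)[OF k m]
    show ?thesis
      unfolding A(2) using exit_rate_erlang(2)[OF k A(1)] busy_nonzero[OF A(1)] A(1)
      by (simp add: q_def l_def erlang_rate_def)
  qed
  have comp: "?f (phase_begin k a n + a n) = real k * mu / l"
  proof -
    let ?m = "phase_begin k a n + a n"
    have A: "?z ?m \<in> busy_states k" "?z (Suc ?m) = after_phase k (?z ?m)"
      using chain_path_completes[OF k, of a n] by (auto simp: completes_def)
    show ?thesis
      unfolding A(2) using exit_rate_erlang(2)[OF k A(1)] busy_nonzero[OF A(1)] A(1) arrival_neq_after_phase[OF A(1)]
      by (simp add: q_def l_def erlang_rate_def)
  qed
  have "(\<Prod>m<phases_end k a (Suc n). ?f m) = (\<Prod>m<phase_begin k a n. ?f m) * (\<Prod>j<a n. ?f (phase_begin k a n + j)) *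
      ?f (phase_begin k a n + a n)"
    unfolding phases_end_Suc by (simp only: prod.lessThan_Suc prod_lessThan_add)
  also have "(\<Prod>j<a n. ?f (phase_begin k a n + j)) = (lam / l) ^ a n"
  proof -
    have "(\<Prod>j<a n. ?f (phase_begin k a n + j)) = (\<Prod>j<a n. lam / l)"
      by (rule prod.cong[OF refl arr]) simp
    then show ?thesis by simp
  qed
  finally show ?case unfolding idle comp Suc.IH by simp
qed simp

text \<open>The jump chain and the holding times, which \<open>ctmc\<close> merely asserts to exist,
  are fixed here as parameters.\<close>

locale erlang_chain = prob_space M for M :: "'a measure" +
  fixes lam mu :: real and k :: nat and Q :: "real \<Rightarrow> 'a \<Rightarrow> nat \<times> nat"
    and Z :: "nat \<Rightarrow> 'a \<Rightarrow> nat \<times> nat" and S :: "nat \<Rightarrow> 'a \<Rightarrow> real"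
  assumes lam: "0 < lam" and mu: "0 < mu" and k: "1 \<le> k"
    and measurable_Z [measurable]: "\<And>n. random_variable (count_space UNIV) (Z n)"
    and measurable_S [measurable]: "\<And>n. random_variable borel (S n)"
    and law: "\<And>n z s. (\<And>i. i < n \<Longrightarrow> 0 \<le> s i) \<Longrightarrow>
      prob {\<omega> \<in> space M. (\<forall>i\<le>n. Z i \<omega> = z i) \<and> (\<forall>i<n. s i < S i \<omega>)} =
        (if z 0 = (0, 0) then
           (\<Prod>i<n. erlang_rate lam mu k (z i) (z (Suc i)) / exit_rate (erlang_rate lam mu k) (z i) *
             exp (- exit_rate (erlang_rate lam mu k) (z i) * s i))
         else 0)"
    and path: "AE \<omega> in M. \<forall>t\<ge>0. \<exists>n. (\<Sum>i<n. S i \<omega>) \<le> t \<and> t < (\<Sum>i<Suc n. S i \<omega>) \<and> Q t \<omega> = Z n \<omega>"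
begin

definition rate :: real where "rate = lam + real k * mu"

lemma rate_pos: "0 < rate"
  using lam mu k unfolding rate_def by (intro add_pos_nonneg) auto

definition jump :: "nat \<Rightarrow> 'a \<Rightarrow> real" where "jump n \<omega> = (\<Sum>i<n. S i \<omega>)"

lemma measurable_jump [measurable]: "jump n \<in> borel_measurable M"
  unfolding jump_def by measurable

definition follows :: "(nat \<Rightarrow> nat) \<Rightarrow> nat \<Rightarrow> 'a set" where
  "follows a n = {\<omega> \<in> space M. \<forall>m\<le>phases_end k a n. Z m \<omega> = chain_path k a m}"

lemma follows_sets [measurable]: "follows a n \<in> events"
  unfolding follows_def by measurable

definition weight :: "(nat \<Rightarrow> nat) \<Rightarrow> nat \<Rightarrow> real" where
  "weight a n = (\<Prod>i<n. (lam / rate) ^ a i * (real k * mu / rate))"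

lemma weight_pos: "0 < weight a n"
  unfolding weight_def using lam mu k rate_pos by (intro prod_pos) auto

lemma prob_follows_holding:
  assumes "\<And>m. m < phases_end k a n \<Longrightarrow> 0 \<le> s m"
  shows "prob {\<omega> \<in> space M. \<omega> \<in> follows a n \<and> (\<forall>m<phases_end k a n. s m < S m \<omega>)} =
    weight a n * (\<Prod>m<phases_end k a n. exp (- exit_rate (erlang_rate lam mu k) (chain_path k a m) * s m))"
proof -
  have z0: "chain_path k a 0 = (0, 0)" by (simp add: chain_path_def)
  have "{\<omega> \<in> space M. \<omega> \<in> follows a n \<and> (\<forall>m<phases_end k a n. s m < S m \<omega>)} =
      {\<omega> \<in> space M. (\<forall>m\<le>phases_end k a n. Z m \<omega> = chain_path k a m) \<and> (\<forall>m<phases_end k a n. s m < S m \<omega>)}"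
    by (auto simp: follows_def)
  then show ?thesis
    unfolding weight_def rate_def prod_transition_probabilities[OF k lam mu, symmetric] prod.distrib[symmetric]
    using law[of "phases_end k a n" s "chain_path k a", OF assms] z0 by simp
qed

lemma prob_follows_positive:
  "prob {\<omega> \<in> space M. \<omega> \<in> follows a n \<and> (\<forall>m<phases_end k a n. 0 < S m \<omega>)} = weight a n"
  using prob_follows_holding[of a n "\<lambda>_. 0"] by simp

text \<open>Extensional functions, so that two different elements differ at some
  \<open>i < n\<close> and describe incompatible paths.\<close>

abbreviation counts :: "nat \<Rightarrow> (nat \<Rightarrow> nat) set" where
  "counts n \<equiv> PiE {..<n} (\<lambda>_. UNIV)"

lemma countable_counts: "countable (counts n)"
  by (rule countable_PiE) auto

lemma disjoint_follows: "disjoint_family_on (\<lambda>a. follows a n) (counts n)"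
  unfolding disjoint_family_on_def
proof (intro ballI impI)
  fix a b assume ab: "a \<in> counts n" "b \<in> counts n" "a \<noteq> b"
  then obtain i where i: "i < n" "a i \<noteq> b i"
    using PiE_ext[OF ab(1,2)] by (metis lessThan_iff)
  show "follows a n \<inter> follows b n = {}"
  proof (rule ccontr)
    assume "follows a n \<inter> follows b n \<noteq> {}"
    then obtain \<omega> where "\<omega> \<in> follows a n" "\<omega> \<in> follows b n" by blast
    then have "a i = b i"
      using chain_path_inject[OF k _ _ i(1), of a "\<lambda>m. Z m \<omega>" b] by (auto simp: follows_def)
    with i show False by simp
  qed
qed

text \<open>The powers of \<open>rate\<close> cancel and the exponential series in
  \<open>lam * x\<close> remains. It lowers the decay rate from \<open>rate\<close> to
  \<open>rate - lam = k * mu\<close>.\<close>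

lemma geometric_mixture_erlang:
  "(\<Sum>m. ennreal ((lam / rate) ^ m * (real k * mu / rate)) * ennreal (erlang_density m rate x)) =
    ennreal (exponential_density (real k * mu) x)"
proof (cases "x < 0")
  case True
  then show ?thesis by (simp add: erlang_density_def exponential_density_def)
next
  case False
  have km: "0 < real k * mu" using k mu by simp
  have "(\<lambda>m. (real k * mu * exp (- rate * x)) * ((lam * x) ^ m / fact m)) sums
      ((real k * mu * exp (- rate * x)) * exp (lam * x))"
    using exp_converges[of "lam * x"] by (intro sums_mult) (simp add: divide_inverse mult.commute)
  moreover have "(lam / rate) ^ m * (real k * mu / rate) * erlang_density m rate x =
      (real k * mu * exp (- rate * x)) * ((lam * x) ^ m / fact m)" for m
    using False rate_pos by (simp add: erlang_density_def power_divide power_mult_distrib field_simps)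
  moreover have "(real k * mu * exp (- rate * x)) * exp (lam * x) = exponential_density (real k * mu) x"
  proof -
    have "exp (- rate * x) * exp (lam * x) = exp (- x * (real k * mu))"
      by (simp add: rate_def algebra_simps flip: exp_add)
    then show ?thesis using False by (simp add: exponential_density_def)
  qed
  ultimately have "(\<lambda>m. (lam / rate) ^ m * (real k * mu / rate) * erlang_density m rate x) sums
      exponential_density (real k * mu) x"
    by (simp only:)
  then show ?thesis
    using km lam rate_pos
    by (subst ennreal_mult[symmetric]) (auto intro!: suminf_ennreal_eq mult_nonneg_nonneg)
qed

lemma sum_geometric: "(\<Sum>m. ennreal ((lam / rate) ^ m * (real k * mu / rate))) = 1"
proof -
  have km: "0 < real k * mu" using k mu by simp
  have "norm (lam / rate) < 1" using lam km by (simp add: rate_def)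
  from sums_mult2[OF geometric_sums[OF this], of "real k * mu / rate"]
  have "(\<lambda>m. (lam / rate) ^ m * (real k * mu / rate)) sums (1 / (1 - lam / rate) * (real k * mu / rate))" .
  moreover have "1 / (1 - lam / rate) * (real k * mu / rate) = 1"
  proof -
    have "rate - lam = real k * mu" by (simp add: rate_def)
    then have eq: "1 - lam / rate = real k * mu / rate" using rate_pos by (simp add: field_simps)
    have "1 / x * x = 1" if "0 < x" for x :: real using that by simp
    then show ?thesis unfolding eq using divide_pos_pos[OF km rate_pos] .
  qed
  ultimately have sums: "(\<lambda>m. (lam / rate) ^ m * (real k * mu / rate)) sums 1" by (simp only:)
  show ?thesis using km lam rate_pos by (subst suminf_ennreal_eq[OF _ sums]) auto
qed

text \<open>The weights sum to 1 over all count vectors, so these disjoint events exhaust the space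
  up to a null set. Positivity of the holding times comes along because the thresholds are
  0.\<close>

lemma AE_follows: "AE \<omega> in M. \<forall>n. \<exists>a\<in>counts n. \<omega> \<in> follows a n \<and> (\<forall>m<phases_end k a n. 0 < S m \<omega>)"
  unfolding AE_all_countable
proof
  fix n
  let ?A = "\<lambda>a. {\<omega> \<in> space M. \<omega> \<in> follows a n \<and> (\<forall>m<phases_end k a n. 0 < S m \<omega>)}"
  have A [measurable]: "?A a \<in> events" for a by measurable
  have U [measurable]: "(\<Union>a\<in>counts n. ?A a) \<in> events"
    using countable_counts by (intro sets.countable_UN') auto
  have "emeasure M (\<Union>a\<in>counts n. ?A a) = (\<integral>\<^sup>+a. emeasure M (?A a) \<partial>count_space (counts n))"
  proof (rule emeasure_UN_countable[OF A countable_counts])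
    show "disjoint_family_on ?A (counts n)"
      using disjoint_follows[of n] by (rule disjoint_family_on_bisimulation) auto
  qed
  also have "\<dots> = (\<integral>\<^sup>+a. (\<Prod>i<n. ennreal ((lam / rate) ^ a i * (real k * mu / rate))) \<partial>count_space (counts n))"
    using lam mu rate_pos
    by (intro nn_integral_cong) (simp add: emeasure_eq_measure prob_follows_positive weight_def prod_ennreal)
  also have "\<dots> = 1"
    by (subst nn_integral_count_space_PiE) (simp, simp only: sum_geometric prod.neutral_const)
  finally have "emeasure M (\<Union>a\<in>counts n. ?A a) = 1" .
  then have "prob (\<Union>a\<in>counts n. ?A a) = 1" by (simp add: emeasure_eq_measure)
  then have "AE \<omega> in M. \<omega> \<in> (\<Union>a\<in>counts n. ?A a)"
    by (subst (asm) prob_eq_1) auto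
  then show "AE \<omega> in M. \<exists>a\<in>counts n. \<omega> \<in> follows a n \<and> (\<forall>m<phases_end k a n. 0 < S m \<omega>)"
    by (auto elim!: eventually_mono)
qed

lemma le_phases_end: "n \<le> phases_end k a n"
  by (induction n) (auto simp: phases_end.simps(2))

lemma chain_path_states: "chain_path k a m \<in> insert (0, 0) (busy_states k)"
proof -
  have "x = (0, 0) \<or> x \<in> busy_states k" if "phase_cfg k a m = (i, r, x)" for m i r x
    using that
  proof (induction m arbitrary: i r x)
    case (Suc m)
    obtain i' r' x' where c: "phase_cfg k a m = (i', r', x')" by (metis prod_cases3)
    have "(1, k) \<in> busy_states k" using k by (simp add: busy_states_def)
    moreover have "(fst x' + 1, snd x') \<in> busy_states k" if "x' \<in> busy_states k"
      using that by (auto simp: busy_states_def)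
    ultimately show ?case
      using Suc.IH[OF c] Suc.prems c after_phase_states[of x' k] by (auto split: if_splits simp del: after_phase.simps)
  qed simp
  then show ?thesis
    unfolding chain_path_def by (metis insert_iff prod.collapse)
qed

lemma chain_path_Suc_neq: "chain_path k a m \<noteq> chain_path k a (Suc m)"
proof -
  obtain i r x where c: "phase_cfg k a m = (i, r, x)" by (metis prod_cases3)
  then show ?thesis
    using chain_path_states[of a m] after_phase_neq[of x k] k
    by (cases x) (auto simp: chain_path_def simp del: after_phase.simps)
qed

lemma AE_jump_structure:
  "AE \<omega> in M. strict_mono (\<lambda>n. jump n \<omega>) \<and> (\<forall>t. \<exists>n. t < jump n \<omega>) \<and>
    (\<forall>n t. jump n \<omega> \<le> t \<longrightarrow> t < jump (Suc n) \<omega> \<longrightarrow> Q t \<omega> = Z n \<omega>) \<and> (\<forall>n. Z n \<omega> \<noteq> Z (Suc n) \<omega>)"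
  using AE_follows path
proof eventually_elim
  case (elim \<omega>)
  \<comment> \<open>Every phase uses at least one jump, so any index \<open>m\<close> lies within
    the first \<open>Suc m\<close> phases.\<close>
  have pos: "0 < S m \<omega>" and neq: "Z m \<omega> \<noteq> Z (Suc m) \<omega>" for m
  proof -
    obtain a where a: "\<omega> \<in> follows a (Suc m)" "\<And>i. i < phases_end k a (Suc m) \<Longrightarrow> 0 < S i \<omega>"
      using elim(1) by blast
    have m: "m < phases_end k a (Suc m)" using le_phases_end[of "Suc m" a] by simp
    show "0 < S m \<omega>" by (rule a(2)[OF m])
    show "Z m \<omega> \<noteq> Z (Suc m) \<omega>"
      using a(1) m chain_path_Suc_neq[of a m] by (auto simp: follows_def)
  qed
  have mono: "strict_mono (\<lambda>n. jump n \<omega>)"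
    by (auto simp: strict_mono_Suc_iff jump_def pos)
  have j0: "0 \<le> jump n \<omega>" for n
    unfolding jump_def by (intro sum_nonneg less_imp_le pos)
  have unb: "\<exists>n. t < jump n \<omega>" for t
  proof (cases "0 \<le> t")
    case True
    then show ?thesis using elim(2) unfolding jump_def by blast
  next
    case False
    then show ?thesis using j0[of 0] by (intro exI[of _ 0]) simp
  qed
  have "Q t \<omega> = Z n \<omega>" if t: "jump n \<omega> \<le> t" "t < jump (Suc n) \<omega>" for n t
  proof -
    have "0 \<le> t" using j0[of n] t by simp
    then obtain n' where n': "jump n' \<omega> \<le> t" "t < jump (Suc n') \<omega>" "Q t \<omega> = Z n' \<omega>"
      using elim(2) unfolding jump_def by blast
    \<comment> \<open>The path property gives some index whose interval contains \<open>t\<close>;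
      strict monotonicity of the jump times makes it the index \<open>n\<close>.\<close>
    have "n < Suc n'" "n' < Suc n"
      using t n' strict_mono_less[OF mono] by (meson le_less_trans)+
    then have "n' = n" by linarith
    with n' show ?thesis by simp
  qed
  with mono unb neq show ?case by blast
qed

end

section \<open>Inter-phase times\<close>

text \<open>Meant for events of inter-phase times: these agree almost surely with measurable events,
  while their definition through infima and left limits gives no direct measurability.\<close>

lemma AE_eq_imp_sets_completion:
  assumes B [measurable]: "B \<in> sets (completion M)" and A: "A \<subseteq> space M"
    and eq: "AE x in M. x \<in> A \<longleftrightarrow> x \<in> B"
  shows "A \<in> sets (completion M)" and "emeasure (completion M) A = emeasure (completion M) B"
proof -
  have [measurable]: "Measurable.pred (completion M) (\<lambda>x. (x \<in> A) \<noteq> (x \<in> B))"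
    using eq by (intro sets_completion_AE) auto
  have "A = {x \<in> space (completion M). (x \<in> B) \<noteq> ((x \<in> A) \<noteq> (x \<in> B))}"
    using A by auto
  also have "\<dots> \<in> sets (completion M)" by measurable
  finally show A': "A \<in> sets (completion M)" .
  show "emeasure (completion M) A = emeasure (completion M) B"
    using AE_completion[OF eq] A' B by (intro emeasure_eq_AE) auto
qed

text \<open>Independence makes the joint law a product measure. Both integrals are carried back to
  \<open>M\<close>, so that the queue path can be frozen while the subordinator is averaged.\<close>

lemma (in prob_space) nn_integral_indep_iterated:
  assumes X [measurable]: "random_variable S X" and Y [measurable]: "random_variable T Y"
    and ind: "indep_set {X -` A \<inter> space M | A. A \<in> sets S} {Y -` B \<inter> space M | B. B \<in> sets T}"
    and f [measurable]: "f \<in> borel_measurable (S \<Otimes>\<^sub>M T)"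
  shows "(\<integral>\<^sup>+\<omega>. f (X \<omega>, Y \<omega>) \<partial>M) = (\<integral>\<^sup>+\<omega>. (\<integral>\<^sup>+\<omega>'. f (X \<omega>, Y \<omega>') \<partial>M) \<partial>M)"
proof -
  interpret X: prob_space "distr M S X" by (rule prob_space_distr) simp
  interpret Y: prob_space "distr M T Y" by (rule prob_space_distr) simp
  have pair: "distr M S X \<Otimes>\<^sub>M distr M T Y = distr M (S \<Otimes>\<^sub>M T) (\<lambda>\<omega>. (X \<omega>, Y \<omega>))"
  proof (rule pair_measure_eqI)
    fix A B assume A: "A \<in> sets (distr M S X)" and B: "B \<in> sets (distr M T Y)"
    then have [measurable]: "A \<in> sets S" "B \<in> sets T" by simp_all
    have "emeasure (distr M (S \<Otimes>\<^sub>M T) (\<lambda>\<omega>. (X \<omega>, Y \<omega>))) (A \<times> B) =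
        emeasure M ((X -` A \<inter> space M) \<inter> (Y -` B \<inter> space M))"
      by (subst emeasure_distr) (auto intro!: arg_cong[where f="emeasure M"])
    also have "emeasure M ((X -` A \<inter> space M) \<inter> (Y -` B \<inter> space M)) =
        emeasure M (X -` A \<inter> space M) * emeasure M (Y -` B \<inter> space M)"
    proof -
    have "prob ((X -` A \<inter> space M) \<inter> (Y -` B \<inter> space M)) = prob (X -` A \<inter> space M) * prob (Y -` B \<inter> space M)"
      by (rule indep_setD[OF ind]) (use A B in auto)
    then show ?thesis by (simp add: emeasure_eq_measure ennreal_mult)
    qed
    also have "\<dots> = emeasure (distr M S X) A * emeasure (distr M T Y) B"
      by (simp add: emeasure_distr)
    finally show "emeasure (distr M S X) A * emeasure (distr M T Y) B =
        emeasure (distr M (S \<Otimes>\<^sub>M T) (\<lambda>\<omega>. (X \<omega>, Y \<omega>))) (A \<times> B)" ..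
  qed (auto intro: X.sigma_finite_measure_axioms Y.sigma_finite_measure_axioms)
  have "(\<integral>\<^sup>+\<omega>. f (X \<omega>, Y \<omega>) \<partial>M) = (\<integral>\<^sup>+p. f p \<partial>distr M (S \<Otimes>\<^sub>M T) (\<lambda>\<omega>. (X \<omega>, Y \<omega>)))"
    by (subst nn_integral_distr) auto
  also have "\<dots> = (\<integral>\<^sup>+x. (\<integral>\<^sup>+y. f (x, y) \<partial>distr M T Y) \<partial>distr M S X)"
    unfolding pair[symmetric] by (subst Y.nn_integral_fst[symmetric]) auto
  also have "\<dots> = (\<integral>\<^sup>+\<omega>. (\<integral>\<^sup>+y. f (X \<omega>, y) \<partial>distr M T Y) \<partial>M)"
    by (subst nn_integral_distr) auto
  also have "\<dots> = (\<integral>\<^sup>+\<omega>. (\<integral>\<^sup>+\<omega>'. f (X \<omega>, Y \<omega>') \<partial>M) \<partial>M)"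
  proof (rule nn_integral_cong)
    fix \<omega> assume "\<omega> \<in> space M"
    then have "X \<omega> \<in> space S" using X by (rule measurable_space[rotated])
    then have "(\<lambda>y. f (X \<omega>, y)) \<in> borel_measurable T" by measurable
    then show "(\<integral>\<^sup>+y. f (X \<omega>, y) \<partial>distr M T Y) = (\<integral>\<^sup>+\<omega>'. f (X \<omega>, Y \<omega>') \<partial>M)"
      by (intro nn_integral_distr) auto
  qed
  finally show ?thesis .
qed

locale time_changed_erlang = erlang_chain M lam mu k Q Z S + mixed_subordinator M D c1 c2 \<alpha>1 \<alpha>2
  for M :: "'a measure" and lam mu k Q Z S D c1 c2 \<alpha>1 \<alpha>2 +
  assumes measurable_queue: "(\<lambda>\<omega>. \<lambda>t\<in>{0..}. Q t \<omega>) \<in> measurable M (PiM {0..} (\<lambda>_. count_space UNIV))"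
    and indep: "indep_set
      {(\<lambda>\<omega>. \<lambda>t\<in>{0..}. Q t \<omega>) -` A \<inter> space M | A. A \<in> sets (PiM {0..} (\<lambda>_. count_space UNIV))}
      {(\<lambda>\<omega>. \<lambda>t\<in>{0..}. inverse_process D t \<omega>) -` B \<inter> space M | B. B \<in> sets (PiM {0..} (\<lambda>_. borel))}"
begin

abbreviation queue_path :: "'a \<Rightarrow> real \<Rightarrow> nat \<times> nat" where
  "queue_path \<omega> \<equiv> \<lambda>t\<in>{0..}. Q t \<omega>"

abbreviation inverse_path :: "'a \<Rightarrow> real \<Rightarrow> real" where
  "inverse_path \<omega> \<equiv> \<lambda>t\<in>{0..}. inverse_process D t \<omega>"

definition phase_time :: "nat \<Rightarrow> 'a \<Rightarrow> real" where
  "phase_time j \<omega> = inter_phase_time k (\<lambda>t. time_change Q (inverse_process D) t \<omega>) j"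

definition span :: "(nat \<Rightarrow> nat) \<Rightarrow> nat \<Rightarrow> 'a \<Rightarrow> real" where
  "span a i \<omega> = passage (jump (phases_end k a (Suc i)) \<omega>) \<omega> - passage (jump (phase_begin k a i) \<omega>) \<omega>"

text \<open>Joint measurability in level and outcome allows passage times to be evaluated at random
  levels.\<close>

lemma measurable_passage_joint [measurable]:
  "(\<lambda>p. passage (fst p) (snd p)) \<in> borel_measurable (borel \<Otimes>\<^sub>M M)"
  unfolding passage_def
  using measurable_compose[OF measurable_snd measurable_inverse] by (intro measurable_level_time) auto

lemma measurable_passage_compose [measurable (raw)]:
  assumes [measurable]: "f \<in> borel_measurable N" "g \<in> measurable N M"
  shows "(\<lambda>x. passage (f x) (g x)) \<in> borel_measurable N"
  using measurable_compose[OF _ measurable_passage_joint, of "\<lambda>x. (f x, g x)" N] by simp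

lemma measurable_span [measurable]: "span a i \<in> borel_measurable M"
  unfolding span_def by measurable

lemma AE_phase_time: "AE \<omega> in M. \<forall>n a. \<omega> \<in> follows a n \<longrightarrow> (\<forall>i<n. phase_time i \<omega> = span a i \<omega>)"
  using AE_jump_structure AE_passage_left_value
proof eventually_elim
  case (elim \<omega>)
  have j: "strict_mono (\<lambda>n. jump n \<omega>)" "jump 0 \<omega> = 0" "\<And>t. \<exists>n. t < jump n \<omega>"
    "\<And>n t. jump n \<omega> \<le> t \<Longrightarrow> t < jump (Suc n) \<omega> \<Longrightarrow> Q t \<omega> = Z n \<omega>"
    using elim(1) by (auto simp: jump_def)
  have j0: "0 \<le> jump n \<omega>" for n using strict_mono_less_eq[OF j(1), of 0 n] j(2) by simp
  have d: "increasing_path (\<lambda>s. D s \<omega>)" and p: "\<And>s. 0 \<le> s \<Longrightarrow> passage s \<omega> = left_value (\<lambda>s. D s \<omega>) s"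
    using elim(2) by auto
  have x: "step_path (\<lambda>t. time_change Q (inverse_process D) t \<omega>) (\<lambda>n. Z n \<omega>) (\<lambda>n. left_value (\<lambda>s. D s \<omega>) (jump n \<omega>))"
    unfolding time_change_def
    by (rule step_path_time_change[where D=D and q="\<lambda>t. Q t \<omega>", OF d j])
  show ?case
  proof (intro allI impI)
    fix n a i assume a: "\<omega> \<in> follows a n" and i: "i < n"
    have Z: "Z m \<omega> = chain_path k a m" if "m \<le> phases_end k a n" for m
      using a that by (simp add: follows_def)
    let ?x = "\<lambda>t. time_change Q (inverse_process D) t \<omega>"
    have "phase_start k ?x i = left_value (\<lambda>s. D s \<omega>) (jump (phase_begin k a i) \<omega>)"
      by (rule step_path_phases(1)[OF k x _ i]) (rule Z)
    moreover have "phase_end k ?x i = left_value (\<lambda>s. D s \<omega>) (jump (phases_end k a (Suc i)) \<omega>)"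
      by (rule step_path_phases(2)[OF k x _ i]) (rule Z)
    ultimately show "phase_time i \<omega> = span a i \<omega>"
      by (simp add: phase_time_def inter_phase_time_def span_def p[OF j0])
  qed
qed

text \<open>The independence hypothesis concerns the paths of \<open>Q\<close> and not
  \<open>Z\<close> and \<open>S\<close>; this identification transfers it to the jump times and the
  jump chain.\<close>

lemma AE_queue_functionals:
  "AE \<omega> in M. \<forall>n. jump_time (queue_path \<omega>) n = jump n \<omega> \<and> (\<forall>z. jump_state (queue_path \<omega>) n z \<longleftrightarrow> Z n \<omega> = z)"
  using AE_jump_structure
proof eventually_elim
  case (elim \<omega>)
  have j: "strict_mono (\<lambda>n. jump n \<omega>)" "jump 0 \<omega> = 0" "\<And>t. \<exists>n. t < jump n \<omega>"
    "\<And>n t. jump n \<omega> \<le> t \<Longrightarrow> t < jump (Suc n) \<omega> \<Longrightarrow> Q t \<omega> = Z n \<omega>" "\<And>n. Z n \<omega> \<noteq> Z (Suc n) \<omega>"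
    using elim by (auto simp: jump_def)
  have "jump_time (queue_path \<omega>) n = jump_time (\<lambda>t. Q t \<omega>) n"
    "jump_state (queue_path \<omega>) n z = jump_state (\<lambda>t. Q t \<omega>) n z" for n z
    by (auto intro!: jump_time_cong jump_state_cong)
  then show ?case
    using jump_time_eq[where T="\<lambda>n. jump n \<omega>" and Z="\<lambda>n. Z n \<omega>" and q="\<lambda>t. Q t \<omega>", OF j]
      jump_state_iff[where T="\<lambda>n. jump n \<omega>" and Z="\<lambda>n. Z n \<omega>" and q="\<lambda>t. Q t \<omega>", OF j] by simp
qed

definition passage_tail :: "real \<Rightarrow> real \<Rightarrow> ennreal" where
  "passage_tail t x = (\<integral>\<^sup>+\<omega>. indicator {t<..} (passage x \<omega>) \<partial>M)"

lemma measurable_passage_tail [measurable]: "passage_tail t \<in> borel_measurable borel"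
  unfolding passage_tail_def by measurable

lemma passage_tail_eq: "passage_tail t x = ennreal (prob {\<omega> \<in> space M. t < passage x \<omega>})"
proof -
  have "passage_tail t x = (\<integral>\<^sup>+\<omega>. indicator {\<omega> \<in> space M. t < passage x \<omega>} \<omega> \<partial>M)"
    unfolding passage_tail_def by (intro nn_integral_cong) (auto simp: indicator_def)
  then show ?thesis by (simp add: emeasure_eq_measure)
qed

text \<open>With the queue frozen, the increments of the subordinator over the phases are
  independent and their laws depend on the durations only. Averaging over the queue then leaves
  independent Erlang durations, phase \<open>i\<close> having \<open>a i + 1\<close> exponential
  stages.\<close>

lemma emeasure_follows_span:
  "emeasure M {\<omega> \<in> space M. \<omega> \<in> follows a n \<and> (\<forall>i<n. t i < span a i \<omega>)} =
    ennreal (weight a n) * (\<Prod>i<n. \<integral>\<^sup>+x. ennreal (erlang_density (a i) rate x) * passage_tail (t i) x \<partial>lborel)"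
proof -
  let ?SQ = "PiM {0..} (\<lambda>_. count_space UNIV) :: (real \<Rightarrow> nat \<times> nat) measure"
  let ?SY = "PiM {0..} (\<lambda>_. borel) :: (real \<Rightarrow> real) measure"
  let ?N = "phases_end k a n"
  \<comment> \<open>The event as a set of pairs of paths, the form in which the independence of the
    two processes can be applied.\<close>
  define G where "G = {p \<in> space (?SQ \<Otimes>\<^sub>M ?SY). (\<forall>m\<le>?N. jump_state (fst p) m (chain_path k a m)) \<and>
    (\<forall>i<n. t i < level_time (snd p) (jump_time (fst p) (phases_end k a (Suc i))) -
      level_time (snd p) (jump_time (fst p) (phase_begin k a i)))}"
  have [measurable]: "(\<lambda>p. jump_time (fst p) m) \<in> borel_measurable (?SQ \<Otimes>\<^sub>M ?SY)"
    "Measurable.pred (?SQ \<Otimes>\<^sub>M ?SY) (\<lambda>p. jump_state (fst p) m z)" for m z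
    by (rule measurable_compose[OF measurable_fst measurable_jump_time]
        measurable_compose[OF measurable_fst measurable_jump_state])+
  have [measurable]: "G \<in> sets (?SQ \<Otimes>\<^sub>M ?SY)" unfolding G_def by measurable
  have inG: "(queue_path \<omega>, inverse_path \<omega>') \<in> G \<longleftrightarrow>
      (\<forall>m\<le>?N. jump_state (queue_path \<omega>) m (chain_path k a m)) \<and>
      (\<forall>i<n. t i < passage (jump_time (queue_path \<omega>) (phases_end k a (Suc i))) \<omega>' -
        passage (jump_time (queue_path \<omega>) (phase_begin k a i)) \<omega>')"
    if "\<omega> \<in> space M" "\<omega>' \<in> space M" for \<omega> \<omega>'
    using measurable_space[OF measurable_queue that(1)] measurable_space[OF measurable_inverse that(2)]
    by (simp add: G_def space_pair_measure passage_def)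
  have blocks: "jump (phases_end k a (Suc i)) \<omega> - jump (phase_begin k a i) \<omega> =
      (\<Sum>m\<in>{phase_begin k a i..<phases_end k a (Suc i)}. S m \<omega>)" for i \<omega>
  proof -
    have "{..<phases_end k a (Suc i)} = {..<phase_begin k a i} \<union> {phase_begin k a i..<phases_end k a (Suc i)}"
      by (auto simp: phases_end_Suc)
    then have "jump (phases_end k a (Suc i)) \<omega> = jump (phase_begin k a i) \<omega> +
        (\<Sum>m\<in>{phase_begin k a i..<phases_end k a (Suc i)}. S m \<omega>)"
      unfolding jump_def by (simp add: sum.union_disjoint ivl_disj_int)
    then show ?thesis by simp
  qed
  have begin_end: "phase_begin k a i < phases_end k a (Suc i)" "phases_end k a i \<le> phase_begin k a i" for i
    by (simp add: phases_end_Suc, simp add: phase_begin_def)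
  define E' where "E' = {\<omega> \<in> space M. \<omega> \<in> follows a n \<and> (\<forall>m<?N. 0 < S m \<omega>)}"
  have "emeasure M {\<omega> \<in> space M. \<omega> \<in> follows a n \<and> (\<forall>i<n. t i < span a i \<omega>)} =
      (\<integral>\<^sup>+\<omega>. indicator {\<omega> \<in> space M. \<omega> \<in> follows a n \<and> (\<forall>i<n. t i < span a i \<omega>)} \<omega> \<partial>M)"
    by simp
  also have "\<dots> = (\<integral>\<^sup>+\<omega>. indicator G (queue_path \<omega>, inverse_path \<omega>) \<partial>M)"
  proof (rule nn_integral_cong_AE)
    show "AE \<omega> in M. indicator {\<omega> \<in> space M. \<omega> \<in> follows a n \<and> (\<forall>i<n. t i < span a i \<omega>)} \<omega> =
        (indicator G (queue_path \<omega>, inverse_path \<omega>) :: ennreal)"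
      using AE_queue_functionals AE_space
    proof eventually_elim
      case (elim \<omega>)
      have js: "jump_state (queue_path \<omega>) m (chain_path k a m) \<longleftrightarrow> Z m \<omega> = chain_path k a m"
        and jt: "jump_time (queue_path \<omega>) m = jump m \<omega>" for m
        using elim(1) by blast+
      show ?case
        using elim(2) by (simp add: indicator_def follows_def span_def inG js jt)
    qed
  qed
  also have "\<dots> = (\<integral>\<^sup>+\<omega>. (\<integral>\<^sup>+\<omega>'. indicator G (queue_path \<omega>, inverse_path \<omega>') \<partial>M) \<partial>M)"
    by (rule nn_integral_indep_iterated[OF measurable_queue measurable_inverse indep]) measurable
  also have "\<dots> = (\<integral>\<^sup>+\<omega>. (\<Prod>i\<in>{..<n}. passage_tail (t i) (\<Sum>m\<in>{phase_begin k a i..<phases_end k a (Suc i)}. S m \<omega>)) *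
      indicator E' \<omega> \<partial>M)"
  proof (rule nn_integral_cong_AE)
    show "AE \<omega> in M. (\<integral>\<^sup>+\<omega>'. indicator G (queue_path \<omega>, inverse_path \<omega>') \<partial>M) =
      (\<Prod>i\<in>{..<n}. passage_tail (t i) (\<Sum>m\<in>{phase_begin k a i..<phases_end k a (Suc i)}. S m \<omega>)) * indicator E' \<omega>"
      using AE_queue_functionals AE_jump_structure AE_space
    proof eventually_elim
      case (elim \<omega>)
      have js: "jump_state (queue_path \<omega>) m (chain_path k a m) \<longleftrightarrow> Z m \<omega> = chain_path k a m"
        and jt: "jump_time (queue_path \<omega>) m = jump m \<omega>" for m
        using elim(1) by blast+
      have mono: "strict_mono (\<lambda>n. jump n \<omega>)" using elim(2) by simp
      \<comment> \<open>Holding times are almost surely positive, so adding positivity to the event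
        is harmless and gives it the shape required by the integral over exponential blocks.\<close>
      have E': "\<omega> \<in> E' \<longleftrightarrow> \<omega> \<in> follows a n"
        using mono elim(3) by (auto simp: E'_def jump_def strict_mono_Suc_iff)
      let ?lo = "\<lambda>i. jump (phase_begin k a i) \<omega>" and ?hi = "\<lambda>i. jump (phases_end k a (Suc i)) \<omega>"
      have "(\<integral>\<^sup>+\<omega>'. indicator G (queue_path \<omega>, inverse_path \<omega>') \<partial>M) =
          (\<integral>\<^sup>+\<omega>'. indicator E' \<omega> * indicator {\<omega>' \<in> space M. \<forall>i<n. t i < passage (?hi i) \<omega>' - passage (?lo i) \<omega>'} \<omega>' \<partial>M)"
        using elim(3) unfolding indicator_def E'
        by (intro nn_integral_cong) (simp add: inG js jt follows_def)
      also have "\<dots> = indicator E' \<omega> * ennreal (prob {\<omega>' \<in> space M. \<forall>i<n. t i < passage (?hi i) \<omega>' - passage (?lo i) \<omega>'})"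
        by (subst nn_integral_cmult) (auto simp: emeasure_eq_measure)
      also have "prob {\<omega>' \<in> space M. \<forall>i<n. t i < passage (?hi i) \<omega>' - passage (?lo i) \<omega>'} =
          (\<Prod>i<n. prob {\<omega>' \<in> space M. t i < passage (?hi i - ?lo i) \<omega>'})"
      proof (rule prob_passage_increments)
        show "0 \<le> ?lo 0" using strict_mono_less_eq[OF mono, of 0] by (simp add: jump_def)
      qed (use begin_end in \<open>auto simp: strict_mono_less_eq[OF mono] intro: less_imp_le\<close>)
      also have "ennreal \<dots> = (\<Prod>i<n. passage_tail (t i) (\<Sum>m\<in>{phase_begin k a i..<phases_end k a (Suc i)}. S m \<omega>))"
        by (simp only: passage_tail_eq blocks prod_ennreal[OF measure_nonneg])
      finally show ?case by (rule trans[OF _ mult.commute])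
    qed
  qed
  also have "\<dots> = ennreal (weight a n) * (\<Prod>i\<in>{..<n}. \<integral>\<^sup>+x. ennreal (erlang_density (a i) rate x) * passage_tail (t i) x \<partial>lborel)"
    unfolding E'_def
  proof (rule nn_integral_exponential_blocks[where r="\<lambda>m. exit_rate (erlang_rate lam mu k) (chain_path k a m)"])
    show "0 < exit_rate (erlang_rate lam mu k) (chain_path k a m)" for m
      using chain_path_states[of a m] exit_rate_erlang(1)[OF k, of lam mu]
        exit_rate_erlang(2)[OF k, of "chain_path k a m" lam mu] lam rate_pos by (auto simp: rate_def)
    show "prob {\<omega> \<in> space M. \<omega> \<in> follows a n \<and> (\<forall>m<?N. s m < S m \<omega>)} =
      weight a n * (\<Prod>m<?N. exp (- exit_rate (erlang_rate lam mu k) (chain_path k a m) * s m))"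
      if "\<And>m. m < ?N \<Longrightarrow> 0 \<le> s m" for s
      using that by (rule prob_follows_holding)
    show "{phase_begin k a i..<phases_end k a (Suc i)} \<subseteq> {..<?N}" if "i \<in> {..<n}" for i
      using phases_end_le_mono[of "Suc i" n k a] that by auto
    show "disjoint_family_on (\<lambda>i. {phase_begin k a i..<phases_end k a (Suc i)}) {..<n}"
    proof -
      have "phases_end k a (Suc i) \<le> phase_begin k a j" if "i < j" for i j
        using phases_end_le_mono[of "Suc i" j k a] begin_end(2)[of j] that by simp
      then show ?thesis by (force simp: disjoint_family_on_def neq_iff)
    qed
    show "exit_rate (erlang_rate lam mu k) (chain_path k a m) = rate"
      if "m \<in> {phase_begin k a i..<phases_end k a (Suc i)}" for i m
    proof -
      have "chain_path k a m \<in> busy_states k"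
        using that chain_path_not_completes(1)[OF k, of a i m] chain_path_completes[OF k, of a i]
        by (cases "m = phase_begin k a i + a i") (auto simp: phases_end_Suc completes_def)
      then show ?thesis using exit_rate_erlang(2)[OF k] by (simp add: rate_def)
    qed
  qed (auto simp: rate_pos weight_pos phases_end_Suc)
  finally show ?thesis .
qed

end

section \<open>Joint and common law of the inter-phase times\<close>

context time_changed_erlang
begin

definition phase_tail :: "real \<Rightarrow> ennreal" where
  "phase_tail t = (\<integral>\<^sup>+x. ennreal (exponential_density (real k * mu) x) * passage_tail t x \<partial>lborel)"

lemma sum_phase_tail:
  "(\<Sum>m. ennreal ((lam / rate) ^ m * (real k * mu / rate)) *
      (\<integral>\<^sup>+x. ennreal (erlang_density m rate x) * passage_tail t x \<partial>lborel)) = phase_tail t"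
proof -
  have "(\<Sum>m. ennreal ((lam / rate) ^ m * (real k * mu / rate)) *
      (\<integral>\<^sup>+x. ennreal (erlang_density m rate x) * passage_tail t x \<partial>lborel)) =
    (\<Sum>m. \<integral>\<^sup>+x. ennreal ((lam / rate) ^ m * (real k * mu / rate)) * ennreal (erlang_density m rate x) * passage_tail t x \<partial>lborel)"
    by (simp add: nn_integral_cmult mult.assoc)
  also have "\<dots> = (\<integral>\<^sup>+x. (\<Sum>m. ennreal ((lam / rate) ^ m * (real k * mu / rate)) * ennreal (erlang_density m rate x) * passage_tail t x) \<partial>lborel)"
    by (rule nn_integral_suminf[symmetric]) measurable
  also have "\<dots> = phase_tail t"
    unfolding phase_tail_def by (simp only: ennreal_suminf_multc geometric_mixture_erlang)
  finally show ?thesis .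
qed

text \<open>Summing over the disjoint events for all count vectors turns a sum of products into a
  product of sums. Each factor averages the Erlang laws geometrically, so the joint tail splits into
  one factor per phase.\<close>

lemma emeasure_phase_times:
  "{\<omega> \<in> space M. \<forall>i<n. t i < phase_time i \<omega>} \<in> sets (completion M)"
  "emeasure (completion M) {\<omega> \<in> space M. \<forall>i<n. t i < phase_time i \<omega>} = (\<Prod>i<n. phase_tail (t i))"
proof -
  let ?B = "\<lambda>a. {\<omega> \<in> space M. \<omega> \<in> follows a n \<and> (\<forall>i<n. t i < span a i \<omega>)}"
  have B [measurable]: "?B a \<in> events" for a by measurable
  have U [measurable]: "(\<Union>a\<in>counts n. ?B a) \<in> events"
    using countable_counts by (intro sets.countable_UN') auto
  have AE: "AE \<omega> in M. \<omega> \<in> {\<omega> \<in> space M. \<forall>i<n. t i < phase_time i \<omega>} \<longleftrightarrow> \<omega> \<in> (\<Union>a\<in>counts n. ?B a)"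
    using AE_phase_time AE_follows AE_space
  proof eventually_elim
    case (elim \<omega>)
    obtain a where a: "a \<in> counts n" "\<omega> \<in> follows a n" using elim(2) by blast
    show ?case
    proof
      assume "\<omega> \<in> {\<omega> \<in> space M. \<forall>i<n. t i < phase_time i \<omega>}"
      then have "\<omega> \<in> ?B a" using a elim(1) by auto
      with a(1) show "\<omega> \<in> (\<Union>a\<in>counts n. ?B a)" by blast
    next
      assume "\<omega> \<in> (\<Union>a\<in>counts n. ?B a)"
      then show "\<omega> \<in> {\<omega> \<in> space M. \<forall>i<n. t i < phase_time i \<omega>}" using elim(1) by auto
    qed
  qed
  show "{\<omega> \<in> space M. \<forall>i<n. t i < phase_time i \<omega>} \<in> sets (completion M)"
    by (rule AE_eq_imp_sets_completion(1)[OF sets_completionI_sets[OF U] _ AE]) auto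
  have "emeasure (completion M) {\<omega> \<in> space M. \<forall>i<n. t i < phase_time i \<omega>} = emeasure M (\<Union>a\<in>counts n. ?B a)"
    by (subst AE_eq_imp_sets_completion(2)[OF sets_completionI_sets[OF U] _ AE])
      (blast, simp only: emeasure_completion[OF sets_completionI_sets[OF U]] main_part[OF U])
  also have "\<dots> = (\<integral>\<^sup>+a. emeasure M (?B a) \<partial>count_space (counts n))"
  proof (rule emeasure_UN_countable[OF B countable_counts])
    show "disjoint_family_on ?B (counts n)"
      using disjoint_follows[of n] by (rule disjoint_family_on_bisimulation) auto
  qed
  also have "\<dots> = (\<integral>\<^sup>+a. (\<Prod>i\<in>{..<n}. ennreal ((lam / rate) ^ a i * (real k * mu / rate)) *
      (\<integral>\<^sup>+x. ennreal (erlang_density (a i) rate x) * passage_tail (t i) x \<partial>lborel)) \<partial>count_space (counts n))"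
  proof (rule nn_integral_cong)
    fix a
    have "ennreal (weight a n) = (\<Prod>i<n. ennreal ((lam / rate) ^ a i * (real k * mu / rate)))"
      unfolding weight_def using lam mu rate_pos by (intro prod_ennreal[symmetric]) auto
    then show "emeasure M (?B a) = (\<Prod>i\<in>{..<n}. ennreal ((lam / rate) ^ a i * (real k * mu / rate)) *
      (\<integral>\<^sup>+x. ennreal (erlang_density (a i) rate x) * passage_tail (t i) x \<partial>lborel))"
      unfolding emeasure_follows_span prod.distrib by simp
  qed
  also have "\<dots> = (\<Prod>i<n. phase_tail (t i))"
    by (subst nn_integral_count_space_PiE) (simp, simp only: sum_phase_tail)
  finally show "emeasure (completion M) {\<omega> \<in> space M. \<forall>i<n. t i < phase_time i \<omega>} = (\<Prod>i<n. phase_tail (t i))" .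
qed

text \<open>The common law of the inter-phase times: the subordinator at an independent exponential time.\<close>

definition phase_law :: "real measure" where
  "phase_law = distr (density lborel (exponential_density (real k * mu)) \<Otimes>\<^sub>M M) borel (\<lambda>p. passage (fst p) (snd p))"

lemma kmu_pos: "0 < real k * mu"
  using k mu by simp

lemma nn_integral_phase_law:
  assumes [measurable]: "f \<in> borel_measurable borel"
  shows "(\<integral>\<^sup>+y. f y \<partial>phase_law) =
    (\<integral>\<^sup>+x. ennreal (exponential_density (real k * mu) x) * (\<integral>\<^sup>+\<omega>. f (passage x \<omega>) \<partial>M) \<partial>lborel)"
proof -
  let ?X = "density lborel (\<lambda>x. ennreal (exponential_density (real k * mu) x))"
  have [measurable]: "(\<lambda>p. passage (fst p) (snd p)) \<in> borel_measurable (?X \<Otimes>\<^sub>M M)" by measurable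
  have "(\<integral>\<^sup>+y. f y \<partial>phase_law) = (\<integral>\<^sup>+p. f (passage (fst p) (snd p)) \<partial>(?X \<Otimes>\<^sub>M M))"
    unfolding phase_law_def by (subst nn_integral_distr) auto
  also have "\<dots> = (\<integral>\<^sup>+x. (\<integral>\<^sup>+\<omega>. f (passage x \<omega>) \<partial>M) \<partial>?X)"
    by (subst nn_integral_fst[symmetric]) auto
  also have "\<dots> = (\<integral>\<^sup>+x. ennreal (exponential_density (real k * mu) x) * (\<integral>\<^sup>+\<omega>. f (passage x \<omega>) \<partial>M) \<partial>lborel)"
    by (subst nn_integral_density) auto
  finally show ?thesis .
qed

lemma real_distribution_phase_law: "real_distribution phase_law"
proof -
  interpret X: prob_space "density lborel (\<lambda>x. ennreal (exponential_density (real k * mu) x))"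
    by (rule prob_space_exponential_density[OF kmu_pos])
  interpret P: pair_prob_space "density lborel (\<lambda>x. ennreal (exponential_density (real k * mu) x))" M ..
  show ?thesis
    unfolding phase_law_def by (rule P.real_distribution_distr) measurable
qed

lemma emeasure_phase_law: "emeasure phase_law {t<..} = phase_tail t"
proof -
  have "emeasure phase_law {t<..} = (\<integral>\<^sup>+y. indicator {t<..} y \<partial>phase_law)"
    by (subst nn_integral_indicator) (auto simp: phase_law_def)
  also have "\<dots> = phase_tail t"
    unfolding phase_tail_def passage_tail_def by (rule nn_integral_phase_law) measurable
  finally show ?thesis .
qed

lemma AE_phase_law_nonneg: "AE y in phase_law. 0 \<le> y"
proof -
  interpret L: real_distribution phase_law by (rule real_distribution_phase_law)
  have "emeasure phase_law {y \<in> space phase_law. \<not> 0 \<le> y} = (\<integral>\<^sup>+y. indicator {..<0} y \<partial>phase_law)"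
    by (subst nn_integral_indicator) (auto simp: not_le lessThan_def)
  also have "\<dots> = (\<integral>\<^sup>+x. ennreal (exponential_density (real k * mu) x) * (\<integral>\<^sup>+\<omega>. indicator {..<0} (passage x \<omega>) \<partial>M) \<partial>lborel)"
    by (rule nn_integral_phase_law) measurable
  also have "\<dots> = (\<integral>\<^sup>+x. 0 \<partial>(lborel :: real measure))"
  proof (rule nn_integral_cong)
    fix x :: real
    show "ennreal (exponential_density (real k * mu) x) * (\<integral>\<^sup>+\<omega>. indicator {..<0} (passage x \<omega>) \<partial>M) = 0"
    proof (cases "x < 0")
      case False
      have "AE \<omega> in M. indicator {..<0} (passage x \<omega>) = (0::ennreal)"
        using AE_passage_left_value
      proof eventually_elim
        case (elim \<omega>)
        then have "0 \<le> passage x \<omega>" using left_value_nonneg[of "\<lambda>s. D s \<omega>" x] False by simp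
        then show ?case by simp
      qed
      then have "(\<integral>\<^sup>+\<omega>. indicator {..<0} (passage x \<omega>) \<partial>M) = (\<integral>\<^sup>+\<omega>. 0 \<partial>M)"
        by (rule nn_integral_cong_AE)
      then show ?thesis by simp
    qed (simp add: exponential_density_def)
  qed
  finally have "emeasure phase_law {y \<in> space phase_law. \<not> 0 \<le> y} = 0" by simp
  then show ?thesis by (subst AE_iff_measurable[OF _ refl]) (auto simp: phase_law_def)
qed

lemma phase_law_laplace:
  assumes "0 < z"
  shows "(\<integral>y. exp (- z * y) \<partial>phase_law) = real k * mu / (real k * mu + (c1 * z powr \<alpha>1 + c2 * z powr \<alpha>2))"
proof -
  let ?km = "real k * mu"
  note km = kmu_pos and psi = psi_pos[OF assms]
  interpret L: real_distribution phase_law by (rule real_distribution_phase_law)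
  have inner: "(\<integral>\<^sup>+\<omega>. ennreal (exp (- z * passage x \<omega>)) \<partial>M) = ennreal (exp (- x * psi z))" if "0 \<le> x" for x
  proof -
    have "AE \<omega> in M. 0 \<le> passage x \<omega>"
      using AE_passage_left_value by eventually_elim (use left_value_nonneg that in auto)
    then have "integrable M (\<lambda>\<omega>. exp (- z * passage x \<omega>))"
      using assms by (intro integrable_const_bound[where B=1]) (auto elim!: eventually_mono)
    then show ?thesis
      using passage_laplace[OF that assms] by (subst nn_integral_eq_integral) auto
  qed
  have "(\<integral>\<^sup>+y. ennreal (exp (- z * y)) \<partial>phase_law) =
      (\<integral>\<^sup>+x. ennreal (exponential_density ?km x) * (\<integral>\<^sup>+\<omega>. ennreal (exp (- z * passage x \<omega>)) \<partial>M) \<partial>lborel)"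
    by (rule nn_integral_phase_law) measurable
  \<comment> \<open>The product of the exponential density and \<open>exp (- x * psi z)\<close> is a
    multiple of the exponential density of rate \<open>k * mu + psi z\<close>; that multiple is the
    transform sought.\<close>
  also have "\<dots> = (\<integral>\<^sup>+x. ennreal (?km / (?km + psi z)) * ennreal (exponential_density (?km + psi z) x) \<partial>lborel)"
  proof (rule nn_integral_cong)
    fix x :: real
    show "ennreal (exponential_density ?km x) * (\<integral>\<^sup>+\<omega>. ennreal (exp (- z * passage x \<omega>)) \<partial>M) =
        ennreal (?km / (?km + psi z)) * ennreal (exponential_density (?km + psi z) x)"
    proof (cases "x < 0")
      case False
      have "exp (- x * ?km) * exp (- x * psi z) = exp (- x * (?km + psi z))"
        by (simp add: algebra_simps flip: exp_add)
      then have "exponential_density ?km x * exp (- x * psi z) = ?km / (?km + psi z) * exponential_density (?km + psi z) x"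
        using False km psi by (simp add: exponential_density_def)
      moreover have "0 \<le> ?km / (?km + psi z)" using km psi by simp
      ultimately show ?thesis
        using False inner[of x] km by (simp add: ennreal_mult'[symmetric] ennreal_mult''[symmetric] del: times_divide_eq_left)
    qed (simp add: exponential_density_def)
  qed
  also have "\<dots> = ennreal (?km / (?km + psi z)) * (\<integral>\<^sup>+x. ennreal (exponential_density (?km + psi z) x) \<partial>lborel)"
    by (rule nn_integral_cmult) measurable
  also have "(\<integral>\<^sup>+x. ennreal (exponential_density (?km + psi z) x) \<partial>lborel) = 1"
  proof -
    interpret E: prob_space "density lborel (exponential_density (?km + psi z))"
      using km psi by (intro prob_space_exponential_density) simp
    show ?thesis using E.emeasure_space_1 by (subst (asm) emeasure_density) auto
  qed
  finally have "(\<integral>\<^sup>+y. ennreal (exp (- z * y)) \<partial>phase_law) = ennreal (?km / (?km + psi z))" by simp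
  then have "(\<integral>y. exp (- z * y) \<partial>phase_law) = ?km / (?km + psi z)"
    using km psi by (subst integral_eq_nn_integral) auto
  then show ?thesis by (simp add: psi_def)
qed

lemma phase_tail_eq: "phase_tail t = ennreal (measure phase_law {t<..})"
proof -
  interpret L: real_distribution phase_law by (rule real_distribution_phase_law)
  show ?thesis using emeasure_phase_law[of t] by (simp add: L.emeasure_eq_measure)
qed

text \<open>The threshold -1 imposes no condition, so it removes a phase from a joint tail.\<close>

lemma phase_tail_minus1: "phase_tail (-1) = 1"
proof -
  interpret L: real_distribution phase_law by (rule real_distribution_phase_law)
  have "AE y in phase_law. y \<in> {-1<..}" using AE_phase_law_nonneg by eventually_elim simp
  then have "measure phase_law {-1<..} = 1" by (subst L.prob_eq_1) auto
  then show ?thesis by (simp add: phase_tail_eq)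
qed

interpretation C: prob_space "completion M"
  by (rule prob_space_completion)

lemma AE_phase_time_lower: "AE \<omega> in completion M. \<forall>i. -1 < phase_time i \<omega>"
  unfolding AE_all_countable
proof
  fix j
  let ?A = "{\<omega> \<in> space M. \<forall>i<Suc j. -1 < phase_time i \<omega>}"
  have "C.prob ?A = 1"
    by (simp only: measure_def emeasure_phase_times(2) phase_tail_minus1 prod.neutral_const enn2real_1)
  then have "AE \<omega> in completion M. \<omega> \<in> ?A"
    by (rule C.AE_prob_1)
  then show "AE \<omega> in completion M. -1 < phase_time j \<omega>"
    by eventually_elim auto
qed

lemma phase_time_gt:
  "{\<omega> \<in> space M. t < phase_time j \<omega>} \<in> sets (completion M)"
  "emeasure (completion M) {\<omega> \<in> space M. t < phase_time j \<omega>} = phase_tail t"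
proof -
  \<comment> \<open>The marginal tail of phase \<open>j\<close> is read off the joint tail of the
    first \<open>Suc j\<close> phases, with threshold -1 for all the others.\<close>
  let ?t = "\<lambda>i. if i = j then t else -1"
  let ?A = "{\<omega> \<in> space M. \<forall>i<Suc j. ?t i < phase_time i \<omega>}"
  have AE: "AE \<omega> in M. \<omega> \<in> {\<omega> \<in> space M. t < phase_time j \<omega>} \<longleftrightarrow> \<omega> \<in> ?A"
    using AE_phase_time_lower unfolding AE_completion_iff by eventually_elim auto
  note A = emeasure_phase_times[of "Suc j" ?t]
  show "{\<omega> \<in> space M. t < phase_time j \<omega>} \<in> sets (completion M)"
    by (rule AE_eq_imp_sets_completion(1)[OF A(1) _ AE]) auto
  have "emeasure (completion M) {\<omega> \<in> space M. t < phase_time j \<omega>} = emeasure (completion M) ?A"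
    by (rule AE_eq_imp_sets_completion(2)[OF A(1) _ AE]) auto
  also have "\<dots> = (\<Prod>i<Suc j. if i = j then phase_tail t else 1)"
    unfolding A(2) by (intro prod.cong) (auto simp: phase_tail_minus1)
  also have "\<dots> = phase_tail t" by simp
  finally show "emeasure (completion M) {\<omega> \<in> space M. t < phase_time j \<omega>} = phase_tail t" .
qed

lemma measurable_phase_time [measurable]: "phase_time j \<in> borel_measurable (completion M)"
  unfolding borel_measurable_iff_greater space_completion using phase_time_gt(1) by blast

lemma prob_phase_time_gt: "C.prob {\<omega> \<in> space M. t < phase_time j \<omega>} = measure phase_law {t<..}"
  by (subst measure_def) (simp only: phase_time_gt(2) phase_tail_eq enn2real_ennreal[OF measure_nonneg])

lemma indep_phase_times: "C.indep_vars (\<lambda>_. borel) phase_time UNIV"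
proof -
  have fin: "C.indep_vars (\<lambda>_. borel) phase_time {..<n}" for n
  proof (rule C.indep_vars_of_tails)
    show "C.prob {\<omega> \<in> space (completion M). \<forall>i\<in>{..<n}. t i < phase_time i \<omega>} =
        (\<Prod>i<n. C.prob {\<omega> \<in> space (completion M). t i < phase_time i \<omega>})" for t
    proof -
      have "C.prob {\<omega> \<in> space M. \<forall>i<n. t i < phase_time i \<omega>} = (\<Prod>i<n. measure phase_law {t i<..})"
        by (subst measure_def)
          (simp only: emeasure_phase_times(2) phase_tail_eq prod_ennreal[OF measure_nonneg]
            enn2real_ennreal[OF prod_nonneg[OF measure_nonneg]])
      then show ?thesis
        by (simp only: space_completion prob_phase_time_gt Ball_def lessThan_iff)
    qed
  next
    show "AE \<omega> in completion M. -1 < phase_time i \<omega>" for i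
      using AE_phase_time_lower by eventually_elim simp
  qed simp_all
  show ?thesis
    unfolding C.indep_vars_def2
  proof
    show "\<forall>i\<in>UNIV. C.random_variable borel (phase_time i)" by simp
    show "C.indep_sets (\<lambda>i. {phase_time i -` A \<inter> space (completion M) | A. A \<in> sets borel}) UNIV"
    proof (subst C.indep_sets_finite_index_sets, intro allI impI)
      fix J :: "nat set" assume "J \<subseteq> UNIV" "J \<noteq> {}" "finite J"
      \<comment> \<open>Independence of an infinite family is tested on finite subfamilies, and each
        of these lies in an initial segment, where the joint tails are known.\<close>
      then have "J \<subseteq> {..<Suc (Max J)}" by (auto simp: less_Suc_eq_le)
      with fin have "C.indep_vars (\<lambda>_. borel) phase_time J" by (rule C.indep_vars_subset)
      then show "C.indep_sets (\<lambda>i. {phase_time i -` A \<inter> space (completion M) | A. A \<in> sets borel}) J"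
        unfolding C.indep_vars_def2 by blast
    qed
  qed
qed

lemma distr_phase_time: "distr (completion M) borel (phase_time j) = phase_law"
proof (rule cdf_unique)
  interpret L: real_distribution phase_law by (rule real_distribution_phase_law)
  show L: "real_distribution phase_law" by (rule real_distribution_phase_law)
  show R: "real_distribution (distr (completion M) borel (phase_time j))"
    by (rule C.real_distribution_distr) measurable
  interpret R: real_distribution "distr (completion M) borel (phase_time j)" by (rule R)
  have compl: "cdf N t = 1 - measure N {t<..}" if "real_distribution N" for N t
  proof -
    interpret N: real_distribution N by fact
    have "{..t} = space N - {t<..}" by auto
    then show ?thesis using N.prob_compl[of "{t<..}"] by (simp add: cdf_def)
  qed
  have "measure (distr (completion M) borel (phase_time j)) {t<..} = measure phase_law {t<..}" for t
    unfolding prob_phase_time_gt[symmetric, of t j]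
    by (subst measure_distr) (auto intro!: arg_cong[where f="C.prob"])
  then show "cdf (distr (completion M) borel (phase_time j)) = cdf phase_law"
    by (intro ext) (simp only: compl[OF L] compl[OF R])
qed

end

theorem theorem3p7:
  fixes M :: "'a measure"
    and Q :: "real \<Rightarrow> 'a \<Rightarrow> nat \<times> nat"
    and D :: "real \<Rightarrow> 'a \<Rightarrow> real"
    and lam mu c1 c2 \<alpha>1 \<alpha>2 :: real
    and k :: nat
  defines "Y \<equiv> inverse_process D"
  defines "P \<equiv> (\<lambda>j \<omega>. inter_phase_time k (\<lambda>t. time_change Q Y t \<omega>) j)"
  defines "F \<equiv> (\<lambda>t r. (- c2 / c1) ^ r * t powr ((\<alpha>1 - \<alpha>2) * real r)
      * mittag_leffler (real r + 1) \<alpha>1 ((\<alpha>1 - \<alpha>2) * real r + 1) (- (real k * mu / c1) * t powr \<alpha>1))"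
  defines "G \<equiv> (\<lambda>t r. (- c2 / c1) ^ (r + 1) * t powr ((\<alpha>1 - \<alpha>2) * (real r + 1))
      * mittag_leffler (real r + 1) \<alpha>1 ((\<alpha>1 - \<alpha>2) * (real r + 1) + 1) (- (real k * mu / c1) * t powr \<alpha>1))"
  assumes "prob_space M"
    and "0 < lam" and "0 < mu" and "1 \<le> k"
    and "0 < \<alpha>2" and "\<alpha>2 < \<alpha>1" and "\<alpha>1 < 1"
    and "0 < c1" and "0 \<le> c2" and "c1 + c2 = 1"
    and "prob_space.erlang_queue M lam mu k Q"
    and "prob_space.mixed_stable_subordinator M c1 c2 \<alpha>1 \<alpha>2 D"
    and "prob_space.indep_processes M Q (count_space UNIV) Y borel"
  shows "prob_space.indep_vars (completion M) (\<lambda>_. borel) P UNIV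
    \<and> (\<forall>i j. distr (completion M) borel (P i) = distr (completion M) borel (P j))
    \<and> (\<forall>j. \<forall>t>0. summable (F t) \<and> summable (G t) \<and>
          measure (completion M) {\<omega> \<in> space M. t < P j \<omega>} = (\<Sum>r. F t r) - (\<Sum>r. G t r))"
proof -
  interpret prob_space M by fact
  obtain Z S where ZS:
    "\<forall>n::nat. random_variable (count_space UNIV) (Z n)" "\<forall>n::nat. random_variable borel (S n)"
    "\<forall>n z s. (\<forall>i<n. 0 \<le> s i) \<longrightarrow>
        prob {\<omega> \<in> space M. (\<forall>i\<le>n. Z i \<omega> = z i) \<and> (\<forall>i<n. s i < S i \<omega>)} =
          (if z 0 = (0, 0) then
             (\<Prod>i<n. erlang_rate lam mu k (z i) (z (Suc i)) / exit_rate (erlang_rate lam mu k) (z i) *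
               exp (- exit_rate (erlang_rate lam mu k) (z i) * s i))
           else 0)"
    "AE \<omega> in M. \<forall>t\<ge>0. \<exists>n. (\<Sum>i<n. S i \<omega>) \<le> t \<and> t < (\<Sum>i<Suc n. S i \<omega>) \<and> Q t \<omega> = Z n \<omega>"
    using \<open>prob_space.erlang_queue M lam mu k Q\<close> unfolding erlang_queue_def ctmc_def by blast
  note indep = \<open>prob_space.indep_processes M Q (count_space UNIV) Y borel\<close>[unfolded indep_processes_def Let_def Y_def]
  interpret time_changed_erlang M lam mu k Q Z S D c1 c2 \<alpha>1 \<alpha>2
  proof unfold_locales
    show "mixed_stable_subordinator c1 c2 \<alpha>1 \<alpha>2 D" by fact
  qed (use assms(5-14) ZS indep in auto)
  have P: "P = phase_time" by (simp add: P_def Y_def phase_time_def fun_eq_iff)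
  have "summable (F t) \<and> summable (G t) \<and>
      measure (completion M) {\<omega> \<in> space M. t < P j \<omega>} = (\<Sum>r. F t r) - (\<Sum>r. G t r)" if "0 < t" for j t
    unfolding F_def G_def P prob_phase_time_gt
    using tail_eq_mittag_leffler_series[OF real_distribution_phase_law AE_phase_law_nonneg kmu_pos _ _ _ _ phase_law_laplace \<open>0 < t\<close>]
      assms(5-14) by auto
  then show ?thesis
    unfolding P using indep_phase_times by (auto simp: distr_phase_time)
qed

end
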